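(* Let $(M^{2n},J,\omega)$ be a compact connected Hermitian manifold of complex dimension $n\ge2$. For all $r,t\in\mathbb R$, $$\mu^{r,t}(\omega)=\mu^{1,t}(\omega)-\frac{n-1}{2}(r-1)|\mathring T|^2 .$$
   Context: Setting. $(M^{2n},J)$ is a compact connected complex manifold, $n=\dim_{\mathbb C}M\ge2$; $\omega$ is a Hermitian metric with associated Riemannian metric $g$, $\omega(X,Y)=g(JX,Y)$, $\omega=\sqrt{-1}\,h_{i\bar j}\,dz^i\wedge d\bar z^j$. $d^*$ is the formal adjoint of $d$. The Lee form $\theta$ is defined by $d\omega^{n-1}=\theta\wedge\omega^{n-1}$. For a real $k$-form, $J\alpha(X_1,\dots,X_k)=(-1)^k\alpha(JX_1,\dots,JX_k)$. Gauduchon connections $\nabla^r$, $r\in\mathbb R$: $g(\nabla^r_XY,Z)=g(\nabla^g_XY,Z)+\frac{r-1}{4}Jd\omega(X,Y,Z)-\frac{1+r}{4}d\omega(JX,Y,Z)$, with $\nabla^g$ the Levi-Civita connection; $r=1$ is the Chern connection. $T^r$ is the torsion of $\nabla^r$; the Chern torsion $T=T^1$ has components $T^k_{ij}=h^{k\bar\ell}(\partial_ih_{j\bar\ell}-\partial_jh_{i\bar\ell})$, and $\theta_i=\sum_kT^k_{ik}$. Norms are full real tensor norms: in a frame with $h_{i\bar j}=\delta_{ij}$, $|T|^2=2\sum_{i,j,k}|T^k_{ij}|^2$ and $|\theta|^2=2\sum_i|\theta_i|^2$. Scalar curvature: $\mathrm{scal}^r=2\,\mathrm{tr}_\omega(\mathrm{Ric}^r)^{1,1}$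 where $\mathrm{Ric}^r=\frac{r-1}{2}dd^*\omega-\sqrt{-1}\partial\bar\partial\log\omega^n$. The trace-free Chern torsion is $(\mathring T)^k_{ij}=T^k_{ij}-\frac1{n-1}(\delta^k_j\theta_i-\delta^k_i\theta_j)$ (same norm convention as $T$). With $A_r=1+(n-1)r$, $K_r=3r^2-2r+1>0$, $$\mu^{r,t}(\omega)=\mathrm{scal}^r+\frac{t-A_r}{n-1}d^*\theta+\frac{t-2A_r}{2K_r}|T^r|^2 .$$ *)

theory Defs
  imports "HOL-Analysis.Analysis" "HOL-Combinatorics.Permutations"
begin

section \<open>Smooth functions and differential forms on open subsets of \<open>\<complex>\<^sup>n\<close>\<close>

text \<open>
  \<open>\<complex>\<^sup>n\<close> is \<open>complex^'n\<close>, a real Euclidean space of dimension \<open>2 CARD('n)\<close>.  A real tangent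
  vector \<open>X\<close> at a point of an open subset is an element of \<open>complex^'n\<close> with \<open>X $ i = dz\<^sup>i(X)\<close>;
  hence \<open>\<partial>/\<partial>x\<^sup>i\<close> is \<open>axis i 1\<close>, \<open>\<partial>/\<partial>y\<^sup>i\<close> is \<open>axis i \<i>\<close>, and the complex structure is
  multiplication by \<open>\<i>\<close>.
\<close>

type_synonym 'n tvec = "complex^'n"
type_synonym 'n form = "'n tvec list \<Rightarrow> real"
type_synonym 'n form_field = "'n tvec \<Rightarrow> 'n form"
type_synonym 'n metric = "'n tvec \<Rightarrow> 'n tvec \<Rightarrow> real"
type_synonym 'n metric_field = "'n tvec \<Rightarrow> 'n metric"
type_synonym 'n tensor21 = "'n tvec \<Rightarrow> 'n tvec \<Rightarrow> 'n tvec"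

abbreviation (input) dir_deriv :: "('a::real_normed_vector \<Rightarrow> 'b::real_normed_vector) \<Rightarrow> 'a \<Rightarrow> 'a \<Rightarrow> 'b"
  where "dir_deriv f z v \<equiv> frechet_derivative f (at z) v"

text \<open>The next two definitions are meant for open \<open>S\<close>.\<close>

primrec Ck_on :: "nat \<Rightarrow> 'a::real_normed_vector set \<Rightarrow> ('a \<Rightarrow> 'b::real_normed_vector) \<Rightarrow> bool" where
  "Ck_on 0 S f \<longleftrightarrow> continuous_on S f"
| "Ck_on (Suc k) S f \<longleftrightarrow> (\<forall>z\<in>S. f differentiable (at z)) \<and> (\<forall>v. Ck_on k S (\<lambda>z. dir_deriv f z v))"

definition smooth_on :: "'a::real_normed_vector set \<Rightarrow> ('a \<Rightarrow> 'b::real_normed_vector) \<Rightarrow> bool" where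
  "smooth_on S f \<longleftrightarrow> (\<forall>k. Ck_on k S f)"

definition J :: "'n::finite tvec \<Rightarrow> 'n tvec" where
  "J X = \<i> *s X"

text \<open>A \<open>k\<close>-form is a function on lists of vectors; only its values on lists of length \<open>k\<close> matter.\<close>

definition alternating_form :: "nat \<Rightarrow> 'n::finite form \<Rightarrow> bool" where
  "alternating_form k a \<longleftrightarrow>
     (\<forall>vs i. length vs = k \<longrightarrow> i < k \<longrightarrow> linear (\<lambda>v. a (vs[i := v]))) \<and>
     (\<forall>vs i j. length vs = k \<longrightarrow> i < j \<longrightarrow> j < k \<longrightarrow> vs ! i = vs ! j \<longrightarrow> a vs = 0)"

definition form_on :: "'n::finite tvec set \<Rightarrow> nat \<Rightarrow> 'n form_field \<Rightarrow> bool" where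
  "form_on V k \<alpha> \<longleftrightarrow>
     (\<forall>z\<in>V. alternating_form k (\<alpha> z)) \<and>
     (\<forall>vs. length vs = k \<longrightarrow> smooth_on V (\<lambda>z. \<alpha> z vs))"

text \<open>
  Wedge product and exterior derivative in the same (usual) normalization:
  \<open>(\<alpha> \<and> \<beta>)(X,Y) = \<alpha>(X)\<beta>(Y) - \<alpha>(Y)\<beta>(X)\<close> and \<open>d\<alpha>(X,Y) = X \<alpha>(Y) - Y \<alpha>(X)\<close> for
  1-forms and constant vector fields.
\<close>

definition wedge :: "nat \<Rightarrow> nat \<Rightarrow> 'n::finite form \<Rightarrow> 'n form \<Rightarrow> 'n form" where
  "wedge p q a b vs =
     (\<Sum>\<sigma> | \<sigma> permutes {..<p + q}.
        of_int (sign \<sigma>) * a (take p (permute_list \<sigma> vs)) * b (drop p (permute_list \<sigma> vs)))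
     / (fact p * fact q)"

primrec wedge_power2 :: "'n::finite form \<Rightarrow> nat \<Rightarrow> 'n form" where
  "wedge_power2 a 0 = (\<lambda>vs. 1)"
| "wedge_power2 a (Suc k) = wedge 2 (2 * k) a (wedge_power2 a k)"

definition ext_d :: "'n::finite form_field \<Rightarrow> 'n form_field" where
  "ext_d \<alpha> z vs =
     (\<Sum>i<length vs. (- 1) ^ i * dir_deriv (\<lambda>w. \<alpha> w (take i vs @ drop (Suc i) vs)) z (vs ! i))"

definition J_form :: "'n::finite form \<Rightarrow> 'n form" where
  "J_form a vs = (- 1) ^ length vs * a (map J vs)"


section \<open>Metric contractions and the formal adjoint of \<open>d\<close>\<close>

definition real_coord :: "'n::finite + 'n \<Rightarrow> 'n tvec" where
  "real_coord = case_sum (\<lambda>i. axis i 1) (\<lambda>i. axis i \<i>)"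

definition orthonormal_frame :: "'n::finite metric \<Rightarrow> ('n + 'n \<Rightarrow> 'n tvec) \<Rightarrow> bool" where
  "orthonormal_frame g e \<longleftrightarrow> (\<forall>a b. g (e a) (e b) = (if a = b then 1 else 0))"

text \<open>The trace of a bilinear form does not depend on the chosen orthonormal frame.\<close>

definition metric_trace :: "'n::finite metric \<Rightarrow> ('n tvec \<Rightarrow> 'n tvec \<Rightarrow> real) \<Rightarrow> real" where
  "metric_trace g B = (let e = (SOME e. orthonormal_frame g e) in \<Sum>a\<in>UNIV. B (e a) (e a))"

text \<open>
  Inner product of \<open>k\<close>-forms, \<open>1/k!\<close> times the full tensor inner product, so that
  the wedge products of an orthonormal coframe with increasing indices are orthonormal.  This is the inner product that
  defines \<open>d\<^sup>*\<close>; on 1-forms it agrees with the full tensor inner product.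
\<close>

primrec form_inner :: "'n::finite metric \<Rightarrow> nat \<Rightarrow> 'n form \<Rightarrow> 'n form \<Rightarrow> real" where
  "form_inner g 0 a b = a [] * b []"
| "form_inner g (Suc k) a b =
     metric_trace g (\<lambda>X Y. form_inner g k (\<lambda>vs. a (X # vs)) (\<lambda>vs. b (Y # vs))) / real (Suc k)"

text \<open>Full real tensor norm (squared) of a vector-valued bilinear map.\<close>

definition tensor_norm_sq :: "'n::finite metric \<Rightarrow> 'n tensor21 \<Rightarrow> real" where
  "tensor_norm_sq g T =
     metric_trace g (\<lambda>X X'. metric_trace g (\<lambda>Y Y'. g (T X Y) (T X' Y')))"

definition volume_density :: "'n::finite metric \<Rightarrow> real" where
  "volume_density g = sqrt (det (\<chi> a b. g (real_coord a) (real_coord b)))"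

definition L2_inner ::
  "'n::finite tvec set \<Rightarrow> 'n metric_field \<Rightarrow> nat \<Rightarrow> 'n form_field \<Rightarrow> 'n form_field \<Rightarrow> real" where
  "L2_inner V g k \<alpha> \<beta> =
     (LINT z:V|lborel. form_inner (g z) k (\<alpha> z) (\<beta> z) * volume_density (g z))"

definition compactly_supported_in :: "'n::finite tvec set \<Rightarrow> 'n form_field \<Rightarrow> bool" where
  "compactly_supported_in V \<alpha> \<longleftrightarrow>
     (\<exists>K. compact K \<and> K \<subseteq> V \<and> (\<forall>z\<in>V - K. \<forall>vs. \<alpha> z vs = 0))"

text \<open>
  \<open>codiff V g k \<beta>\<close> is \<open>d\<^sup>*\<beta>\<close> for a \<open>(k+1)\<close>-form \<open>\<beta>\<close>: the image of \<open>\<beta>\<close> under the formal adjoint of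
  \<open>d\<close> from \<open>k\<close>-forms to \<open>(k+1)\<close>-forms.  Test forms with compact support in \<open>V\<close> determine it at
  all points of \<open>V\<close>, and only its values there are used.
\<close>

definition codiff ::
  "'n::finite tvec set \<Rightarrow> 'n metric_field \<Rightarrow> nat \<Rightarrow> 'n form_field \<Rightarrow> 'n form_field" where
  "codiff V g k \<beta> =
     (SOME \<gamma>. form_on V k \<gamma> \<and>
        (\<forall>\<alpha>. form_on V k \<alpha> \<longrightarrow> compactly_supported_in V \<alpha> \<longrightarrow>
           L2_inner V g (Suc k) (ext_d \<alpha>) \<beta> = L2_inner V g k \<alpha> \<gamma>))"


section \<open>Local Hermitian geometry\<close>

text \<open>
  From here on \<open>\<omega>\<close> is the fundamental form of a Hermitian metric on an open set \<open>V\<close>.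
  Since \<open>\<omega>(X,Y) = g(JX,Y)\<close> and \<open>g\<close> is \<open>J\<close>-invariant, \<open>g(X,Y) = \<omega>(X,JY)\<close>.
\<close>

definition assoc_metric :: "'n::finite form_field \<Rightarrow> 'n metric_field" where
  "assoc_metric \<omega> z X Y = \<omega> z [X, J Y]"

definition is_lee_form :: "'n::finite tvec set \<Rightarrow> 'n form_field \<Rightarrow> 'n form_field \<Rightarrow> bool" where
  "is_lee_form V \<omega> \<theta> \<longleftrightarrow> form_on V 1 \<theta> \<and>
     (let m = CARD('n) - 1 in
      \<forall>z\<in>V. \<forall>vs. length vs = 2 * m + 1 \<longrightarrow>
        ext_d (\<lambda>w. wedge_power2 (\<omega> w) m) z vs = wedge 1 (2 * m) (\<theta> z) (wedge_power2 (\<omega> z) m) vs)"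

text \<open>The condition determines the Lee form at every point of \<open>V\<close>.\<close>

definition lee_form :: "'n::finite tvec set \<Rightarrow> 'n form_field \<Rightarrow> 'n form_field" where
  "lee_form V \<omega> = (SOME \<theta>. is_lee_form V \<omega> \<theta>)"

text \<open>
  A connection is given by its Christoffel tensor \<open>\<Gamma>\<close> in the coordinates: \<open>\<nabla>\<^sub>X Y = D\<^sub>X Y + \<Gamma>(X,Y)\<close>.
  For constant vector fields \<open>X, Y\<close> this is \<open>\<Gamma>(X,Y)\<close>.
\<close>

definition levi_civita :: "'n::finite metric_field \<Rightarrow> 'n tvec \<Rightarrow> 'n tensor21" where
  "levi_civita g z = (THE \<Gamma>. bilinear \<Gamma> \<and> (\<forall>X Y. \<Gamma> X Y = \<Gamma> Y X) \<and>
     (\<forall>X Y Z. dir_deriv (\<lambda>w. g w Y Z) z X = g z (\<Gamma> X Y) Z + g z Y (\<Gamma> X Z)))"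

definition gauduchon :: "real \<Rightarrow> 'n::finite form_field \<Rightarrow> 'n tvec \<Rightarrow> 'n tensor21" where
  "gauduchon r \<omega> z X Y = (let g = assoc_metric \<omega> in
     THE W. \<forall>Z. g z W Z = g z (levi_civita g z X Y) Z
        + (r - 1) / 4 * J_form (ext_d \<omega> z) [X, Y, Z]
        - (1 + r) / 4 * ext_d \<omega> z [J X, Y, Z])"

text \<open>Torsion \<open>\<nabla>\<^sub>X Y - \<nabla>\<^sub>Y X - [X,Y]\<close>, evaluated on constant vector fields.\<close>

definition torsion :: "real \<Rightarrow> 'n::finite form_field \<Rightarrow> 'n tvec \<Rightarrow> 'n tensor21" where
  "torsion r \<omega> z X Y = gauduchon r \<omega> z X Y - gauduchon r \<omega> z Y X"

text \<open>
  Components \<open>T\<^sup>k\<^sub>i\<^sub>j = dz\<^sup>k(T(\<partial>\<^sub>i,\<partial>\<^sub>j))\<close> and \<open>\<theta>\<^sub>i = \<theta>(\<partial>\<^sub>i)\<close> of the complex multilinear extensions, where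
  \<open>\<partial>\<^sub>i = (\<partial>/\<partial>x\<^sup>i - \<i> \<partial>/\<partial>y\<^sup>i) / 2\<close>.
\<close>

definition chern_torsion_comp ::
  "'n::finite form_field \<Rightarrow> 'n tvec \<Rightarrow> 'n \<Rightarrow> 'n \<Rightarrow> 'n \<Rightarrow> complex" where
  "chern_torsion_comp \<omega> z k i j = (let T = torsion 1 \<omega> z in
     (T (axis i 1) (axis j 1) $ k - T (axis i \<i>) (axis j \<i>) $ k
      - \<i> * (T (axis i 1) (axis j \<i>) $ k + T (axis i \<i>) (axis j 1) $ k)) / 4)"

definition lee_comp ::
  "'n::finite tvec set \<Rightarrow> 'n form_field \<Rightarrow> 'n tvec \<Rightarrow> 'n \<Rightarrow> complex" where
  "lee_comp V \<omega> z i =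
     (of_real (lee_form V \<omega> z [axis i 1]) - \<i> * of_real (lee_form V \<omega> z [axis i \<i>])) / 2"

definition tracefree_torsion_comp ::
  "'n::finite tvec set \<Rightarrow> 'n form_field \<Rightarrow> 'n tvec \<Rightarrow> 'n \<Rightarrow> 'n \<Rightarrow> 'n \<Rightarrow> complex" where
  "tracefree_torsion_comp V \<omega> z k i j = chern_torsion_comp \<omega> z k i j
     - ((if k = j then lee_comp V \<omega> z i else 0) - (if k = i then lee_comp V \<omega> z j else 0))
       / (of_nat CARD('n) - 1)"

text \<open>
  The real tensor whose complexification has the components above on \<open>(\<partial>\<^sub>i, \<partial>\<^sub>j)\<close>, their
  conjugates on the conjugate vectors, and vanishes on mixed pairs.
\<close>

definition tracefree_torsion ::
  "'n::finite tvec set \<Rightarrow> 'n form_field \<Rightarrow> 'n tvec \<Rightarrow> 'n tensor21" where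
  "tracefree_torsion V \<omega> z X Y =
     (\<chi> k. \<Sum>i\<in>UNIV. \<Sum>j\<in>UNIV. tracefree_torsion_comp V \<omega> z k i j * X $ i * Y $ j)"


subsection \<open>Ricci form and scalar curvature of the Gauduchon connections\<close>

definition d_z :: "'n::finite \<Rightarrow> ('n tvec \<Rightarrow> complex) \<Rightarrow> 'n tvec \<Rightarrow> complex" where
  "d_z i f z = (dir_deriv f z (axis i 1) - \<i> * dir_deriv f z (axis i \<i>)) / 2"

definition d_zbar :: "'n::finite \<Rightarrow> ('n tvec \<Rightarrow> complex) \<Rightarrow> 'n tvec \<Rightarrow> complex" where
  "d_zbar j f z = (dir_deriv f z (axis j 1) + \<i> * dir_deriv f z (axis j \<i>)) / 2"

text \<open>The real 2-form \<open>\<i> \<partial>\<partial>\<^bsup>bar\<^esup> f = \<i> f\<^sub>i\<^sub>j dz\<^sup>i \<and> dz\<^sup>j\<^bsup>bar\<^esup>\<close> of a real function \<open>f\<close>.\<close>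

definition i_ddbar :: "('n::finite tvec \<Rightarrow> real) \<Rightarrow> 'n form_field" where
  "i_ddbar f z vs = Re (\<i> * (\<Sum>i\<in>UNIV. \<Sum>j\<in>UNIV. d_z i (d_zbar j (\<lambda>w. of_real (f w))) z *
     ((vs ! 0) $ i * cnj ((vs ! 1) $ j) - (vs ! 1) $ i * cnj ((vs ! 0) $ j))))"

text \<open>
  \<open>\<omega> = \<i> h\<^sub>i\<^sub>j dz\<^sup>i \<and> dz\<^sup>j\<^bsup>bar\<^esup>\<close> means \<open>h\<^sub>i\<^sub>j = g(\<partial>\<^sub>i, \<partial>\<^sub>j\<^bsup>bar\<^esup>)\<close> for the complex bilinear extension of \<open>g\<close>;
  by \<open>J\<close>-invariance this is the expression below.  In particular \<open>g(X,X) = 2 h\<^sub>i\<^sub>j X\<^sup>i X\<^sup>j\<^bsup>bar\<^esup>\<close>.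
\<close>

definition herm_matrix :: "'n::finite form_field \<Rightarrow> 'n tvec \<Rightarrow> complex^'n^'n" where
  "herm_matrix \<omega> z = (\<chi> i j.
     (of_real (assoc_metric \<omega> z (axis i 1) (axis j 1)) - \<i> * of_real (\<omega> z [axis i 1, axis j 1])) / 2)"

text \<open>
  In holomorphic coordinates \<open>\<omega>\<^sup>n\<close> is \<open>det h\<close> times a constant volume form, so
  \<open>\<i> \<partial>\<partial>\<^bsup>bar\<^esup> log \<omega>\<^sup>n = \<i> \<partial>\<partial>\<^bsup>bar\<^esup> log det h\<close>; \<open>det h\<close> is real and positive.
\<close>

definition ricci_form :: "real \<Rightarrow> 'n::finite tvec set \<Rightarrow> 'n form_field \<Rightarrow> 'n form_field" where
  "ricci_form r V \<omega> z vs =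
     (r - 1) / 2 * ext_d (codiff V (assoc_metric \<omega>) 1 \<omega>) z vs
     - i_ddbar (\<lambda>w. ln (Re (det (herm_matrix \<omega> w)))) z vs"

definition part11 :: "'n::finite form \<Rightarrow> 'n form" where
  "part11 a vs = (a vs + a (map J vs)) / 2"

text \<open>
  For a real (1,1)-form \<open>a = \<i> a\<^sub>i\<^sub>j dz\<^sup>i \<and> dz\<^sup>j\<^bsup>bar\<^esup>\<close> this is \<open>h\<^sup>i\<^sup>j a\<^sub>i\<^sub>j\<close>; the trace of \<open>\<omega>\<close> itself is \<open>n\<close>.
\<close>

definition trace_omega :: "'n::finite metric \<Rightarrow> 'n form \<Rightarrow> real" where
  "trace_omega g a = metric_trace g (\<lambda>X Y. a [X, J Y]) / 2"

definition scal :: "real \<Rightarrow> 'n::finite tvec set \<Rightarrow> 'n form_field \<Rightarrow> 'n tvec \<Rightarrow> real" where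
  "scal r V \<omega> z = 2 * trace_omega (assoc_metric \<omega> z) (part11 (ricci_form r V \<omega> z))"


subsection \<open>The function \<open>\<mu>\<close>\<close>

definition mu :: "real \<Rightarrow> real \<Rightarrow> 'n::finite tvec set \<Rightarrow> 'n form_field \<Rightarrow> 'n tvec \<Rightarrow> real" where
  "mu r t V \<omega> z = (let n = real CARD('n); A = 1 + (n - 1) * r; K = 3 * r\<^sup>2 - 2 * r + 1 in
     scal r V \<omega> z
     + (t - A) / (n - 1) * codiff V (assoc_metric \<omega>) 0 (lee_form V \<omega>) z []
     + (t - 2 * A) / (2 * K) * tensor_norm_sq (assoc_metric \<omega> z) (torsion r \<omega> z))"


section \<open>Complex manifolds and Hermitian metrics\<close>

type_synonym ('m, 'n) hol_chart = "'m set \<times> ('m \<Rightarrow> complex^'n)"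

definition holomorphic_map_on :: "(complex^'n) set \<Rightarrow> (complex^'n::finite \<Rightarrow> complex^'n) \<Rightarrow> bool" where
  "holomorphic_map_on S f \<longleftrightarrow>
     (\<forall>z\<in>S. \<exists>f'. (f has_derivative f') (at z) \<and> (\<forall>v. f' (J v) = J (f' v)))"

definition transition ::
  "('m, 'n::finite) hol_chart \<Rightarrow> ('m, 'n) hol_chart \<Rightarrow> complex^'n \<Rightarrow> complex^'n" where
  "transition c c' = snd c' \<circ> inv_into (fst c) (snd c)"

text \<open>
  Second countability is not listed, as it is automatic for compact spaces.
\<close>

definition complex_manifold :: "'m topology \<Rightarrow> ('m, 'n::finite) hol_chart set \<Rightarrow> bool" where
  "complex_manifold M A \<longleftrightarrow>
     Hausdorff_space M \<and>
     topspace M = (\<Union>(U, \<phi>)\<in>A. U) \<and>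
     (\<forall>(U, \<phi>)\<in>A. openin M U \<and> open (\<phi> ` U) \<and>
        homeomorphic_map (subtopology M U) (top_of_set (\<phi> ` U)) \<phi>) \<and>
     (\<forall>c\<in>A. \<forall>c'\<in>A. holomorphic_map_on (snd c ` (fst c \<inter> fst c')) (transition c c'))"

text \<open>
  A tensor field on the manifold is the family of its coordinate expressions, one for every
  chart, related by pullback along the transition maps.
\<close>

definition hermitian_metric ::
  "('m, 'n::finite) hol_chart set \<Rightarrow> (('m, 'n) hol_chart \<Rightarrow> 'n form_field) \<Rightarrow> bool" where
  "hermitian_metric A \<omega> \<longleftrightarrow>
     (\<forall>c\<in>A. form_on (snd c ` fst c) 2 (\<omega> c) \<and>
        (\<forall>z\<in>snd c ` fst c.
           (\<forall>X Y. \<omega> c z [J X, J Y] = \<omega> c z [X, Y]) \<and>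
           (\<forall>X. X \<noteq> 0 \<longrightarrow> \<omega> c z [X, J X] > 0))) \<and>
     (\<forall>c\<in>A. \<forall>c'\<in>A. \<forall>z\<in>snd c ` (fst c \<inter> fst c'). \<forall>X Y.
        \<omega> c z [X, Y] = \<omega> c' (transition c c' z)
          [dir_deriv (transition c c') z X, dir_deriv (transition c c') z Y])"

end

theory Submission
  imports Defs
begin

text \<open>
  Everything is local: on a coordinate patch, \<open>\<mu>\<^sup>r\<^sup>,\<^sup>t - \<mu>\<^sup>1\<^sup>,\<^sup>t\<close> is expressed through
  \<open>d\<^sup>*\<theta>\<close>, \<open>|\<theta>|\<^sup>2\<close> and \<open>|T|\<^sup>2\<close>.  Four facts are combined.

  (1) \<open>\<theta> = \<Lambda> d\<omega>\<close>.  The form \<open>d\<omega> \<and> \<omega>\<^bsup>n-1\<^esup>\<close> vanishes for degree reasons, and contracting it with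
  \<open>\<omega>\<close> gives \<open>(n-1) d\<omega> \<and> \<omega>\<^bsup>n-2\<^esup> = \<Lambda> d\<omega> \<and> \<omega>\<^bsup>n-1\<^esup>\<close>.

  (2) \<open>d\<^sup>*\<omega> = \<theta> \<circ> J\<close>, and \<open>tr\<^sub>\<omega> d(\<theta> \<circ> J) = d\<^sup>*\<theta> + |\<theta>|\<^sup>2\<close>.  For a test form \<open>\<alpha>\<close>, the function
  \<open>tr\<^sub>\<omega> d\<alpha> - \<langle>\<alpha>, \<theta> \<circ> J\<rangle>\<close> is the divergence of the vector field dual to \<open>\<alpha>\<close> under \<open>\<omega>\<close>; the
  second identity is the weak form of the first for \<open>\<alpha> = f (\<theta> \<circ> J)\<close>.  Hence
  \<open>scal\<^sup>r - scal\<^sup>1 = (r - 1) (d\<^sup>*\<theta> + |\<theta>|\<^sup>2)\<close>.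

  (3) \<open>|T\<^sup>r|\<^sup>2 = (K\<^sub>r / 2) |T|\<^sup>2\<close>, because \<open>d\<omega>\<close> has type (2,1) + (1,2).

  (4) \<open>\<theta>\<close> is the trace of \<open>T\<close>, so \<open>|T\<circ>|\<^sup>2 = |T|\<^sup>2 - 2 |\<theta>|\<^sup>2 / (n - 1)\<close> for the trace-free part \<open>T\<circ>\<close>.
\<close>

section \<open>Antisymmetrization and exterior products\<close>

text \<open>The constants in \<mu> are matched to these facts. Passing from 1 to r changes A_r by
  (n-1)(r-1), so the coefficient of d*\<theta> changes by -(r-1), which cancels the d*\<theta>
  produced by the scalar curvature. By (3), K_r drops out of (t - 2 A_r) / (2 K_r) |T^r|^2, leaving
  (t - 2 A_r) / 4 |T|^2, which changes by -(n-1)(r-1)/2 |T|^2. The remainder (r-1) (|\<theta>|^2 -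
  (n-1)/2 |T|^2) is the claim, by (4).

  The obstacle is that \<open>lee_form\<close> and \<open>codiff\<close> are picked by
  \<open>SOME\<close> from a wedge identity and an integral identity. Each needs an explicit
  solution and a uniqueness proof: injectivity of exterior multiplication by \<omega>^(n-1) on
  1-forms for the former, test forms cut off by bump functions for the latter. Orthonormal frames
  are picked by \<open>SOME\<close> too and need not vary smoothly, so smoothness and derivatives of
  traces go through coordinates or through a frame frozen at one point.

  Forms are functions on lists, so prepending v to the argument list is the interior product with v.
  The sum over permutations in \<open>wedge\<close> is therefore replaced by operators that recurse
  on the list, and the exterior algebra becomes induction on lists.\<close>

definition antisym_sum :: "nat \<Rightarrow> ('a list \<Rightarrow> real) \<Rightarrow> 'a list \<Rightarrow> real" where
  "antisym_sum k F vs = (\<Sum>\<sigma> | \<sigma> permutes {..<k}. of_int (sign \<sigma>) * F (permute_list \<sigma> vs))"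

definition skew :: "nat \<Rightarrow> ('a list \<Rightarrow> real) \<Rightarrow> bool" where
  "skew k b \<longleftrightarrow> (\<forall>\<sigma> us. \<sigma> permutes {..<k} \<longrightarrow> length us = k \<longrightarrow>
     b (permute_list \<sigma> us) = of_int (sign \<sigma>) * b us)"

abbreviation remove_nth :: "nat \<Rightarrow> 'a list \<Rightarrow> 'a list" where
  "remove_nth i vs \<equiv> take i vs @ drop (Suc i) vs"

text \<open>The cycle for which \<open>permute_list\<close> brings entry i to the front and keeps
  the order of the others. Followed by a permutation of the remaining entries
  (\<open>lift_perm\<close>), it reaches every permutation exactly once.\<close>

definition front_cycle :: "nat \<Rightarrow> nat \<Rightarrow> nat" where
  "front_cycle i m = (if m = 0 then i else if m \<le> i then m - 1 else m)"

definition lift_perm :: "(nat \<Rightarrow> nat) \<Rightarrow> nat \<Rightarrow> nat" where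
  "lift_perm \<tau> m = (case m of 0 \<Rightarrow> 0 | Suc l \<Rightarrow> Suc (\<tau> l))"

lemma front_cycle_Suc: "front_cycle (Suc i) = Transposition.transpose i (Suc i) \<circ> front_cycle i"
  by (auto simp: front_cycle_def fun_eq_iff Transposition.transpose_def)

lemma front_cycle_0: "front_cycle 0 = id"
  by (auto simp: front_cycle_def fun_eq_iff)

lemma front_cycle_permutes: "i < k \<Longrightarrow> front_cycle i permutes {..<k}"
proof (induction i)
  case 0
  then show ?case unfolding front_cycle_0 by (intro permutes_id)
next
  case (Suc i)
  then show ?case unfolding front_cycle_Suc
    by (intro permutes_compose permutes_swap_id) auto
qed

lemma sign_front_cycle: "sign (front_cycle i) = (- 1) ^ i"
proof (induction i)
  case 0
  then show ?case by (simp add: front_cycle_0)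
next
  case (Suc i)
  have "permutation (front_cycle i)"
    using front_cycle_permutes[of i "Suc i"] permutation_permutes by blast
  then have "sign (front_cycle (Suc i)) = - sign (front_cycle i)"
    unfolding front_cycle_Suc by (subst sign_compose) (simp_all add: permutation_swap_id sign_swap_id)
  then show ?case using Suc by simp
qed

lemma permute_list_front_cycle:
  assumes "i < length vs"
  shows "permute_list (front_cycle i) vs = vs ! i # remove_nth i vs"
  using assms
  by (intro nth_equalityI)
    (auto simp: permute_list_def front_cycle_def nth_Cons nth_append min_def split: nat.split)

lemma lift_perm_compose_transpose:
  "lift_perm (Transposition.transpose a b \<circ> \<tau>) = Transposition.transpose (Suc a) (Suc b) \<circ> lift_perm \<tau>"
  by (auto simp: lift_perm_def fun_eq_iff Transposition.transpose_def split: nat.split)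

lemma lift_perm_id: "lift_perm id = id"
  by (auto simp: lift_perm_def fun_eq_iff split: nat.split)

lemma lift_perm:
  assumes "\<tau> permutes {..<k}"
  shows "lift_perm \<tau> permutes {..<Suc k}" "sign (lift_perm \<tau>) = sign \<tau>"
proof -
  have "lift_perm \<tau> permutes {..<Suc k} \<and> sign (lift_perm \<tau>) = sign \<tau>"
    using assms finite_lessThan
  proof (induction rule: permutes_induct)
    case id
    then show ?case unfolding lift_perm_id by (simp only: permutes_id simp_thms)
  next
    case (swap a b p)
    have p: "permutation p" "permutation (lift_perm p)"
      using swap permutation_permutes finite_lessThan by blast+
    have "lift_perm (Transposition.transpose a b \<circ> p) permutes {..<Suc k}"
      unfolding lift_perm_compose_transpose using swap by (intro permutes_compose permutes_swap_id) auto
    moreover have "sign (lift_perm (Transposition.transpose a b \<circ> p)) = sign (Transposition.transpose a b \<circ> p)"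
      unfolding lift_perm_compose_transpose
      using p swap by (subst (1 2) sign_compose) (auto simp: permutation_swap_id sign_swap_id)
    ultimately show ?case by blast
  qed
  then show "lift_perm \<tau> permutes {..<Suc k}" "sign (lift_perm \<tau>) = sign \<tau>" by auto
qed

lemma permute_list_lift_perm:
  "permute_list (lift_perm \<tau>) (x # us) = x # permute_list \<tau> us"
proof (rule nth_equalityI)
  fix i assume "i < length (permute_list (lift_perm \<tau>) (x # us))"
  then show "permute_list (lift_perm \<tau>) (x # us) ! i = (x # permute_list \<tau> us) ! i"
    by (cases i) (simp_all add: permute_list_def lift_perm_def del: upt_Suc)
qed simp

text \<open>The value at 0 recovers i, and the injective cycle can then be cancelled. Surjectivity
  is counting: (k+1) k! = (k+1)!.\<close>

lemma bij_betw_perm_Suc: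
  "bij_betw (\<lambda>(i, \<tau>). front_cycle i \<circ> lift_perm \<tau>) ({..<Suc k} \<times> {\<tau>. \<tau> permutes {..<k}})
     {\<sigma>. \<sigma> permutes {..<Suc k}}"
  unfolding bij_betw_def
proof (intro conjI)
  let ?f = "\<lambda>(i, \<tau>). front_cycle i \<circ> lift_perm \<tau>"
  let ?A = "{..<Suc k} \<times> {\<tau>. \<tau> permutes {..<k}}"
  show inj: "inj_on ?f ?A"
  proof (rule inj_onI, clarsimp)
    fix i \<tau> j \<rho> assume *: "front_cycle i \<circ> lift_perm \<tau> = front_cycle j \<circ> lift_perm \<rho>"
      and p: "\<tau> permutes {..<k}" "\<rho> permutes {..<k}"
    from fun_cong[OF *, of 0] have "i = j" by (simp add: front_cycle_def lift_perm_def)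
    have "inj (front_cycle i)" using front_cycle_permutes[of i "Suc i"] permutes_inj by blast
    with * \<open>i = j\<close> have "lift_perm \<tau> m = lift_perm \<rho> m" for m
      by (metis comp_apply inj_eq)
    from this[of "Suc _"] have "\<tau> = \<rho>" by (auto simp: lift_perm_def fun_eq_iff)
    with \<open>i = j\<close> show "i = j \<and> \<tau> = \<rho>" by simp
  qed
  have "?f ` ?A \<subseteq> {\<sigma>. \<sigma> permutes {..<Suc k}}"
    using front_cycle_permutes lift_perm by (auto intro!: permutes_compose)
  moreover have "card {\<tau>. \<tau> permutes {..<m}} = fact m" for m :: nat
    by (rule card_permutations) auto
  then have "card (?f ` ?A) = card {\<sigma>. \<sigma> permutes {..<Suc k}}"
    unfolding card_image[OF inj] card_cartesian_product by simp
  moreover have "finite {\<sigma>. \<sigma> permutes {..<Suc k}}"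
    by (rule finite_permutations) simp
  ultimately show "?f ` ?A = {\<sigma>. \<sigma> permutes {..<Suc k}}"
    using card_subset_eq by blast
qed

text \<open>Laplace expansion along the first argument, obtained by summing over permutations in the
  form given by \<open>bij_betw_perm_Suc\<close>.\<close>

lemma antisym_sum_Suc:
  assumes "length vs = Suc k"
  shows "antisym_sum (Suc k) F vs = (\<Sum>i<Suc k. (- 1) ^ i * antisym_sum k (\<lambda>us. F (vs ! i # us)) (remove_nth i vs))"
proof -
  have perm: "sign (front_cycle i \<circ> lift_perm \<tau>) = (- 1) ^ i * sign \<tau>"
    "permute_list (front_cycle i \<circ> lift_perm \<tau>) vs = vs ! i # permute_list \<tau> (remove_nth i vs)"
    if "i < Suc k" "\<tau> permutes {..<k}" for i \<tau>
  proof -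
    have p: "front_cycle i permutes {..<Suc k}" "lift_perm \<tau> permutes {..<Suc k}"
      using that front_cycle_permutes lift_perm by auto
    then show "sign (front_cycle i \<circ> lift_perm \<tau>) = (- 1) ^ i * sign \<tau>"
      using that lift_perm by (subst sign_compose) (auto simp: sign_front_cycle permutation_permutes)
    show "permute_list (front_cycle i \<circ> lift_perm \<tau>) vs = vs ! i # permute_list \<tau> (remove_nth i vs)"
      using that assms p
      by (subst permute_list_compose) (auto simp: permute_list_front_cycle permute_list_lift_perm)
  qed
  have "antisym_sum (Suc k) F vs = (\<Sum>(i, \<tau>)\<in>{..<Suc k} \<times> {\<tau>. \<tau> permutes {..<k}}.
     of_int (sign (front_cycle i \<circ> lift_perm \<tau>)) * F (permute_list (front_cycle i \<circ> lift_perm \<tau>) vs))"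
    unfolding antisym_sum_def sum.reindex_bij_betw[OF bij_betw_perm_Suc, symmetric]
    by (simp add: case_prod_beta)
  also have "\<dots> = (\<Sum>(i, \<tau>)\<in>{..<Suc k} \<times> {\<tau>. \<tau> permutes {..<k}}.
      (- 1) ^ i * (of_int (sign \<tau>) * F (vs ! i # permute_list \<tau> (remove_nth i vs))))"
    by (intro sum.cong refl) (auto simp: perm)
  also have "\<dots> = (\<Sum>i<Suc k. (- 1) ^ i * antisym_sum k (\<lambda>us. F (vs ! i # us)) (remove_nth i vs))"
    by (simp add: sum.cartesian_product[symmetric] antisym_sum_def sum_distrib_left)
  finally show ?thesis .
qed

lemma antisym_sum_skew:
  assumes "skew k b" "length us = k"
  shows "antisym_sum k b us = fact k * b us"
proof -
  have "antisym_sum k b us = (\<Sum>\<sigma> | \<sigma> permutes {..<k}. b us)"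
    unfolding antisym_sum_def using assms
    by (intro sum.cong refl) (auto simp: skew_def sign_def)
  then show ?thesis using card_permutations[of "{..<k}" k] by simp
qed

lemma skew_antisym_sum: "skew k (antisym_sum k F)"
  unfolding skew_def
proof (intro allI impI)
  fix \<tau> :: "nat \<Rightarrow> nat" and us :: "'a list"
  assume \<tau>: "\<tau> permutes {..<k}" and us: "length us = k"
  have "antisym_sum k F us = (\<Sum>\<sigma> | \<sigma> permutes {..<k}. of_int (sign (\<tau> \<circ> \<sigma>)) * F (permute_list (\<tau> \<circ> \<sigma>) us))"
    unfolding antisym_sum_def by (rule setum_permutations_compose_left[OF \<tau>])
  also have "\<dots> = (\<Sum>\<sigma> | \<sigma> permutes {..<k}. of_int (sign \<tau>) * (of_int (sign \<sigma>) * F (permute_list \<sigma> (permute_list \<tau> us))))"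
    using \<tau> us by (intro sum.cong refl)
      (auto simp: permute_list_compose sign_compose permutation_permutes[THEN iffD2, OF exI[of _ "{..<k}"]])
  finally have "antisym_sum k F us = of_int (sign \<tau>) * antisym_sum k F (permute_list \<tau> us)"
    by (simp add: antisym_sum_def sum_distrib_left)
  then show "antisym_sum k F (permute_list \<tau> us) = of_int (sign \<tau>) * antisym_sum k F us"
    by (simp add: sign_def)
qed

lemma wedge_eq_antisym_sum:
  "wedge p q a b = (\<lambda>vs. antisym_sum (p + q) (\<lambda>us. a (take p us) * b (drop p us)) vs / (fact p * fact q))"
  by (simp add: wedge_def antisym_sum_def fun_eq_iff mult.assoc)

lemma skew_wedge: "skew (p + q) (wedge p q a b)"
  using skew_antisym_sum[of "p + q"] unfolding wedge_eq_antisym_sum skew_def by auto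

lemma antisym_sum_cmult: "antisym_sum k (\<lambda>us. c * F us) vs = c * antisym_sum k F vs"
  by (simp add: antisym_sum_def sum_distrib_left mult.left_commute)

text \<open>On skew forms, \<open>lw l\<close> is exterior multiplication by the 1-form \<open>l\<close> from the left.\<close>

primrec lw :: "('a \<Rightarrow> real) \<Rightarrow> ('a list \<Rightarrow> real) \<Rightarrow> 'a list \<Rightarrow> real" where
  "lw l b [] = 0"
| "lw l b (v # us) = l v * b us - lw l (\<lambda>ws. b (v # ws)) us"

lemma lw_eq_sum: "lw l b vs = (\<Sum>i<length vs. (- 1) ^ i * l (vs ! i) * b (remove_nth i vs))"
proof (induction vs arbitrary: b)
  case (Cons v us)
  have "(\<Sum>i<length us. (- 1) ^ Suc i * l ((v # us) ! Suc i) * b (remove_nth (Suc i) (v # us)))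
    = - lw l (\<lambda>ws. b (v # ws)) us"
    unfolding Cons sum_negf[symmetric] by (intro sum.cong refl) simp
  then show ?case
    by (simp only: length_Cons sum.lessThan_Suc_shift) simp
qed simp

text \<open>After one expansion, antisymmetrizing the skew b again only multiplies it by q!, and
  this is the factorial in the normalization of \<open>wedge\<close>.\<close>

lemma wedge_1:
  assumes "skew q b" "length vs = Suc q"
  shows "wedge 1 q a b vs = lw (\<lambda>v. a [v]) b vs"
proof -
  have "antisym_sum (Suc q) (\<lambda>us. a (take 1 us) * b (drop 1 us)) vs
     = (\<Sum>i<Suc q. fact q * ((- 1) ^ i * a [vs ! i] * b (remove_nth i vs)))"
    unfolding antisym_sum_Suc[OF assms(2)]
  proof (rule sum.cong[OF refl])
    fix i assume "i \<in> {..<Suc q}"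
    then have "antisym_sum q b (remove_nth i vs) = fact q * b (remove_nth i vs)"
      using assms by (intro antisym_sum_skew) auto
    then show "(- 1) ^ i * antisym_sum q (\<lambda>us. a (take 1 (vs ! i # us)) * b (drop 1 (vs ! i # us))) (remove_nth i vs)
      = fact q * ((- 1) ^ i * a [vs ! i] * b (remove_nth i vs))"
      by (simp add: antisym_sum_cmult)
  qed
  also have "\<dots> = fact q * lw (\<lambda>v. a [v]) b vs"
    unfolding lw_eq_sum assms(2) sum_distrib_left ..
  finally show ?thesis by (simp add: wedge_eq_antisym_sum)
qed

text \<open>Two expansions at the front. The q! cancels as in \<open>wedge_1\<close>; the remaining
  1/2 is 1/2!, since each pair of arguments of a is met in both orders.\<close>

lemma wedge_2:
  assumes "skew q b" "length vs = Suc (Suc q)"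
  shows "wedge 2 q a b vs = (\<Sum>i<Suc (Suc q). (- 1) ^ i * lw (\<lambda>w. a [vs ! i, w]) b (remove_nth i vs)) / 2"
proof -
  have inner: "antisym_sum (Suc q) (\<lambda>us. a (take 2 (x # us)) * b (drop 2 (x # us))) ws
     = fact q * lw (\<lambda>w. a [x, w]) b ws" if len: "length ws = Suc q" for x ws
  proof -
    have "antisym_sum (Suc q) (\<lambda>us. a (take 2 (x # us)) * b (drop 2 (x # us))) ws
       = (\<Sum>j<Suc q. fact q * ((- 1) ^ j * a [x, ws ! j] * b (remove_nth j ws)))"
      unfolding antisym_sum_Suc[OF len]
    proof (rule sum.cong[OF refl])
      fix j assume "j \<in> {..<Suc q}"
      then have "antisym_sum q b (remove_nth j ws) = fact q * b (remove_nth j ws)"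
        using assms len by (intro antisym_sum_skew) auto
      then show "(- 1) ^ j * antisym_sum q (\<lambda>us. a (take 2 (x # ws ! j # us)) * b (drop 2 (x # ws ! j # us))) (remove_nth j ws)
        = fact q * ((- 1) ^ j * a [x, ws ! j] * b (remove_nth j ws))"
        by (simp add: antisym_sum_cmult numeral_2_eq_2)
    qed
    also have "\<dots> = fact q * lw (\<lambda>w. a [x, w]) b ws"
      unfolding lw_eq_sum len sum_distrib_left ..
    finally show ?thesis .
  qed
  have eq: "antisym_sum (Suc (Suc q)) (\<lambda>us. a (take 2 us) * b (drop 2 us)) vs
     = (\<Sum>i<Suc (Suc q). fact q * ((- 1) ^ i * lw (\<lambda>w. a [vs ! i, w]) b (remove_nth i vs)))"
    unfolding antisym_sum_Suc[OF assms(2)]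
  proof (rule sum.cong[OF refl])
    fix i assume "i \<in> {..<Suc (Suc q)}"
    then have "length (remove_nth i vs) = Suc q" using assms by simp
    then have "antisym_sum (Suc q) (\<lambda>us. a (take 2 (vs ! i # us)) * b (drop 2 (vs ! i # us))) (remove_nth i vs)
      = fact q * lw (\<lambda>w. a [vs ! i, w]) b (remove_nth i vs)"
      by (rule inner)
    then show "(- 1) ^ i * antisym_sum (Suc q) (\<lambda>us. a (take 2 (vs ! i # us)) * b (drop 2 (vs ! i # us))) (remove_nth i vs)
      = fact q * ((- 1) ^ i * lw (\<lambda>w. a [vs ! i, w]) b (remove_nth i vs))"
      by (simp only: mult.left_commute)
  qed
  have "fact q * y / (fact 2 * fact q) = y / 2" for y :: real
    by simp
  then show ?thesis
    unfolding wedge_eq_antisym_sum add_2_eq_Suc eq sum_distrib_left[symmetric] .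
qed

section \<open>Exterior multiplication on lists\<close>

lemma lw_add: "lw l (\<lambda>vs. b vs + b' vs) vs = lw l b vs + lw l b' vs"
  by (induction vs arbitrary: b b') (simp_all add: algebra_simps)

lemma lw_cmult: "lw l (\<lambda>vs. c * b vs) vs = c * lw l b vs"
  by (induction vs arbitrary: b) (simp_all add: algebra_simps)

lemma lw_zero [simp]: "lw l (\<lambda>vs. 0) vs = 0"
  using lw_cmult[of l 0 "\<lambda>_. 0"] by simp

lemma lw_minus: "lw l (\<lambda>vs. - b vs) vs = - lw l b vs"
  using lw_cmult[of l "-1"] by simp

lemma lw_diff: "lw l (\<lambda>vs. b vs - b' vs) vs = lw l b vs - lw l b' vs"
  using lw_add[of l b "\<lambda>vs. - b' vs"] by (simp add: lw_minus)

lemma lw_sum: "lw l (\<lambda>vs. \<Sum>c\<in>C. b c vs) vs = (\<Sum>c\<in>C. lw l (b c) vs)"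
  by (induction C rule: infinite_finite_induct) (simp_all add: lw_add)

lemma lw_divide: "lw l (\<lambda>vs. b vs / c) vs = lw l b vs / c"
  using lw_cmult[of l "1/c"] by simp

lemma lw_fun:
  "lw l (\<lambda>vs. b vs + b' vs) = (\<lambda>vs. lw l b vs + lw l b' vs)"
  "lw l (\<lambda>vs. c * b vs) = (\<lambda>vs. c * lw l b vs)"
  "lw l (\<lambda>vs. \<Sum>d\<in>D. f d vs) = (\<lambda>vs. \<Sum>d\<in>D. lw l (f d) vs)"
  by (rule ext, simp add: lw_add lw_cmult lw_sum)+

lemma lw_add_left: "lw (\<lambda>v. l v + l' v) b vs = lw l b vs + lw l' b vs"
  by (induction vs arbitrary: b) (simp_all add: algebra_simps)

lemma lw_cmult_left: "lw (\<lambda>v. c * l v) b vs = c * lw l b vs"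
  by (induction vs arbitrary: b) (simp_all add: algebra_simps)

lemma lw_zero_left [simp]: "lw (\<lambda>v. 0) b vs = 0"
  using lw_cmult_left[of 0 "\<lambda>_. 0"] by simp

lemma lw_minus_left: "lw (\<lambda>v. - l v) b vs = - lw l b vs"
  using lw_cmult_left[of "-1"] by simp

lemma lw_diff_left: "lw (\<lambda>v. l v - l' v) b vs = lw l b vs - lw l' b vs"
  using lw_add_left[of l "\<lambda>v. - l' v"] by (simp add: lw_minus_left)

lemma lw_sum_left: "lw (\<lambda>v. \<Sum>c\<in>C. l c v) b vs = (\<Sum>c\<in>C. lw (l c) b vs)"
  by (induction C rule: infinite_finite_induct) (simp_all add: lw_add_left)

lemma lw_cong:
  assumes "\<And>us. Suc (length us) = length vs \<Longrightarrow> b us = b' us"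
  shows "lw l b vs = lw l b' vs"
  using assms
proof (induction vs arbitrary: b b')
  case (Cons v us)
  have "b us = b' us"
    by (rule Cons.prems) simp
  moreover have "lw l (\<lambda>ws. b (v # ws)) us = lw l (\<lambda>ws. b' (v # ws)) us"
    by (rule Cons.IH, rule Cons.prems) simp
  ultimately show ?case by (simp only: lw.simps)
qed simp

text \<open>Follows from the recursion of \<open>lw\<close> alone, for every function on lists. The
  operator identities below can therefore be used without side conditions on the forms.\<close>

lemma lw_anticommute: "lw l (lw m b) vs = - lw m (lw l b) vs"
  by (induction vs arbitrary: b) (simp_all add: lw_diff lw_cmult)

lemma lw_lw_self: "lw l (lw l b) vs = 0"
  using lw_anticommute[of l l b vs] by linarith

text \<open>The 0-form 1, made zero on nonempty lists, unlike \<open>wedge_power2 a 0\<close>. Its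
  interior products then vanish, which starts the inductions on powers and makes \<open>Lpow\<close>
  homogeneous on lists of every length.\<close>

definition unit_form :: "'a list \<Rightarrow> real" where
  "unit_form vs = (if vs = [] then 1 else 0)"

lemma unit_form_simps [simp]: "unit_form [] = 1" "unit_form (v # vs) = 0"
  by (auto simp: unit_form_def)

section \<open>Exterior multiplication by a 2-form and its powers\<close>

definition bilin_alt :: "('a::real_vector \<Rightarrow> 'a \<Rightarrow> real) \<Rightarrow> bool" where
  "bilin_alt a \<longleftrightarrow> bilinear a \<and> (\<forall>x y. a x y = - a y x)"

lemma bilin_altD:
  assumes "bilin_alt a"
  shows "linear (\<lambda>x. a x y)" "linear (a x)" "a x y = - a y x"
  using assms unfolding bilin_alt_def bilinear_def by blast+

text \<open>The frame is independent of any 2-form. This allows it to stay fixed at one point z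
  while the fundamental form varies nearby, as differentiating the powers of \<omega>
  requires.\<close>

locale coframe =
  fixes E :: "'c::finite \<Rightarrow> 'a::real_vector" and eps :: "'c \<Rightarrow> 'a \<Rightarrow> real"
  assumes linear_eps: "\<And>c. linear (eps c)"
    and expand: "\<And>v. (\<Sum>c\<in>UNIV. eps c v *\<^sub>R E c) = v"
begin

text \<open>Exterior multiplication by the 2-form \<open>a\<close>, and the powers of \<open>a\<close>.\<close>

definition L2 :: "('a \<Rightarrow> 'a \<Rightarrow> real) \<Rightarrow> ('a list \<Rightarrow> real) \<Rightarrow> 'a list \<Rightarrow> real" where
  "L2 a b vs = (\<Sum>c\<in>UNIV. lw (eps c) (lw (a (E c)) b) vs) / 2"

definition Lpow :: "('a \<Rightarrow> 'a \<Rightarrow> real) \<Rightarrow> nat \<Rightarrow> 'a list \<Rightarrow> real" where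
  "Lpow a m = (L2 a ^^ m) unit_form"

lemma Lpow_simps [simp]: "Lpow a 0 = unit_form" "Lpow a (Suc m) = L2 a (Lpow a m)"
  by (auto simp: Lpow_def)

lemma linear_expand: 
  fixes l :: "'a \<Rightarrow> 'b::real_vector"
  assumes "linear l" shows "l v = (\<Sum>c\<in>UNIV. eps c v *\<^sub>R l (E c))"
proof -
  have "l v = l (\<Sum>c\<in>UNIV. eps c v *\<^sub>R E c)" by (simp add: expand)
  also have "\<dots> = (\<Sum>c\<in>UNIV. eps c v *\<^sub>R l (E c))"
    using assms by (simp add: linear_sum linear_scale)
  finally show ?thesis .
qed

lemma lw_expand:
  assumes "linear l" shows "lw l b vs = (\<Sum>c\<in>UNIV. l (E c) * lw (eps c) b vs)"
proof -
  have "l = (\<lambda>v. \<Sum>c\<in>UNIV. l (E c) * eps c v)"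
    by (rule ext) (subst linear_expand[OF assms], simp add: mult.commute)
  then have "lw l b vs = lw (\<lambda>v. \<Sum>c\<in>UNIV. l (E c) * eps c v) b vs" by simp
  then show ?thesis by (simp add: lw_sum_left lw_cmult_left)
qed

lemma L2_add: "L2 a (\<lambda>vs. b vs + b' vs) vs = L2 a b vs + L2 a b' vs"
  by (simp add: L2_def lw_fun sum.distrib add_divide_distrib)

lemma L2_cmult: "L2 a (\<lambda>vs. k * b vs) vs = k * L2 a b vs"
  by (simp add: L2_def lw_fun sum_distrib_left)

lemma L2_sum: "L2 a (\<lambda>vs. \<Sum>c\<in>C. b c vs) vs = (\<Sum>c\<in>C. L2 a (b c) vs)"
  unfolding L2_def lw_fun sum_divide_distrib by (rule sum.swap)

lemma L2_zero [simp]: "L2 a (\<lambda>vs. 0) vs = 0"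
  using L2_cmult[of a 0 "\<lambda>_. 0"] by simp

lemma L2_divide: "L2 a (\<lambda>vs. b vs / k) vs = L2 a b vs / k"
  using L2_cmult[of a "1/k"] by simp

text \<open>Moving l past the two 1-forms of each summand changes the sign twice.\<close>

lemma lw_L2: "lw l (L2 a b) = L2 a (lw l b)"
proof (rule ext)
  fix vs
  have "lw l (lw (eps c) (lw (a (E c)) b)) vs = lw (eps c) (lw (a (E c)) (lw l b)) vs" for c
  proof -
    have "lw l (lw (eps c) (lw (a (E c)) b)) vs = - lw (eps c) (lw l (lw (a (E c)) b)) vs"
      by (rule lw_anticommute)
    also have "lw l (lw (a (E c)) b) = (\<lambda>vs. - lw (a (E c)) (lw l b) vs)"
      by (rule ext) (rule lw_anticommute)
    finally show ?thesis by (simp add: lw_minus)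
  qed
  then show "lw l (L2 a b) vs = L2 a (lw l b) vs"
    unfolding L2_def lw_divide lw_sum by simp
qed

lemma L2_commute: "L2 a (L2 a' b) = L2 a' (L2 a b)"
proof (rule ext)
  fix vs show "L2 a (L2 a' b) vs = L2 a' (L2 a b) vs"
  proof -
    have eq: "L2 a b = (\<lambda>vs. (\<Sum>c\<in>UNIV. lw (eps c) (lw (a (E c)) b) vs) / 2)"
      by (rule ext) (rule L2_def)
    show ?thesis
      unfolding eq L2_divide L2_sum unfolding L2_def[of a "L2 a' b"] lw_L2 ..
  qed
qed

text \<open>The Leibniz rule for the interior product with v; no sign appears because a has even
  degree. The two frame sums that arise from contracting a both equal a(v, .) by skewness, which
  absorbs the 1/2 in \<open>L2\<close>.\<close>

lemma L2_Cons:
  assumes "bilin_alt a"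
  shows "L2 a b (v # us) = lw (a v) b us + L2 a (\<lambda>ws. b (v # ws)) us"
proof -
  have lin: "linear (\<lambda>x. a x y)" "linear (a x)" and alt: "a x y = - a y x" for x y
    using assms bilin_altD by blast+
  have 1: "(\<Sum>c\<in>UNIV. lw (eps c) (lw (a (E c)) b) (v # us))
    = (\<Sum>c\<in>UNIV. eps c v * lw (a (E c)) b us) - (\<Sum>c\<in>UNIV. a (E c) v * lw (eps c) b us)
      + (\<Sum>c\<in>UNIV. lw (eps c) (lw (a (E c)) (\<lambda>ws. b (v # ws))) us)"
    by (simp add: lw_diff lw_cmult sum_subtractf)
  have "a v = (\<lambda>x. \<Sum>c\<in>UNIV. eps c v * a (E c) x)"
    by (rule ext) (subst linear_expand[OF lin(1)], simp)
  then have 2: "(\<Sum>c\<in>UNIV. eps c v * lw (a (E c)) b us) = lw (a v) b us"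
    by (simp only: lw_sum_left lw_cmult_left)
  have 3: "(\<Sum>c\<in>UNIV. a (E c) v * lw (eps c) b us) = - lw (a v) b us"
    unfolding lw_expand[OF lin(2)] sum_negf[symmetric]
    by (intro sum.cong refl) (subst alt, simp)
  show ?thesis unfolding L2_def 1 2 3 by simp
qed

text \<open>The interior product of a^m is m (i_v a) \<and> a^(m-1): each of the m factors
  contributes the same term since 2-forms commute. The truncated m - 1 at m = 0 is harmless because
  of the factor m.\<close>

lemma Lpow_Cons:
  assumes "bilin_alt a"
  shows "Lpow a m (v # us) = real m * lw (a v) (Lpow a (m - 1)) us"
proof (induction m arbitrary: us)
  case (Suc m)
  have eq: "(\<lambda>ws. Lpow a m (v # ws)) = (\<lambda>ws. real m * lw (a v) (Lpow a (m - 1)) ws)"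
    using Suc by auto
  have "Lpow a (Suc m) (v # us) = lw (a v) (Lpow a m) us + real m * L2 a (lw (a v) (Lpow a (m - 1))) us"
    by (simp add: L2_Cons[OF assms] eq L2_cmult)
  also have "L2 a (lw (a v) (Lpow a (m - 1))) = lw (a v) (L2 a (Lpow a (m - 1)))"
    by (rule lw_L2[symmetric])
  also have "real m * lw (a v) (L2 a (Lpow a (m - 1))) us = real m * lw (a v) (Lpow a m) us"
    by (cases m) auto
  finally have "Lpow a (Suc m) (v # us) = (1 + real m) * lw (a v) (Lpow a m) us"
    by (simp only: distrib_right mult_1_left)
  then show ?case by (simp only: of_nat_Suc diff_Suc_1)
qed simp

text \<open>The operator summed here multiplies a form by its degree.\<close>

lemma degree_L2:
  assumes "bilin_alt a"
  shows "(\<Sum>c\<in>UNIV. lw (eps c) (\<lambda>ws. L2 a b (E c # ws)) vs)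
     = 2 * L2 a b vs + L2 a (\<lambda>us. \<Sum>c\<in>UNIV. lw (eps c) (\<lambda>ws. b (E c # ws)) us) vs"
proof -
  have "lw (eps c) (\<lambda>ws. L2 a b (E c # ws)) vs
     = lw (eps c) (lw (a (E c)) b) vs + L2 a (lw (eps c) (\<lambda>ws. b (E c # ws))) vs" for c
    unfolding L2_Cons[OF assms] lw_add by (simp add: lw_L2)
  then have 1: "(\<Sum>c\<in>UNIV. lw (eps c) (\<lambda>ws. L2 a b (E c # ws)) vs)
     = (\<Sum>c\<in>UNIV. lw (eps c) (lw (a (E c)) b) vs) + (\<Sum>c\<in>UNIV. L2 a (lw (eps c) (\<lambda>ws. b (E c # ws))) vs)"
    by (simp only: sum.distrib)
  have 2: "(\<Sum>c\<in>UNIV. lw (eps c) (lw (a (E c)) b) vs) = 2 * L2 a b vs"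
    by (simp add: L2_def)
  show ?thesis unfolding 1 2 by (rule arg_cong[OF L2_sum[symmetric]])
qed

lemma degree_Lpow:
  assumes "bilin_alt a"
  shows "(\<Sum>c\<in>UNIV. lw (eps c) (\<lambda>ws. Lpow a m (E c # ws)) vs) = 2 * real m * Lpow a m vs"
proof (induction m arbitrary: vs)
  case (Suc m)
  then have "(\<lambda>us. \<Sum>c\<in>UNIV. lw (eps c) (\<lambda>ws. Lpow a m (E c # ws)) us) = (\<lambda>us. 2 * real m * Lpow a m us)"
    by blast
  then have "(\<Sum>c\<in>UNIV. lw (eps c) (\<lambda>ws. Lpow a (Suc m) (E c # ws)) vs)
      = 2 * L2 a (Lpow a m) vs + 2 * real m * L2 a (Lpow a m) vs"
    using degree_L2[OF assms, of "Lpow a m" vs] by (simp only: L2_cmult Lpow_simps)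
  moreover have "2 * x + 2 * real m * x = 2 * real (Suc m) * x" for x :: real
    by (simp add: algebra_simps)
  ultimately show ?case by (simp only: Lpow_simps)
qed simp

text \<open>The span of the k-fold products of coframe elements. Two vanishing statements can be
  read off from the generators: on lists of length other than k (\<open>has_degree_length\<close>),
  and altogether when k exceeds the number of coframe elements
  (\<open>has_degree_top\<close>).\<close>

inductive has_degree :: "nat \<Rightarrow> ('a list \<Rightarrow> real) \<Rightarrow> bool" where
  prod: "length cs = k \<Longrightarrow> has_degree k (foldr (\<lambda>c. lw (eps c)) cs unit_form)"
| zero: "has_degree k (\<lambda>_. 0)"
| add: "has_degree k b \<Longrightarrow> has_degree k b' \<Longrightarrow> has_degree k (\<lambda>vs. b vs + b' vs)"
| scale: "has_degree k b \<Longrightarrow> has_degree k (\<lambda>vs. r * b vs)"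

lemma has_degree_sum:
  "(\<And>c. c \<in> C \<Longrightarrow> has_degree k (b c)) \<Longrightarrow> has_degree k (\<lambda>vs. \<Sum>c\<in>C. b c vs)"
  by (induction C rule: infinite_finite_induct) (auto intro: has_degree.intros)

lemma has_degree_lw_eps: "has_degree k b \<Longrightarrow> has_degree (Suc k) (lw (eps c) b)"
proof (induction rule: has_degree.induct)
  case (prod cs k)
  then show ?case using has_degree.prod[of "c # cs" "Suc k"] by simp
next
  case (zero k)
  have "lw (eps c) (\<lambda>_. 0) = (\<lambda>_. 0)" by (rule ext) simp
  then show ?case using has_degree.zero by simp
next
  case (add k b b')
  have "lw (eps c) (\<lambda>vs. b vs + b' vs) = (\<lambda>vs. lw (eps c) b vs + lw (eps c) b' vs)"
    by (rule ext) (rule lw_add)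
  then show ?case using add has_degree.add by simp
next
  case (scale k b r)
  have "lw (eps c) (\<lambda>vs. r * b vs) = (\<lambda>vs. r * lw (eps c) b vs)"
    by (rule ext) (rule lw_cmult)
  then show ?case using scale has_degree.scale by simp
qed

lemma has_degree_lw:
  assumes "has_degree k b" "linear l" shows "has_degree (Suc k) (lw l b)"
proof -
  have "lw l b = (\<lambda>vs. \<Sum>c\<in>UNIV. l (E c) * lw (eps c) b vs)"
    by (rule ext) (rule lw_expand[OF assms(2)])
  then show ?thesis using assms(1)
    by (auto intro!: has_degree_sum has_degree.scale has_degree_lw_eps)
qed

lemma has_degree_L2:
  assumes "has_degree k b" "bilin_alt a" shows "has_degree (Suc (Suc k)) (L2 a b)"
proof -
  have eq: "L2 a b = (\<lambda>vs. (1/2) * (\<Sum>c\<in>UNIV. lw (eps c) (lw (a (E c)) b) vs))"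
    by (rule ext) (simp add: L2_def)
  have "linear (a x)" for x using assms bilin_altD by blast+
  then show ?thesis using assms(1) unfolding eq
    by (intro has_degree_sum has_degree.scale has_degree_lw linear_eps)
qed

lemma has_degree_Lpow:
  assumes "bilin_alt a" shows "has_degree (2 * m) (Lpow a m)"
proof (induction m)
  case 0
  then show ?case using has_degree.prod[of "[]" 0] by simp
next
  case (Suc m)
  then show ?case using has_degree_L2[OF Suc assms] by simp
qed

lemma has_degree_length: "has_degree k b \<Longrightarrow> length vs \<noteq> k \<Longrightarrow> b vs = 0"
proof (induction arbitrary: vs rule: has_degree.induct)
  case (prod cs k)
  have "foldr (\<lambda>c. lw (eps c)) cs unit_form vs = 0" if "length vs \<noteq> length cs" for vs
    using that
  proof (induction cs arbitrary: vs)
    case Nil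
    then show ?case by (simp add: unit_form_def)
  next
    case (Cons c cs)
    have "lw (eps c) (foldr (\<lambda>c. lw (eps c)) cs unit_form) vs = lw (eps c) (\<lambda>_. 0) vs"
      by (rule lw_cong, rule Cons.IH) (use Cons.prems in auto)
    then show ?case by simp
  qed
  then show ?case using prod by blast
qed auto

lemma lw_prod_mem:
  "c \<in> set cs \<Longrightarrow> lw (eps c) (foldr (\<lambda>c. lw (eps c)) cs b) vs = 0"
proof (induction cs arbitrary: vs)
  case (Cons d cs)
  show ?case
  proof (cases "c = d")
    case True
    then show ?thesis by (simp add: lw_lw_self)
  next
    case False
    then have "lw (eps c) (foldr (\<lambda>c. lw (eps c)) cs b) = (\<lambda>_. 0)"
      using Cons by auto
    then show ?thesis using lw_anticommute[of "eps c" "eps d" _ vs] by simp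
  qed
qed simp

text \<open>By the pigeonhole principle some coframe element is repeated in each generator, and
  \<open>lw_prod_mem\<close> anticommutes one copy up to the other, where the product is
  zero.\<close>

lemma has_degree_top: "has_degree k b \<Longrightarrow> CARD('c) < k \<Longrightarrow> b vs = 0"
proof (induction arbitrary: vs rule: has_degree.induct)
  case (prod cs k)
  have "foldr (\<lambda>c. lw (eps c)) cs unit_form vs = 0" if "\<not> distinct cs" for vs
    using that
  proof (induction cs arbitrary: vs)
    case (Cons c cs)
    show ?case
    proof (cases "c \<in> set cs")
      case True
      then show ?thesis by (simp add: lw_prod_mem)
    next
      case False
      then have "foldr (\<lambda>c. lw (eps c)) cs unit_form = (\<lambda>_. 0)" using Cons by auto
      then show ?thesis by simp
    qed
  qed simp
  moreover have "\<not> distinct cs"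
  proof
    assume "distinct cs"
    then have "length cs = card (set cs)" by (simp add: distinct_card)
    also have "\<dots> \<le> CARD('c)" by (intro card_mono) auto
    finally show False using prod by simp
  qed
  ultimately show ?case by blast
qed auto

end

lemma wedge_1_eq_lw:
  assumes "skew q b" "length vs = Suc q" "\<And>us. length us = q \<Longrightarrow> b us = b' us"
  shows "wedge 1 q a b vs = lw (\<lambda>v. a [v]) b' vs"
  unfolding wedge_1[OF assms(1,2)] by (rule lw_cong) (use assms in auto)

text \<open>Expanding the first slot of a in the frame turns the alternating sum over positions in
  \<open>wedge_2\<close> into the sum that defines \<open>lw (eps c)\<close>; then the sums over
  positions and over the frame are exchanged.\<close>

lemma wedge_2_eq_L2:
  fixes E :: "'c::finite \<Rightarrow> 'n::finite tvec"
  assumes "coframe E eps" and "skew q b" "length vs = Suc (Suc q)" "\<And>us. length us = q \<Longrightarrow> b us = b' us"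
    and a: "\<And>x y. a [x, y] = a' x y" "bilin_alt a'"
  shows "wedge 2 q a b vs = coframe.L2 E eps a' b' vs"
proof -
  interpret coframe E eps by fact
  have lin: "linear (\<lambda>x. a' x y)" for y
    using a(2) bilin_altD by blast
  have "(- 1) ^ i * lw (\<lambda>w. a [vs ! i, w]) b (remove_nth i vs)
    = (\<Sum>c\<in>UNIV. (- 1) ^ i * eps c (vs ! i) * lw (a' (E c)) b' (remove_nth i vs))"
    if "i < Suc (Suc q)" for i
  proof -
    have "(\<lambda>w. a [vs ! i, w]) = (\<lambda>w. \<Sum>c\<in>UNIV. eps c (vs ! i) * a' (E c) w)"
      unfolding a(1) by (rule ext) (subst linear_expand[OF lin], simp)
    moreover have "lw l b (remove_nth i vs) = lw l b' (remove_nth i vs)" for l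
      by (rule lw_cong) (use assms that in simp)
    ultimately have "lw (\<lambda>w. a [vs ! i, w]) b (remove_nth i vs)
        = (\<Sum>c\<in>UNIV. eps c (vs ! i) * lw (a' (E c)) b' (remove_nth i vs))"
      by (simp only: lw_sum_left lw_cmult_left)
    then show ?thesis by (simp only: sum_distrib_left mult.assoc)
  qed
  then have "(\<Sum>i<Suc (Suc q). (- 1) ^ i * lw (\<lambda>w. a [vs ! i, w]) b (remove_nth i vs))
     = (\<Sum>i<Suc (Suc q). \<Sum>c\<in>UNIV. (- 1) ^ i * eps c (vs ! i) * lw (a' (E c)) b' (remove_nth i vs))"
    by (intro sum.cong refl) auto
  also have "\<dots> = (\<Sum>c\<in>UNIV. lw (eps c) (lw (a' (E c)) b') vs)"
    unfolding lw_eq_sum[of "eps _" _ vs] assms(3) by (rule sum.swap)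
  finally show ?thesis by (simp only: wedge_2[OF assms(2,3)] L2_def)
qed

lemma skew_wedge_power2: "skew (2 * k) (wedge_power2 a k)"
proof (cases k)
  case 0
  then show ?thesis by (simp add: skew_def)
next
  case (Suc m)
  then show ?thesis using skew_wedge[of 2 "2 * m"] by simp
qed

lemma wedge_power2_eq_Lpow:
  fixes E :: "'c::finite \<Rightarrow> 'n::finite tvec"
  assumes frame: "coframe E eps" and a: "\<And>x y. a [x, y] = a' x y" "bilin_alt a'" "length vs = 2 * k"
  shows "wedge_power2 a k vs = coframe.Lpow E eps a' k vs"
proof -
  interpret coframe E eps by fact
  show ?thesis
    using assms(4)
  proof (induction k arbitrary: vs)
  case (Suc k)
  then show ?case
    using wedge_2_eq_L2[OF frame skew_wedge_power2[of k a], of vs "Lpow a' k" a a'] a by simp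
  qed simp
qed

lemma wedge_1_power2_eq:
  fixes E :: "'c::finite \<Rightarrow> 'n::finite tvec"
  assumes "coframe E eps" and "\<And>x y. a [x, y] = a' x y" "bilin_alt a'" "length vs = Suc (2 * k)"
  shows "wedge 1 (2 * k) l (wedge_power2 a k) vs = lw (\<lambda>v. l [v]) (coframe.Lpow E eps a' k) vs"
  using assms by (intro wedge_1_eq_lw skew_wedge_power2 wedge_power2_eq_Lpow)

section \<open>Hermitian forms on a vector space\<close>

lemma linear_J: "linear J"
  by (rule linearI) (simp_all add: J_def vec_eq_iff algebra_simps scaleR_conv_of_real)

lemma J_simps [simp]:
  "J (J x) = - x" "J 0 = 0" "J (- x) = - J x" "J (x + y) = J x + J y" "J (x - y) = J x - J y"
  "J (c *\<^sub>R x) = c *\<^sub>R J x"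
  by (simp_all add: linear_add linear_diff linear_neg linear_scale linear_0 linear_J)
     (simp add: J_def vec_eq_iff)

locale inner_form =
  fixes g :: "'n::finite metric"
  assumes bilinear_g: "bilinear g"
    and sym: "g x y = g y x"
    and pos: "x \<noteq> 0 \<Longrightarrow> g x x > 0"
begin

lemmas g_simps = bilinear_ladd[OF bilinear_g] bilinear_radd[OF bilinear_g]
  bilinear_lmul[OF bilinear_g] bilinear_rmul[OF bilinear_g] bilinear_lneg[OF bilinear_g]
  bilinear_rneg[OF bilinear_g] bilinear_lzero[OF bilinear_g] bilinear_rzero[OF bilinear_g]
  bilinear_lsub[OF bilinear_g] bilinear_rsub[OF bilinear_g]

lemma linear_g: "linear (g x)" "linear (\<lambda>x. g x y)"
  using bilinear_g unfolding bilinear_def by blast+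

lemma g_sum: "g (\<Sum>i\<in>I. f i) y = (\<Sum>i\<in>I. g (f i) y)" "g y (\<Sum>i\<in>I. f i) = (\<Sum>i\<in>I. g y (f i))"
  using linear_g by (simp_all add: linear_sum[of "\<lambda>x. g x y"] linear_sum[of "g y"])

lemma nondegenerate: "(\<And>y. g x y = g x' y) \<Longrightarrow> x = x'"
  using pos[of "x - x'"] by (auto simp: g_simps)

text \<open>Gram-Schmidt: below full dimension there is a vector outside the span, and subtracting
  its projection leaves a nonzero vector to normalize.\<close>

lemma ex_orthonormal_nat:
  "k \<le> DIM('n tvec) \<Longrightarrow> \<exists>f::nat \<Rightarrow> 'n tvec. \<forall>i<k. \<forall>j<k. g (f i) (f j) = (if i = j then 1 else 0)"
proof (induction k)
  case (Suc k)
  then obtain f :: "nat \<Rightarrow> 'n tvec" where f: "i < k \<Longrightarrow> j < k \<Longrightarrow> g (f i) (f j) = (if i = j then 1 else 0)" for i j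
    by auto
  have "dim (f ` {..<k}) \<le> card (f ` {..<k})" by (rule dim_le_card') simp
  also have "\<dots> \<le> k" using card_image_le[of "{..<k}" f] by simp
  finally have "dim (f ` {..<k}) < DIM('n tvec)" using Suc.prems by simp
  then have "span (f ` {..<k}) \<noteq> UNIV" using dim_span[of "f ` {..<k}"] by (metis dim_UNIV nat_neq_iff)
  then obtain x where x: "x \<notin> span (f ` {..<k})" by auto
  define y where "y = x - (\<Sum>i<k. g x (f i) *\<^sub>R f i)"
  have "y \<noteq> 0"
  proof
    assume "y = 0"
    then have "x = (\<Sum>i<k. g x (f i) *\<^sub>R f i)" by (simp add: y_def)
    also have "\<dots> \<in> span (f ` {..<k})" by (intro span_sum span_scale span_base) auto
    finally show False using x by blast
  qed
  have orth: "g y (f j) = 0" if "j < k" for j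
  proof -
    have "g y (f j) = g x (f j) - (\<Sum>i<k. g x (f i) * g (f i) (f j))"
      by (simp add: y_def g_simps g_sum)
    also have "(\<Sum>i<k. g x (f i) * g (f i) (f j)) = (\<Sum>i<k. if i = j then g x (f j) else 0)"
      using that by (intro sum.cong refl) (auto simp: f)
    finally show ?thesis using that by simp
  qed
  define h where "h = f(k := (1 / sqrt (g y y)) *\<^sub>R y)"
  have "g y y > 0" using pos \<open>y \<noteq> 0\<close> by blast
  then have "g (h k) (h k) = 1" by (simp add: h_def g_simps field_simps)
  moreover have "g (h k) (h j) = 0" "g (h j) (h k) = 0" if "j < k" for j
    using that orth[of j] sym[of y "f j"] by (auto simp: h_def g_simps)
  moreover have "g (h i) (h j) = (if i = j then 1 else 0)" if "i < k" "j < k" for i j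
    using that f by (simp add: h_def)
  ultimately show ?case by (intro exI[of _ h]) (auto simp: less_Suc_eq)
qed simp

lemma ex_orthonormal_frame: "\<exists>e. orthonormal_frame g e"
proof -
  obtain f :: "nat \<Rightarrow> 'n tvec" where f: "\<forall>i<DIM('n tvec). \<forall>j<DIM('n tvec). g (f i) (f j) = (if i = j then 1 else 0)"
    using ex_orthonormal_nat[of "DIM('n tvec)"] by auto
  have "card (UNIV :: ('n + 'n) set) = card {..<DIM('n tvec)}" by simp
  then obtain h where h: "bij_betw h (UNIV :: ('n + 'n) set) {..<DIM('n tvec)}"
    using finite_same_card_bij[of "UNIV :: ('n + 'n) set" "{..<DIM('n tvec)}"] by auto
  have lt: "h a < DIM('n tvec)" for a using h by (auto simp: bij_betw_def)
  have inj: "h a = h b \<longleftrightarrow> a = b" for a b using h by (auto simp: bij_betw_def inj_on_def)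
  have "g (f (h a)) (f (h b)) = (if a = b then 1 else 0)" for a b
    using f lt inj by metis
  then have "orthonormal_frame g (f \<circ> h)" by (simp add: orthonormal_frame_def)
  then show ?thesis by blast
qed

context
  fixes e :: "'n + 'n \<Rightarrow> 'n tvec"
  assumes e: "orthonormal_frame g e"
begin

lemma frame_expand: "(\<Sum>a\<in>UNIV. g v (e a) *\<^sub>R e a) = v"
proof -
  have ee: "g (e a) (e b) = (if a = b then 1 else 0)" for a b
    using e by (simp add: orthonormal_frame_def)
  have "inj e" using ee by (metis injI zero_neq_one)
  have coeff: "(\<Sum>a\<in>UNIV. k a *\<^sub>R e a) = 0 \<Longrightarrow> k b = 0" for k b
  proof -
    assume "(\<Sum>a\<in>UNIV. k a *\<^sub>R e a) = 0"
    then have "0 = g (\<Sum>a\<in>UNIV. k a *\<^sub>R e a) (e b)" by (simp add: g_simps)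
    also have "\<dots> = (\<Sum>a\<in>UNIV. if a = b then k b else 0)"
      unfolding g_sum by (intro sum.cong refl) (auto simp: g_simps ee)
    finally show "k b = 0" by simp
  qed
  have "independent (e ` UNIV)"
  proof (subst independent_explicit, intro conjI allI impI ballI)
    fix k v assume "(\<Sum>v\<in>range e. k v *\<^sub>R v) = 0" "v \<in> range e"
    moreover have "(\<Sum>v\<in>range e. k v *\<^sub>R v) = (\<Sum>a\<in>UNIV. k (e a) *\<^sub>R e a)"
      by (subst sum.reindex[OF \<open>inj e\<close>]) simp
    ultimately show "k v = 0" using coeff[of "\<lambda>a. k (e a)"] by auto
  qed simp
  moreover have "card (e ` UNIV) = DIM('n tvec)"
    by (subst card_image[OF \<open>inj e\<close>]) simp
  ultimately have span: "span (e ` UNIV) = UNIV"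
    using card_ge_dim_independent[of "e ` UNIV" UNIV] by (auto simp: dim_UNIV)
  have "linear (\<lambda>v. \<Sum>a\<in>UNIV. g v (e a) *\<^sub>R e a)"
    by (rule linearI) (simp_all add: g_simps sum.distrib scaleR_left_distrib scaleR_sum_right)
  moreover have "(\<Sum>a\<in>UNIV. g v (e a) *\<^sub>R e a) = v" if "v \<in> range e" for v
  proof -
    from \<open>v \<in> range e\<close> obtain b where b: "v = e b" by blast
    have "(\<Sum>a\<in>UNIV. g v (e a) *\<^sub>R e a) = (\<Sum>a\<in>UNIV. if a = b then e b else 0)"
      by (intro sum.cong refl) (auto simp: b ee)
    then show ?thesis by (simp add: b)
  qed
  ultimately show ?thesis
    using linear_eq_on_span[of "\<lambda>v. \<Sum>a\<in>UNIV. g v (e a) *\<^sub>R e a" "\<lambda>v. v" "range e" v] span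
    by (simp add: linear_id[unfolded id_def])
qed

lemma coframe_frame: "coframe e (\<lambda>a v. g v (e a))"
  by (rule coframe.intro) (rule linear_g frame_expand)+

lemma frame_linear:
  fixes l :: "'n tvec \<Rightarrow> 'b::real_vector"
  assumes "linear l" shows "(\<Sum>a\<in>UNIV. g v (e a) *\<^sub>R l (e a)) = l v"
  using coframe.linear_expand[OF coframe_frame assms, of v] by simp

lemma frame_real:
  fixes l :: "'n tvec \<Rightarrow> real"
  assumes "linear l" shows "(\<Sum>a\<in>UNIV. g v (e a) * l (e a)) = l v"
  using frame_linear[OF assms, of v] by simp

text \<open>Expand each \<open>f a\<close> in the frame e, exchange the sums, and collapse the
  expansion of \<open>e b\<close> in f. Besides independence of the frame, this gives invariance of
  traces under J, as J maps orthonormal frames to orthonormal frames.\<close>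

lemma trace_unique:
  fixes B :: "'n tvec \<Rightarrow> 'n tvec \<Rightarrow> real"
  assumes B: "bilinear B" and f: "\<And>v. (\<Sum>a\<in>(UNIV::('n + 'n) set). g v (f a) *\<^sub>R f a) = v"
  shows "(\<Sum>a\<in>UNIV. B (e a) (e a)) = (\<Sum>a\<in>UNIV. B (f a) (f a))"
proof -
  have lin: "linear (\<lambda>x. B x y)" "linear (B y)" for y using B unfolding bilinear_def by blast+
  have "(\<Sum>a\<in>UNIV. B (f a) (f a)) = (\<Sum>a\<in>UNIV. \<Sum>b\<in>UNIV. g (f a) (e b) * B (e b) (f a))"
    by (intro sum.cong refl) (rule frame_real[OF lin(1), symmetric])
  also have "\<dots> = (\<Sum>b\<in>UNIV. \<Sum>a\<in>UNIV. g (f a) (e b) * B (e b) (f a))"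
    by (rule sum.swap)
  also have "\<dots> = (\<Sum>b\<in>UNIV. B (e b) (\<Sum>a\<in>UNIV. g (e b) (f a) *\<^sub>R f a))"
    using lin by (simp add: linear_sum linear_scale sym[of "f _"])
  finally show ?thesis by (simp add: f)
qed

end

lemma metric_trace_eq:
  assumes B: "bilinear B" and f: "orthonormal_frame g f"
  shows "metric_trace g B = (\<Sum>a\<in>UNIV. B (f a) (f a))"
proof -
  have "orthonormal_frame g (SOME e. orthonormal_frame g e)"
    using ex_orthonormal_frame by (rule someI_ex)
  then show ?thesis
    using trace_unique[OF _ B frame_expand[OF f]] by (simp add: metric_trace_def Let_def)
qed

end

locale hermitian_form =
  fixes a :: "'n::finite tvec \<Rightarrow> 'n tvec \<Rightarrow> real"
  assumes alt: "bilin_alt a"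
    and J_invariant: "a (J x) (J y) = a x y"
    and positive: "x \<noteq> 0 \<Longrightarrow> a x (J x) > 0"
begin

definition g :: "'n metric" where "g x y = a x (J y)"

lemma a_skew: "a x y = - a y x"
  by (rule bilin_altD(3)[OF alt])

lemma linear_a: "linear (a x)" "linear (\<lambda>x. a x y)"
  using bilin_altD[OF alt] by blast+

sublocale inner_form g
proof
  show "bilinear g" unfolding bilinear_def g_def
    using linear_a linear_compose[OF linear_J, of "a _"] by (auto simp: comp_def)
  show "g x y = g y x" for x y
  proof -
    have "a x (J y) = a (J x) (J (J y))" by (rule J_invariant[symmetric])
    also have "\<dots> = - a (J x) y" by (simp add: linear_neg[OF linear_a(1)])
    also have "\<dots> = a y (J x)" using a_skew[of y "J x"] by linarith
    finally show ?thesis by (simp add: g_def)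
  qed
  show "g x x > 0" if "x \<noteq> 0" for x using positive[OF that] by (simp add: g_def)
qed

lemma g_J: "g (J x) (J y) = g x y"
  unfolding g_def using J_invariant by blast

lemma g_J_swap: "g (J x) y = - g x (J y)"
  using g_J[of x "J y"] by (simp add: g_simps)

lemma a_eq_g: "a x y = g (J x) y"
  unfolding g_def by (rule J_invariant[symmetric])

lemma orthonormal_frame_J: "orthonormal_frame g e \<Longrightarrow> orthonormal_frame g (\<lambda>c. J (e c))"
  by (simp add: orthonormal_frame_def g_J)

lemma trace_J:
  fixes B :: "'n tvec \<Rightarrow> 'n tvec \<Rightarrow> real"
  assumes "orthonormal_frame g e" "bilinear B"
  shows "(\<Sum>c\<in>UNIV. B (J (e c)) (J (e c))) = (\<Sum>c\<in>UNIV. B (e c) (e c))"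
  by (rule trace_unique[OF orthonormal_frame_J[OF assms(1)] assms(2) frame_expand[OF assms(1)]])

end

section \<open>The Lee form at a point\<close>

text \<open>
  \<open>da v\<close> is the derivative of the form \<open>a\<close> in the direction \<open>v\<close>, and \<open>tau\<close> its exterior derivative.
\<close>

locale hermitian_jet = hermitian_form a for a :: "'n::finite tvec \<Rightarrow> 'n tvec \<Rightarrow> real" +
  fixes da :: "'n tvec \<Rightarrow> 'n tvec \<Rightarrow> 'n tvec \<Rightarrow> real"
  assumes linear_da: "linear (\<lambda>v. da v x y)"
    and da_alt: "bilin_alt (da v)"
    and da_J: "da v (J x) (J y) = da v x y"
begin

definition tau :: "'n tvec \<Rightarrow> 'n tvec \<Rightarrow> 'n tvec \<Rightarrow> real" where
  "tau x y z = da x y z + da y z x + da z x y"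

lemmas da_simps = linear_da[THEN linear_add] linear_da[THEN linear_scale] linear_da[THEN linear_neg] linear_da[THEN linear_0]
  bilin_altD(1)[OF da_alt, THEN linear_add] bilin_altD(1)[OF da_alt, THEN linear_scale] bilin_altD(1)[OF da_alt, THEN linear_neg] bilin_altD(1)[OF da_alt, THEN linear_0]
  bilin_altD(2)[OF da_alt, THEN linear_add] bilin_altD(2)[OF da_alt, THEN linear_scale] bilin_altD(2)[OF da_alt, THEN linear_neg] bilin_altD(2)[OF da_alt, THEN linear_0]

lemma da_skew: "da v x y = - da v y x"
  by (rule bilin_altD(3)[OF da_alt])

lemma tau_cyclic: "tau x y z = tau y z x"
  by (simp add: tau_def)

lemma tau_skew: "tau x y z = - tau y x z" "tau x y z = - tau x z y"
  using da_skew[of x y z] da_skew[of y z x] da_skew[of z x y] by (auto simp: tau_def)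

lemma tau_simps:
  "tau (x + x') y z = tau x y z + tau x' y z" "tau (r *\<^sub>R x) y z = r * tau x y z" "tau (- x) y z = - tau x y z" "tau 0 y z = 0"
  "tau y (x + x') z = tau y x z + tau y x' z" "tau y (r *\<^sub>R x) z = r * tau y x z" "tau y (- x) z = - tau y x z" "tau y 0 z = 0"
  "tau y z (x + x') = tau y z x + tau y z x'" "tau y z (r *\<^sub>R x) = r * tau y z x" "tau y z (- x) = - tau y z x" "tau y z 0 = 0"
  by (simp_all add: tau_def da_simps algebra_simps)

text \<open>The exterior derivative has no component of type (3,0).\<close>

lemma tau_type: "tau (J x) (J y) z + tau (J x) y (J z) + tau x (J y) (J z) = tau x y z"
proof -
  have J1: "da v (J x) y = - da v x (J y)" for v x y
    using da_J[of v x "J y"] by (simp add: da_simps)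
  show ?thesis
    \<comment> \<open>The terms differentiated along J x, J y or J z cancel in pairs by
      \<open>J1\<close>. In the three others J sits on both arguments of the form and is removed by
      \<open>da_J\<close>.\<close>
    unfolding tau_def using J1[of "J x" y z] J1[of "J y" z x] J1[of "J z" x y]
    by (simp add: da_J)
qed

definition lee :: "('n + 'n \<Rightarrow> 'n tvec) \<Rightarrow> 'n tvec \<Rightarrow> real" where
  "lee e v = (\<Sum>c\<in>UNIV. tau v (e c) (J (e c))) / 2"

lemma linear_lee: "linear (lee e)"
  by (rule linearI) (simp_all add: lee_def tau_simps sum.distrib add_divide_distrib sum_distrib_left)

context
  fixes e :: "'n + 'n \<Rightarrow> 'n tvec"
  assumes e: "orthonormal_frame g e"
begin

interpretation coframe e "\<lambda>c v. g v (e c)"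
  by (rule coframe_frame[OF e])

text \<open>Exterior multiplication by \<open>tau\<close>, and by its contraction with \<open>v\<close>.\<close>

definition wedge_tau :: "('n tvec list \<Rightarrow> real) \<Rightarrow> 'n tvec list \<Rightarrow> real" where
  "wedge_tau X vs = (\<Sum>c\<in>UNIV. lw (\<lambda>v. g v (e c)) (L2 (da (e c)) X) vs)"

definition contract_tau :: "'n tvec \<Rightarrow> ('n tvec list \<Rightarrow> real) \<Rightarrow> 'n tvec list \<Rightarrow> real" where
  "contract_tau v X us = L2 (da v) X us - (\<Sum>c\<in>UNIV. lw (\<lambda>v. g v (e c)) (lw (da (e c) v) X) us)"

lemma L2_da: "(\<Sum>c\<in>UNIV. g v (e c) * L2 (da (e c)) X us) = L2 (da v) X us"
proof -
  have "(\<Sum>d\<in>UNIV. g v (e d) * lw (\<lambda>v. g v (e c)) (lw (da (e d) (e c)) X) us)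
      = lw (\<lambda>v. g v (e c)) (lw (da v (e c)) X) us" for c
  proof -
    have eq: "da v (e c) = (\<lambda>x. \<Sum>d\<in>UNIV. g v (e d) * da (e d) (e c) x)"
      by (rule ext) (rule frame_real[OF e linear_da, symmetric])
    have "lw (da v (e c)) X = (\<lambda>us. \<Sum>d\<in>UNIV. g v (e d) * lw (da (e d) (e c)) X us)"
      by (rule ext) (subst eq, simp only: lw_sum_left lw_cmult_left)
    then show ?thesis by (simp only: lw_fun)
  qed
  then show ?thesis
    unfolding L2_def by (simp add: sum_distrib_left sum_divide_distrib[symmetric]) (subst sum.swap, simp)
qed

text \<open>Leibniz rule for the interior product with v, with a minus sign because
  \<open>tau\<close> has odd degree.\<close>

lemma wedge_tau_Cons: "wedge_tau X (v # us) = contract_tau v X us - wedge_tau (\<lambda>ws. X (v # ws)) us"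
proof -
  have 1: "lw l (\<lambda>ws. L2 (da (e c)) X (v # ws)) us
    = lw l (lw (da (e c) v) X) us + lw l (L2 (da (e c)) (\<lambda>ws. X (v # ws))) us" for c l
    unfolding L2_Cons[OF da_alt] lw_add ..
  have "wedge_tau X (v # us) = (\<Sum>c\<in>UNIV. g v (e c) * L2 (da (e c)) X us)
    - (\<Sum>c\<in>UNIV. lw (\<lambda>v. g v (e c)) (\<lambda>ws. L2 (da (e c)) X (v # ws)) us)"
    by (simp only: wedge_tau_def lw.simps sum_subtractf)
  then show ?thesis
    by (simp only: L2_da 1 sum.distrib contract_tau_def[of v X] wedge_tau_def[of _ us] diff_diff_eq)
qed

text \<open>The same rule for the 2-form \<open>tau v\<close>: no sign, and its own contraction with
  u is the 1-form \<open>tau v u\<close>.\<close>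

lemma contract_tau_Cons: "contract_tau v X (u # us) = contract_tau v (\<lambda>ws. X (u # ws)) us + lw (tau v u) X us"
proof -
  let ?l = "\<lambda>c v. g v (e c)"
  have 1: "lw (?l c) (lw (da (e c) v) X) (u # us) = g u (e c) * lw (da (e c) v) X us
    - (da (e c) v u * lw (?l c) X us - lw (?l c) (lw (da (e c) v) (\<lambda>ws. X (u # ws))) us)" for c
    by (simp add: lw_diff lw_cmult)
  have "da u v = (\<lambda>x. \<Sum>c\<in>UNIV. g u (e c) * da (e c) v x)"
    by (rule ext) (rule frame_real[OF e linear_da, symmetric])
  then have 2: "(\<Sum>c\<in>UNIV. g u (e c) * lw (da (e c) v) X us) = lw (da u v) X us"
    by (simp only: lw_sum_left lw_cmult_left)
  have 3: "(\<Sum>c\<in>UNIV. da (e c) v u * lw (?l c) X us) = lw (\<lambda>x. da x v u) X us"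
    by (rule lw_expand[OF linear_da, symmetric])
  have "tau v u = (\<lambda>x. da v u x - da u v x + da x v u)"
    by (intro ext) (simp add: tau_def da_skew[of u _ v])
  then have 4: "lw (tau v u) X us = lw (da v u) X us - lw (da u v) X us + lw (\<lambda>x. da x v u) X us"
    by (simp only: lw_add_left lw_diff_left)
  have "contract_tau v X (u # us) = (lw (da v u) X us + L2 (da v) (\<lambda>ws. X (u # ws)) us)
     - (lw (da u v) X us - (lw (\<lambda>x. da x v u) X us
        - (\<Sum>c\<in>UNIV. lw (?l c) (lw (da (e c) v) (\<lambda>ws. X (u # ws))) us)))"
    unfolding contract_tau_def 1 L2_Cons[OF da_alt] unfolding sum_subtractf 2 3 ..
  then show ?thesis
    unfolding contract_tau_def[of v "\<lambda>ws. X (u # ws)"] 4 by linarith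
qed

lemma wedge_tau_Cons_Cons:
  "wedge_tau X (v # u # us) = contract_tau v (\<lambda>ws. X (u # ws)) us + lw (tau v u) X us - contract_tau u (\<lambda>ws. X (v # ws)) us
     + wedge_tau (\<lambda>ws. X (v # u # ws)) us"
  unfolding wedge_tau_Cons contract_tau_Cons by simp

lemma contract_tau_cmult: "contract_tau v (\<lambda>ws. k * X ws) us = k * contract_tau v X us"
  by (simp add: contract_tau_def L2_cmult lw_fun sum_distrib_left right_diff_distrib)

lemma wedge_tau_cmult: "wedge_tau (\<lambda>ws. k * X ws) us = k * wedge_tau X us"
proof -
  have "L2 b (\<lambda>ws. k * X ws) = (\<lambda>us. k * L2 b X us)" for b
    by (rule ext) (rule L2_cmult)
  then show ?thesis by (simp add: wedge_tau_def lw_fun sum_distrib_left)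
qed

lemma wedge_tau_sum: "wedge_tau (\<lambda>ws. \<Sum>c\<in>C. X c ws) us = (\<Sum>c\<in>C. wedge_tau (X c) us)"
proof -
  have "L2 b (\<lambda>ws. \<Sum>c\<in>C. X c ws) = (\<lambda>us. \<Sum>c\<in>C. L2 b (X c) us)" for b
    by (rule ext) (rule L2_sum)
  then show ?thesis unfolding wedge_tau_def by (simp only: lw_fun) (rule sum.swap)
qed

lemma contract_tau_linear: "linear (\<lambda>v. contract_tau v X us)"
proof -
  have 1: "linear (\<lambda>v. L2 (da v) X us)"
  proof -
    have "(\<lambda>v. L2 (da v) X us) = (\<lambda>v. \<Sum>c\<in>UNIV. g v (e c) * L2 (da (e c)) X us)"
      by (simp only: L2_da)
    then show ?thesis by (auto intro!: linearI simp: g_simps sum.distrib algebra_simps sum_distrib_left)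
  qed
  have 2: "linear (\<lambda>v. lw l (lw (da w v) X) us)" for l w
  proof (rule linearI)
    fix x y r
    have "da w (x + y) = (\<lambda>z. da w x z + da w y z)" "da w (r *\<^sub>R x) = (\<lambda>z. r * da w x z)"
      by (simp_all add: da_simps fun_eq_iff)
    then show "lw l (lw (da w (x + y)) X) us = lw l (lw (da w x) X) us + lw l (lw (da w y) X) us"
      "lw l (lw (da w (r *\<^sub>R x)) X) us = r *\<^sub>R lw l (lw (da w x) X) us"
      by (simp_all add: lw_add[symmetric] lw_cmult[symmetric] lw_add_left[abs_def] lw_cmult_left[abs_def])
  qed
  show ?thesis unfolding contract_tau_def
    by (intro linear_compose_sub linear_compose_sum 1 2 ballI)
qed

lemma lw_g_linear: "linear (\<lambda>u. lw (g u) Y us)"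
proof (rule linearI)
  fix x y r
  have "g (x + y) = (\<lambda>z. g x z + g y z)" "g (r *\<^sub>R x) = (\<lambda>z. r * g x z)"
    by (simp_all add: g_simps fun_eq_iff)
  then show "lw (g (x + y)) Y us = lw (g x) Y us + lw (g y) Y us"
    "lw (g (r *\<^sub>R x)) Y us = r *\<^sub>R lw (g x) Y us"
    by (simp_all add: lw_add_left lw_cmult_left)
qed

lemma contract_tau_lw_linear: "linear (\<lambda>u. contract_tau v (lw (g u) Y) us)"
proof (rule linearI)
  fix x y r
  have "lw (g (x + y)) Y = (\<lambda>us. lw (g x) Y us + lw (g y) Y us)" "lw (g (r *\<^sub>R x)) Y = (\<lambda>us. r * lw (g x) Y us)"
    using lw_g_linear[of Y] by (auto simp: linear_iff fun_eq_iff)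
  then show "contract_tau v (lw (g (x + y)) Y) us = contract_tau v (lw (g x) Y) us + contract_tau v (lw (g y) Y) us"
    "contract_tau v (lw (g (r *\<^sub>R x)) Y) us = r *\<^sub>R contract_tau v (lw (g x) Y) us"
    by (simp_all add: contract_tau_cmult) (simp add: contract_tau_def L2_add lw_fun sum.distrib)
qed

lemma g_frame: "g (e c) = (\<lambda>v. g v (e c))"
  using sym by blast

text \<open>The 3 is the degree of \<open>tau\<close>: the sum over c of e^c \<and> i_(e_c)
  multiplies a 3-form by 3, and e^c can be moved past a 2-form without a sign.\<close>

lemma sum_contract_tau: "(\<Sum>c\<in>UNIV. contract_tau (e c) (lw (g (e c)) Y) us) = 3 * wedge_tau Y us"
proof -
  let ?l = "\<lambda>c v. g v (e c)"
  have 1: "(\<Sum>c\<in>UNIV. L2 (da (e c)) (lw (?l c) Y) us) = wedge_tau Y us"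
    unfolding wedge_tau_def lw_L2 ..
  have 2: "lw (?l d) (lw (da (e d) (e c)) (lw (?l c) Y)) us = - lw (?l d) (lw (?l c) (lw (da (e d) (e c)) Y)) us" for c d
  proof -
    have "lw (da (e d) (e c)) (lw (?l c) Y) = (\<lambda>us. - lw (?l c) (lw (da (e d) (e c)) Y) us)"
      by (rule ext) (rule lw_anticommute)
    then show ?thesis by (simp only: lw_minus)
  qed
  have 3: "(\<Sum>c\<in>UNIV. \<Sum>d\<in>UNIV. lw (?l d) (lw (?l c) (lw (da (e d) (e c)) Y)) us) = 2 * wedge_tau Y us"
  proof -
    have "2 * wedge_tau Y us = (\<Sum>d\<in>UNIV. lw (?l d) (\<lambda>us. 2 * L2 (da (e d)) Y us) us)"
      unfolding wedge_tau_def sum_distrib_left lw_cmult ..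
    also have "\<dots> = (\<Sum>d\<in>UNIV. \<Sum>c\<in>UNIV. lw (?l d) (lw (?l c) (lw (da (e d) (e c)) Y)) us)"
      unfolding L2_def by (simp add: lw_sum)
    also have "\<dots> = (\<Sum>c\<in>UNIV. \<Sum>d\<in>UNIV. lw (?l d) (lw (?l c) (lw (da (e d) (e c)) Y)) us)"
      by (rule sum.swap)
    finally show ?thesis by (rule HOL.sym)
  qed
  show ?thesis
    unfolding g_frame contract_tau_def sum_subtractf 1 2 sum_negf 3 by simp
qed

section \<open>Contraction with the fundamental form and the Lefschetz argument\<close>

lemma Lpow_Cons_a: "(\<lambda>ws. Lpow a (Suc k) (v # ws)) = (\<lambda>ws. real (Suc k) * lw (g (J v)) (Lpow a k) ws)"
proof -
  have "a v = g (J v)" by (rule ext) (rule a_eq_g)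
  then show ?thesis using Lpow_Cons[OF alt, of "Suc k"] by simp
qed

lemma Lpow_Cons_linear: "linear (\<lambda>v. Lpow a k (v # us))"
proof (cases k)
  case (Suc m)
  have "(\<lambda>v. Lpow a (Suc m) (v # us)) = (\<lambda>v. real (Suc m) * lw (g (J v)) (Lpow a m) us)"
    by (rule ext) (rule fun_cong[OF Lpow_Cons_a])
  moreover have "linear (\<lambda>v. lw (g (J v)) (Lpow a m) us)"
    using linear_compose[OF linear_J lw_g_linear] by (simp add: comp_def)
  from linear_compose_scale_right[OF this, of "real (Suc m)"]
  have "linear (\<lambda>v. real (Suc m) * lw (g (J v)) (Lpow a m) us)" by (simp only: real_scaleR_def)
  ultimately show ?thesis
    unfolding Suc by (simp only:)
qed (simp add: linear_zero)

lemma lw_Lpow_linear: "linear (\<lambda>v. lw l (\<lambda>ws. Lpow a k (v # ws)) us)"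
  using Lpow_Cons_linear by (auto simp: linear_iff lw_add lw_cmult)

text \<open>Two interior products are taken. The term 2n counts the frame vectors, through g(e_c,
  e_c) = 1; the term -2k is the degree of a^k, met when the second contraction hits a^k and
  evaluated by \<open>degree_Lpow\<close>.\<close>

lemma contract_Lpow:
  "(\<Sum>c\<in>UNIV. Lpow a (Suc k) (e c # J (e c) # ws))
     = real (Suc k) * (2 * real CARD('n) - 2 * real k) * Lpow a k ws"
proof -
  have "(\<Sum>c\<in>UNIV. lw (g (J (e c))) (\<lambda>ws. Lpow a k (J (e c) # ws)) ws)
    = (\<Sum>c\<in>UNIV. lw (g (e c)) (\<lambda>ws. Lpow a k (e c # ws)) ws)"
    by (rule trace_J[OF e]) (simp add: bilinear_def lw_g_linear lw_Lpow_linear)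
  also have "\<dots> = 2 * real k * Lpow a k ws"
    unfolding g_frame by (rule degree_Lpow[OF alt])
  finally have 1: "(\<Sum>c\<in>UNIV. lw (g (J (e c))) (\<lambda>ws. Lpow a k (J (e c) # ws)) ws) = 2 * real k * Lpow a k ws" .
  have ee: "g (e c) (e c) = 1" for c using e by (simp add: orthonormal_frame_def)
  have "Lpow a (Suc k) (e c # J (e c) # ws) = real (Suc k) *
     (Lpow a k ws - lw (g (J (e c))) (\<lambda>ws. Lpow a k (J (e c) # ws)) ws)" for c
    using fun_cong[OF Lpow_Cons_a, of k "e c" "J (e c) # ws"] by (simp only: lw.simps g_J ee mult_1_left)
  then have "(\<Sum>c\<in>UNIV. Lpow a (Suc k) (e c # J (e c) # ws)) = real (Suc k) *
     (\<Sum>c\<in>(UNIV :: ('n + 'n) set). Lpow a k ws - lw (g (J (e c))) (\<lambda>ws. Lpow a k (J (e c) # ws)) ws)"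
    by (simp only: sum_distrib_left)
  then show ?thesis unfolding sum_subtractf 1 by (simp add: algebra_simps)
qed

text \<open>If both contractions hit \<open>tau\<close>, the result is twice the Lee form; if both
  hit the power, \<open>contract_Lpow\<close> applies. The two mixed terms each contribute -3 (k+1)
  by \<open>sum_contract_tau\<close>, whence the 6. For n = k + 2 the factor 2n - 2k - 6 equals
  -2.\<close>

lemma contract_wedge_tau:
  "(\<Sum>c\<in>UNIV. wedge_tau (Lpow a (Suc k)) (e c # J (e c) # us))
    = 2 * lw (lee e) (Lpow a (Suc k)) us + real (Suc k) * (2 * real CARD('n) - 2 * real k - 6) * wedge_tau (Lpow a k) us"
proof -
  let ?Y = "Lpow a k"
  have M: "bilinear (\<lambda>v u. contract_tau v (lw (g u) ?Y) us)"
    unfolding bilinear_def using contract_tau_linear contract_tau_lw_linear by blast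
  have 1: "(\<Sum>c\<in>UNIV. contract_tau (e c) (\<lambda>ws. Lpow a (Suc k) (J (e c) # ws)) us) = - (real (Suc k) * (3 * wedge_tau ?Y us))"
  proof -
    have "lw (g (J (J (e c)))) ?Y ws = - lw (g (e c)) ?Y ws" for c ws
      by (simp add: g_simps[abs_def] lw_minus_left)
    then have "real (Suc k) * lw (g (J (J (e c)))) ?Y ws = - real (Suc k) * lw (g (e c)) ?Y ws" for c ws
      by (simp only: mult_minus_left mult_minus_right)
    then have "contract_tau (e c) (\<lambda>ws. Lpow a (Suc k) (J (e c) # ws)) us = - real (Suc k) * contract_tau (e c) (lw (g (e c)) ?Y) us" for c
      by (simp only: Lpow_Cons_a contract_tau_cmult)
    then have "(\<Sum>c\<in>UNIV. contract_tau (e c) (\<lambda>ws. Lpow a (Suc k) (J (e c) # ws)) us)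
       = - real (Suc k) * (\<Sum>c\<in>UNIV. contract_tau (e c) (lw (g (e c)) ?Y) us)"
      by (simp only: sum_distrib_left)
    then show ?thesis by (simp only: sum_contract_tau mult_minus_left)
  qed
  have 2: "(\<Sum>c\<in>UNIV. contract_tau (J (e c)) (\<lambda>ws. Lpow a (Suc k) (e c # ws)) us) = real (Suc k) * (3 * wedge_tau ?Y us)"
    unfolding Lpow_Cons_a contract_tau_cmult sum_distrib_left[symmetric] trace_J[OF e M] sum_contract_tau ..
  have 3: "(\<Sum>c\<in>UNIV. lw (tau (e c) (J (e c))) X us) = 2 * lw (lee e) X us" for X
  proof -
    have "(\<lambda>v. 2 * lee e v) = (\<lambda>v. \<Sum>c\<in>UNIV. tau (e c) (J (e c)) v)"
      by (simp add: lee_def) (intro ext sum.cong refl tau_cyclic)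
    then show ?thesis by (simp only: lw_sum_left[symmetric] lw_cmult_left[symmetric])
  qed
  have 4: "(\<Sum>c\<in>UNIV. wedge_tau (\<lambda>ws. Lpow a (Suc k) (e c # J (e c) # ws)) us)
     = real (Suc k) * (2 * real CARD('n) - 2 * real k) * wedge_tau ?Y us"
    unfolding wedge_tau_sum[symmetric] contract_Lpow wedge_tau_cmult ..
  show ?thesis
    unfolding wedge_tau_Cons_Cons sum.distrib sum_subtractf 1 2 3 4 by (simp add: algebra_simps)
qed

lemma has_degree_wedge_tau:
  assumes "has_degree k X" shows "has_degree (Suc (Suc (Suc k))) (wedge_tau X)"
proof -
  have "wedge_tau X = (\<lambda>vs. \<Sum>c\<in>UNIV. lw (\<lambda>v. g v (e c)) (L2 (da (e c)) X) vs)"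
    by (rule ext) (rule wedge_tau_def)
  then show ?thesis
    using has_degree_sum[of UNIV "Suc (Suc (Suc k))" "\<lambda>c. lw (\<lambda>v. g v (e c)) (L2 (da (e c)) X)"]
      has_degree_lw_eps[OF has_degree_L2[OF assms da_alt]] by simp
qed

text \<open>
  The form to which the contraction is applied has degree \<open>2 * CARD('n) + 1\<close> and hence vanishes.
\<close>

lemma lee_Lpow:
  assumes "CARD('n) = Suc (Suc k)"
  shows "lw (lee e) (Lpow a (Suc k)) us = real (Suc k) * wedge_tau (Lpow a k) us"
proof -
  have "has_degree (Suc (Suc (Suc (2 * Suc k)))) (wedge_tau (Lpow a (Suc k)))"
    by (rule has_degree_wedge_tau) (rule has_degree_Lpow[OF alt])
  then have "wedge_tau (Lpow a (Suc k)) vs = 0" for vs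
    by (rule has_degree_top) (simp add: assms)
  then have "0 = 2 * lw (lee e) (Lpow a (Suc k)) us - 2 * (real (Suc k) * wedge_tau (Lpow a k) us)"
    using contract_wedge_tau[of k us] assms by (simp del: Lpow_simps add: algebra_simps)
  then show ?thesis by linarith
qed

text \<open>As in \<open>contract_wedge_tau\<close> with a 1-form in place of \<open>tau\<close>:
  each mixed term contributes -(k+1), and contracting l twice gives nothing.\<close>

lemma contract_lw:
  assumes l: "linear l"
  shows "(\<Sum>c\<in>UNIV. lw l (Lpow a (Suc k)) (e c # J (e c) # us))
    = real (Suc k) * (2 * real CARD('n) - 2 * real k - 2) * lw l (Lpow a k) us"
proof -
  let ?Y = "Lpow a k"
  have expand_l: "(\<Sum>c\<in>UNIV. l (e c) * lw (g (e c)) ?Y us) = lw l ?Y us"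
    unfolding g_frame by (rule lw_expand[OF l, symmetric])
  have 1: "(\<Sum>c\<in>UNIV. l (e c) * Lpow a (Suc k) (J (e c) # us)) = - (real (Suc k) * lw l ?Y us)"
  proof -
    have "Lpow a (Suc k) (J (e c) # us) = - (real (Suc k) * lw (g (e c)) ?Y us)" for c
      using fun_cong[OF Lpow_Cons_a, of k "J (e c)" us] by (simp add: g_simps[abs_def] lw_minus_left)
    then show ?thesis
      unfolding expand_l[symmetric] sum_distrib_left sum_negf[symmetric]
      by (intro sum.cong refl) (simp del: Lpow_simps)
  qed
  have 2: "(\<Sum>c\<in>UNIV. l (J (e c)) * Lpow a (Suc k) (e c # us)) = real (Suc k) * lw l ?Y us"
  proof -
    have B: "bilinear (\<lambda>u v. l u * lw (g v) ?Y us)"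
      using l lw_g_linear[of ?Y us] by (auto simp: bilinear_def linear_iff algebra_simps)
    have "(\<Sum>c\<in>UNIV. l (J (e c)) * Lpow a (Suc k) (e c # us))
       = real (Suc k) * (\<Sum>c\<in>UNIV. l (J (e c)) * lw (g (J (e c))) ?Y us)"
      unfolding fun_cong[OF Lpow_Cons_a] sum_distrib_left by (intro sum.cong refl mult.left_commute)
    then show ?thesis unfolding trace_J[OF e B] expand_l .
  qed
  have 3: "(\<Sum>c\<in>UNIV. lw l (\<lambda>ws. Lpow a (Suc k) (e c # J (e c) # ws)) us)
     = real (Suc k) * (2 * real CARD('n) - 2 * real k) * lw l ?Y us"
    unfolding lw_sum[symmetric] contract_Lpow lw_cmult ..
  have "lw l (Lpow a (Suc k)) (v # u # us) = l v * Lpow a (Suc k) (u # us) - l u * Lpow a (Suc k) (v # us)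
      + lw l (\<lambda>ws. Lpow a (Suc k) (v # u # ws)) us" for u v
    by (simp del: Lpow_simps)
  then have "(\<Sum>c\<in>UNIV. lw l (Lpow a (Suc k)) (e c # J (e c) # us))
      = (\<Sum>c\<in>UNIV. l (e c) * Lpow a (Suc k) (J (e c) # us)) - (\<Sum>c\<in>UNIV. l (J (e c)) * Lpow a (Suc k) (e c # us))
        + (\<Sum>c\<in>UNIV. lw l (\<lambda>ws. Lpow a (Suc k) (e c # J (e c) # ws)) us)"
    by (simp only: sum.distrib sum_subtractf)
  then show ?thesis
    unfolding 1 2 3 by (simp only: algebra_simps)
qed

text \<open>Contraction lowers the power one step at a time. The factor 2n - 2k - 2 from
  \<open>contract_lw\<close> is nonzero as long as k + 1 < n, so the vanishing descends to a^0 and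
  hence to l itself.\<close>

lemma lw_Lpow_inject:
  assumes "linear l" "\<And>us. lw l (Lpow a k) us = 0" "k < CARD('n)"
  shows "l v = 0"
  using assms(2,3)
proof (induction k)
  case 0
  then have "lw l unit_form [v] = 0" by (simp only: Lpow_simps)
  then show ?case by simp
next
  case (Suc k)
  have "lw l (Lpow a k) us = 0" for us
  proof -
    have "(\<Sum>c\<in>UNIV. lw l (Lpow a (Suc k)) (e c # J (e c) # us)) = 0"
      by (simp only: Suc.prems(1) sum.neutral_const)
    then have "real (Suc k) * (2 * real CARD('n) - 2 * real k - 2) * lw l (Lpow a k) us = 0"
      by (simp only: contract_lw[OF assms(1)])
    moreover have "2 * real CARD('n) - 2 * real k - 2 \<noteq> 0" "real (Suc k) \<noteq> 0" using Suc.prems(2) by auto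
    ultimately show ?thesis by (simp only: mult_eq_0_iff simp_thms)
  qed
  then show ?case by (rule Suc.IH) (use Suc.prems(2) in simp)
qed

end

end

section \<open>Smooth functions\<close>

lemma dir_deriv_eqI: "(f has_derivative D) (at z) \<Longrightarrow> dir_deriv f z v = D v"
  using frechet_derivative_at by metis

lemma dir_deriv_worksI: "f differentiable (at z) \<Longrightarrow> (f has_derivative (\<lambda>v. dir_deriv f z v)) (at z)"
  by (simp add: frechet_derivative_works)

lemma linear_dir_deriv: "f differentiable (at z) \<Longrightarrow> linear (\<lambda>v. dir_deriv f z v)"
  by (rule linear_frechet_derivative)

lemma differentiable_cong_open:
  assumes "open S" "z \<in> S" "\<And>x. x \<in> S \<Longrightarrow> f x = g x"
  shows "f differentiable (at z) \<longleftrightarrow> g differentiable (at z)"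
  unfolding differentiable_def using assms has_derivative_transform_within_open[of f _ z UNIV S g]
    has_derivative_transform_within_open[of g _ z UNIV S f] by metis

lemma dir_deriv_cong_open:
  assumes "open S" "z \<in> S" "\<And>x. x \<in> S \<Longrightarrow> f x = g x"
  shows "dir_deriv f z v = dir_deriv g z v"
proof -
  have "(f has_derivative D) (at z) \<longleftrightarrow> (g has_derivative D) (at z)" for D
    using assms has_derivative_transform_within_open[of f D z UNIV S g]
      has_derivative_transform_within_open[of g D z UNIV S f] by metis
  then show ?thesis by (simp add: frechet_derivative_def)
qed

lemma Ck_on_cong:
  assumes "open S" "\<And>x. x \<in> S \<Longrightarrow> f x = g x"
  shows "Ck_on k S f \<longleftrightarrow> Ck_on k S g"
  using assms(2)
proof (induction k arbitrary: f g)
  case 0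
  then show ?case by (simp cong: continuous_on_cong)
next
  case (Suc k)
  have "Ck_on k S (\<lambda>z. dir_deriv f z v) \<longleftrightarrow> Ck_on k S (\<lambda>z. dir_deriv g z v)" for v
    by (rule Suc.IH) (rule dir_deriv_cong_open[OF assms(1)], auto simp: Suc.prems)
  moreover have "f differentiable (at z) \<longleftrightarrow> g differentiable (at z)" if "z \<in> S" for z
    by (rule differentiable_cong_open[OF assms(1) that Suc.prems])
  ultimately show ?case by simp
qed

lemma Ck_on_SucD: "Ck_on (Suc k) S f \<Longrightarrow> Ck_on k S f"
proof (induction k arbitrary: f)
  case 0
  then show ?case
    by (auto intro!: continuous_at_imp_continuous_on differentiable_imp_continuous_within)
next
  case (Suc k)
  have "Ck_on k S (\<lambda>z. dir_deriv f z v)" for v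
    using Suc.prems by (intro Suc.IH) (simp del: Ck_on.simps(2) add: Ck_on.simps(2)[of "Suc k"])
  then show ?case using Suc.prems by simp
qed

lemma Ck_on_const: "Ck_on k S (\<lambda>_. c)"
proof (induction k arbitrary: c)
  case (Suc k)
  have "dir_deriv (\<lambda>_. c) z v = 0" for z v :: 'a
    by (rule dir_deriv_eqI) (auto intro: derivative_eq_intros)
  then show ?case using Suc by simp
qed simp

lemma Ck_on_linear:
  assumes "bounded_linear f" shows "Ck_on k S f"
proof (cases k)
  case 0
  then show ?thesis using assms by (simp add: linear_continuous_on)
next
  case (Suc m)
  have "(f has_derivative f) (at z)" for z
    by (rule bounded_linear_imp_has_derivative[OF assms])
  then have "dir_deriv f z v = f v" "f differentiable (at z)" for z v
    by (auto intro: dir_deriv_eqI simp: differentiable_def)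
  then show ?thesis using Suc by (simp add: Ck_on_const)
qed

lemma Ck_on_add:
  assumes S: "open S" and "Ck_on k S f" "Ck_on k S g"
  shows "Ck_on k S (\<lambda>z. f z + g z)"
  using assms(2,3)
proof (induction k arbitrary: f g)
  case 0
  then show ?case by (simp add: continuous_on_add)
next
  case (Suc k)
  have "Ck_on k S (\<lambda>z. dir_deriv (\<lambda>z. f z + g z) z v)" for v
  proof (subst Ck_on_cong[OF S])
    show "Ck_on k S (\<lambda>z. dir_deriv f z v + dir_deriv g z v)"
      using Suc.prems by (intro Suc.IH) auto
    show "dir_deriv (\<lambda>z. f z + g z) z v = dir_deriv f z v + dir_deriv g z v" if "z \<in> S" for z
      using Suc.prems that by (intro dir_deriv_eqI has_derivative_add dir_deriv_worksI) auto
  qed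
  then show ?case using Suc.prems by simp
qed

lemma Ck_on_mult:
  fixes f g :: "'a::real_normed_vector \<Rightarrow> real"
  assumes S: "open S" and "Ck_on k S f" "Ck_on k S g"
  shows "Ck_on k S (\<lambda>z. f z * g z)"
  using assms(2,3)
proof (induction k arbitrary: f g)
  case 0
  then show ?case by (simp add: continuous_on_mult)
next
  case (Suc k)
  have "Ck_on k S (\<lambda>z. dir_deriv (\<lambda>z. f z * g z) z v)" for v
  proof (subst Ck_on_cong[OF S])
    show "Ck_on k S (\<lambda>z. f z * dir_deriv g z v + dir_deriv f z v * g z)"
      using Suc.prems Ck_on_SucD[OF Suc.prems(1)] Ck_on_SucD[OF Suc.prems(2)]
      by (intro Ck_on_add[OF S] Suc.IH) auto
    show "dir_deriv (\<lambda>z. f z * g z) z v = f z * dir_deriv g z v + dir_deriv f z v * g z" if "z \<in> S" for z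
      using Suc.prems that by (intro dir_deriv_eqI has_derivative_mult dir_deriv_worksI) auto
  qed
  then show ?case using Suc.prems by simp
qed

lemma Ck_on_inverse:
  fixes f :: "'a::real_normed_vector \<Rightarrow> real"
  assumes S: "open S" and "Ck_on k S f" and nz: "\<And>z. z \<in> S \<Longrightarrow> f z \<noteq> 0"
  shows "Ck_on k S (\<lambda>z. inverse (f z))"
  using assms(2)
proof (induction k)
  case 0
  then show ?case using nz by (auto intro!: continuous_on_inverse)
next
  case (Suc k)
  have der: "((\<lambda>z. inverse (f z)) has_derivative (\<lambda>v. - (inverse (f z) * dir_deriv f z v * inverse (f z)))) (at z)" if "z \<in> S" for z
    using Suc.prems that nz by (intro Deriv.has_derivative_inverse dir_deriv_worksI) auto
  have "Ck_on k S (\<lambda>z. dir_deriv (\<lambda>z. inverse (f z)) z v)" for v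
  proof (subst Ck_on_cong[OF S])
    show "Ck_on k S (\<lambda>z. (-1) * (inverse (f z) * dir_deriv f z v * inverse (f z)))"
      using Suc Ck_on_SucD[OF Suc.prems] by (intro Ck_on_mult[OF S] Ck_on_const Suc.IH) auto
    show "dir_deriv (\<lambda>z. inverse (f z)) z v = (-1) * (inverse (f z) * dir_deriv f z v * inverse (f z))" if "z \<in> S" for z
      using dir_deriv_eqI[OF der[OF that]] by simp
  qed
  then show ?case using der by (auto simp: differentiable_def)
qed

lemma smooth_on_cong:
  "open S \<Longrightarrow> (\<And>x. x \<in> S \<Longrightarrow> f x = g x) \<Longrightarrow> smooth_on S f \<longleftrightarrow> smooth_on S g"
  unfolding smooth_on_def using Ck_on_cong by blast

lemma smooth_on_const: "smooth_on S (\<lambda>_. c)"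
  by (simp add: smooth_on_def Ck_on_const)

lemma smooth_on_add: "open S \<Longrightarrow> smooth_on S f \<Longrightarrow> smooth_on S g \<Longrightarrow> smooth_on S (\<lambda>z. f z + g z)"
  by (simp add: smooth_on_def Ck_on_add)

lemma smooth_on_mult:
  fixes f g :: "'a::real_normed_vector \<Rightarrow> real"
  shows "open S \<Longrightarrow> smooth_on S f \<Longrightarrow> smooth_on S g \<Longrightarrow> smooth_on S (\<lambda>z. f z * g z)"
  by (simp add: smooth_on_def Ck_on_mult)

lemma smooth_on_divide:
  fixes f g :: "'a::real_normed_vector \<Rightarrow> real"
  shows "open S \<Longrightarrow> smooth_on S f \<Longrightarrow> smooth_on S g \<Longrightarrow> (\<And>z. z \<in> S \<Longrightarrow> g z \<noteq> 0) \<Longrightarrow> smooth_on S (\<lambda>z. f z / g z)"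
  unfolding divide_inverse by (simp add: smooth_on_def Ck_on_mult Ck_on_inverse)

lemma smooth_on_diff:
  fixes f g :: "'a::real_normed_vector \<Rightarrow> real"
  shows "open S \<Longrightarrow> smooth_on S f \<Longrightarrow> smooth_on S g \<Longrightarrow> smooth_on S (\<lambda>z. f z - g z)"
  using smooth_on_add[of S f "\<lambda>z. (-1) * g z"] smooth_on_mult[OF _ smooth_on_const, of S g "-1"] by simp

lemma smooth_on_sum:
  fixes f :: "'i \<Rightarrow> 'a::real_normed_vector \<Rightarrow> real"
  shows "open S \<Longrightarrow> (\<And>i. i \<in> I \<Longrightarrow> smooth_on S (f i)) \<Longrightarrow> smooth_on S (\<lambda>z. \<Sum>i\<in>I. f i z)"
  by (induction I rule: infinite_finite_induct) (auto intro: smooth_on_const smooth_on_add)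

lemma smooth_on_prod:
  fixes f :: "'i \<Rightarrow> 'a::real_normed_vector \<Rightarrow> real"
  shows "open S \<Longrightarrow> (\<And>i. i \<in> I \<Longrightarrow> smooth_on S (f i)) \<Longrightarrow> smooth_on S (\<lambda>z. \<Prod>i\<in>I. f i z)"
  by (induction I rule: infinite_finite_induct) (auto intro: smooth_on_const smooth_on_mult)

lemma smooth_on_dir_deriv: "smooth_on S f \<Longrightarrow> smooth_on S (\<lambda>z. dir_deriv f z v)"
  unfolding smooth_on_def using Ck_on.simps(2) by blast

lemma smooth_on_differentiable: "smooth_on S f \<Longrightarrow> z \<in> S \<Longrightarrow> f differentiable (at z)"
  unfolding smooth_on_def using Ck_on.simps(2) by blast

lemma smooth_on_continuous: "smooth_on S f \<Longrightarrow> continuous_on S f"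
  unfolding smooth_on_def using Ck_on.simps(1) by blast

text \<open>The derivative of each of these functions is a linear combination of the next two.\<close>

definition flat :: "nat \<Rightarrow> real \<Rightarrow> real" where
  "flat j x = (if x > 0 then inverse x ^ j * exp (- inverse x) else 0)"

lemma flat_tendsto: "(flat j \<longlongrightarrow> 0) (at 0)"
proof -
  have "((\<lambda>t. t ^ j / exp t :: real) \<longlongrightarrow> 0) at_top"
    by (rule tendsto_power_div_exp_0)
  from filterlim_compose[OF this filterlim_inverse_at_top_right]
  have "((\<lambda>x. inverse x ^ j * exp (- inverse x) :: real) \<longlongrightarrow> 0) (at_right 0)"
    by (simp add: exp_minus field_simps)
  moreover have "\<forall>\<^sub>F x in at_right 0. inverse x ^ j * exp (- inverse x) = flat j x"
    by (auto simp: flat_def eventually_at_right_less intro: eventually_mono[OF eventually_at_right_less])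
  ultimately have "(flat j \<longlongrightarrow> 0) (at_right 0)"
    by (rule Lim_transform_eventually)
  moreover have "(flat j \<longlongrightarrow> 0) (at_left 0)"
    by (rule Lim_transform_eventually[of "\<lambda>_. 0"])
      (auto simp: flat_def eventually_at_filter)
  ultimately show ?thesis by (simp add: filterlim_at_split)
qed

lemma flat_deriv: "(flat j has_real_derivative (flat (Suc (Suc j)) x - real j * flat (Suc j) x)) (at x)"
proof -
  consider "x > 0" | "x < 0" | "x = 0" by linarith
  then show ?thesis
  proof cases
    case 1
    have "((\<lambda>x. inverse x ^ j * exp (- inverse x)) has_real_derivative
        (flat (Suc (Suc j)) x - real j * flat (Suc j) x)) (at x)"
    proof (cases j)
      case 0
      then show ?thesis using 1
        by (auto intro!: derivative_eq_intros simp: flat_def field_simps power2_eq_square)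
    next
      case (Suc i)
      have "x ^ j = x * x ^ (j - 1)" "j \<noteq> 0" using Suc by auto
      then show ?thesis using 1
        by (auto intro!: derivative_eq_intros simp: flat_def field_simps)
    qed
    then show ?thesis
      by (rule has_field_derivative_transform_within_open[of _ _ _ "{0<..}"]) (use 1 in \<open>auto simp: flat_def\<close>)
  next
    case 2
    have "((\<lambda>x. 0) has_real_derivative (flat (Suc (Suc j)) x - real j * flat (Suc j) x)) (at x)"
      using 2 by (simp add: flat_def)
    then show ?thesis
      by (rule has_field_derivative_transform_within_open[of _ _ _ "{..<0}"]) (use 2 in \<open>auto simp: flat_def\<close>)
  next
    case 3
    \<comment> \<open>The difference quotient at 0 is the next function of the family, so
      \<open>flat_tendsto\<close> gives derivative 0 there.\<close>
    have "(flat j y - flat j 0) / (y - 0) = flat (Suc j) y" if "y \<noteq> 0" for y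
      by (simp add: flat_def field_simps)
    then have "\<forall>\<^sub>F y in at 0. flat (Suc j) y = (flat j y - flat j 0) / (y - 0)"
      by (auto simp: eventually_at_filter)
    with flat_tendsto[of "Suc j"] have "((\<lambda>y. (flat j y - flat j 0) / (y - 0)) \<longlongrightarrow> 0) (at 0)"
      by (rule Lim_transform_eventually)
    then show ?thesis using 3 by (simp add: has_field_derivative_iff flat_def)
  qed
qed

lemma Ck_on_flat:
  assumes S: "open S" and f: "\<And>k. Ck_on k S f"
  shows "Ck_on k S (\<lambda>z. flat j (f z))"
proof (induction k arbitrary: j)
  case 0
  have "continuous_on UNIV (flat j)"
    by (intro continuous_at_imp_continuous_on ballI DERIV_isCont[OF flat_deriv])
  moreover have "continuous_on S f" using f[of 0] by simp
  ultimately show ?case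
    using continuous_on_compose2[of UNIV "flat j" S f] by simp
next
  case (Suc k)
  have der: "((\<lambda>z. flat j (f z)) has_derivative
      (\<lambda>v. dir_deriv f z v * (flat (Suc (Suc j)) (f z) - real j * flat (Suc j) (f z)))) (at z)" if "z \<in> S" for z
    using f[of "Suc 0"] that
    by (intro DERIV_compose_FDERIV[OF flat_deriv] dir_deriv_worksI) auto
  have "Ck_on k S (\<lambda>z. dir_deriv (\<lambda>z. flat j (f z)) z v)" for v
  proof (subst Ck_on_cong[OF S])
    show "Ck_on k S (\<lambda>z. dir_deriv f z v * (flat (Suc (Suc j)) (f z) + (- real j) * flat (Suc j) (f z)))"
      using f[of "Suc k"] by (intro Ck_on_mult[OF S] Ck_on_add[OF S] Ck_on_const Suc.IH) auto
    show "dir_deriv (\<lambda>z. flat j (f z)) z v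
        = dir_deriv f z v * (flat (Suc (Suc j)) (f z) + (- real j) * flat (Suc j) (f z))" if "z \<in> S" for z
      using dir_deriv_eqI[OF der[OF that]] by simp
  qed
  then show ?case using der by (auto simp: differentiable_def)
qed

text \<open>The function exp(-1/x), extended by 0, is applied to r^2 - |z - z0|^2. The squared
  distance is written as a sum of products of linear functions so that its smoothness follows from
  the closure rules above.\<close>

lemma ex_bump:
  fixes z0 :: "'a::euclidean_space"
  assumes "open V" "z0 \<in> V"
  obtains b :: "'a \<Rightarrow> real" and K where "smooth_on V b" "\<And>z. b z \<ge> 0" "b z0 > 0"
    "compact K" "K \<subseteq> V" "\<And>z. z \<notin> K \<Longrightarrow> b z = 0"
proof -
  obtain r where r: "r > 0" "cball z0 r \<subseteq> V" using assms open_contains_cball by blast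
  define f :: "'a \<Rightarrow> real" where "f z = r\<^sup>2 - (\<Sum>i\<in>Basis. ((z - z0) \<bullet> i) * ((z - z0) \<bullet> i))" for z
  have f: "f z = r\<^sup>2 - (dist z0 z)\<^sup>2" for z
    using euclidean_inner[of "z - z0" "z - z0"]
    by (simp add: f_def dist_norm norm_minus_commute[of z0] power2_norm_eq_inner)
  have lin: "smooth_on V (\<lambda>z::'a. (z - z0) \<bullet> i)" for i
    unfolding inner_diff_left
    by (intro smooth_on_diff smooth_on_const assms(1)) (simp add: smooth_on_def Ck_on_linear bounded_linear_inner_left)
  have "smooth_on V f" unfolding f_def
    by (intro smooth_on_diff smooth_on_const smooth_on_sum smooth_on_mult lin assms(1))
  then have 1: "smooth_on V (\<lambda>z. flat 0 (f z))"
    unfolding smooth_on_def using Ck_on_flat[OF assms(1)] by blast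
  have 2: "flat 0 (f z) = 0" if "z \<notin> cball z0 r" for z
  proof -
    have "r\<^sup>2 \<le> (dist z0 z)\<^sup>2" using that r by (intro power_mono) auto
    then show ?thesis by (simp add: f flat_def)
  qed
  have 3: "flat 0 (f z0) > 0" using r by (simp add: f flat_def)
  have 4: "flat 0 x \<ge> 0" for x by (simp add: flat_def)
  show ?thesis
    by (rule that[OF 1 4 3 compact_cball r(2) 2])
qed

section \<open>Integrals of derivatives with compact support\<close>

lemma has_real_derivative_along_line:
  fixes f :: "'a::real_normed_vector \<Rightarrow> real"
  assumes "f differentiable (at (z + t *\<^sub>R v))"
  shows "((\<lambda>s. f (z + s *\<^sub>R v)) has_real_derivative dir_deriv f (z + t *\<^sub>R v) v) (at t)"
proof -
  have "((\<lambda>s. z + s *\<^sub>R v) has_derivative (\<lambda>s. s *\<^sub>R v)) (at t)"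
    by (auto intro!: derivative_eq_intros)
  from has_derivative_compose[OF this dir_deriv_worksI[OF assms]]
  have "((\<lambda>s. f (z + s *\<^sub>R v)) has_derivative (\<lambda>s. dir_deriv f (z + t *\<^sub>R v) (s *\<^sub>R v))) (at t)" .
  then show ?thesis
    by (simp add: has_field_derivative_def linear_scale[OF linear_dir_deriv[OF assms]] mult_commute_abs)
qed

text \<open>
  The difference quotients in the direction \<open>v\<close> have integral zero by translation invariance,
  and they converge boundedly to the derivative.
\<close>

lemma integral_dir_deriv_eq_0:
  fixes f :: "'a::euclidean_space \<Rightarrow> real"
  assumes diff: "\<And>z. f differentiable (at z)"
    and cont: "continuous_on UNIV (\<lambda>z. dir_deriv f z v)"
    and K: "compact K" "\<And>z. z \<notin> K \<Longrightarrow> f z = 0"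
  shows "(LINT z|lborel. dir_deriv f z v) = 0"
proof -
  let ?D = "\<lambda>z. dir_deriv f z v"
  have D0: "?D z = 0" if "z \<notin> K" for z
  proof -
    have "?D z = dir_deriv (\<lambda>_. 0) z v"
      by (rule dir_deriv_cong_open[of "- K"]) (use K that compact_imp_closed in \<open>auto simp: open_Compl\<close>)
    also have "\<dots> = 0" by (rule dir_deriv_eqI) (auto intro: derivative_eq_intros)
    finally show ?thesis .
  qed
  obtain R where R: "K \<subseteq> cball 0 R"
  proof -
    obtain R where "\<forall>x\<in>K. norm x \<le> R" using compact_imp_bounded[OF K(1)] bounded_iff by blast
    then have "K \<subseteq> cball 0 R" by auto
    then show ?thesis by (rule that)
  qed
  obtain B where B: "\<And>z. z \<in> K \<Longrightarrow> norm (?D z) \<le> B"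
    using compact_imp_bounded[OF compact_continuous_image[OF continuous_on_subset[OF cont] K(1)]]
    unfolding bounded_iff by blast
  define C where "C = max B 0"
  have C: "\<bar>?D z\<bar> \<le> C" for z using B[of z] D0[of z] by (cases "z \<in> K") (auto simp: C_def)
  define q where "q n z = (f (z + inverse (real (Suc n)) *\<^sub>R v) - f z) / inverse (real (Suc n))" for n z
  have fcont: "continuous_on UNIV f"
    using diff differentiable_imp_continuous_within continuous_at_imp_continuous_on by blast
  have fint: "integrable lborel f"
  proof -
    have "(\<lambda>x. indicat_real K x *\<^sub>R f x) = f" using K(2) by (auto simp: fun_eq_iff indicator_def)
    then show ?thesis using borel_integrable_compact[OF K(1) continuous_on_subset[OF fcont, of K]] by simp
  qed
  have fmeas: "f \<in> borel_measurable borel" by (rule borel_measurable_continuous_onI[OF fcont])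
  have shift: "integrable lborel (\<lambda>z. f (z + c))" "(LINT z|lborel. f (z + c)) = (LINT z|lborel. f z)" for c
  proof -
    have "integrable (distr lborel borel ((+) c)) f" using fint by (simp add: lborel_distr_plus)
    then show "integrable lborel (\<lambda>z. f (z + c))"
      by (subst (asm) integrable_distr_eq) (use fmeas in \<open>auto simp: add.commute\<close>)
    have "(LINT z|lborel. f z) = (LINT z|distr lborel borel ((+) c). f z)" by (simp add: lborel_distr_plus)
    also have "\<dots> = (LINT z|lborel. f (c + z))"
      by (rule integral_distr) (use fmeas in auto)
    finally show "(LINT z|lborel. f (z + c)) = (LINT z|lborel. f z)" by (simp add: add.commute)
  qed
  have q0: "(LINT z|lborel. q n z) = 0" for n
    unfolding q_def using shift fint by simp
  \<comment> \<open>The increments are at most 1, so the mean value theorem evaluates the derivative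
    at a point within \<open>norm v\<close> of z. Enlarging the ball around K by
    \<open>norm v\<close> gives one dominating function for all n.\<close>
  have qbound: "norm (q n z) \<le> C * indicator (cball 0 (R + norm v)) z" for n z
  proof -
    let ?h = "inverse (real (Suc n))"
    have h: "0 < ?h" "?h \<le> 1" by (auto simp: field_simps)
    obtain s where s: "0 < s" "s < ?h" "f (z + ?h *\<^sub>R v) - f (z + 0 *\<^sub>R v) = (?h - 0) * ?D (z + s *\<^sub>R v)"
      using MVT2[OF h(1) has_real_derivative_along_line[OF diff]] by blast
    then have qs: "q n z = ?D (z + s *\<^sub>R v)" using h by (simp add: q_def field_simps)
    show ?thesis
    proof (cases "z \<in> cball 0 (R + norm v)")
      case True
      then show ?thesis using C qs by simp
    next
      case False
      have "norm z \<le> norm (z + s *\<^sub>R v) + norm (s *\<^sub>R v)"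
        using norm_triangle_ineq4[of "z + s *\<^sub>R v" "s *\<^sub>R v"] by simp
      moreover have "norm (s *\<^sub>R v) \<le> norm v" using s h by (simp add: mult_left_le_one_le)
      ultimately have "z + s *\<^sub>R v \<notin> K" using False R by auto
      then show ?thesis using D0 qs False by simp
    qed
  qed
  have qlim: "(\<lambda>n. q n z) \<longlonglongrightarrow> ?D z" for z
  proof -
    have "((\<lambda>h. (f (z + (0 + h) *\<^sub>R v) - f (z + 0 *\<^sub>R v)) / h) \<longlongrightarrow> ?D (z + 0 *\<^sub>R v)) (at 0)"
      using has_real_derivative_along_line[OF diff, where z = z and t = 0 and v = v] by (simp add: DERIV_def)
    moreover have "filterlim (\<lambda>n. inverse (real (Suc n))) (at 0) sequentially"
      using LIMSEQ_inverse_real_of_nat by (auto simp: filterlim_at)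
    ultimately show ?thesis
      unfolding q_def by (auto dest: filterlim_compose)
  qed
  have "(\<lambda>n. LINT z|lborel. q n z) \<longlonglongrightarrow> (LINT z|lborel. ?D z)"
  proof (rule integral_dominated_convergence[where w = "\<lambda>z. C * indicator (cball 0 (R + norm v)) z"])
    show "?D \<in> borel_measurable lborel"
      using borel_measurable_continuous_onI[OF cont] by simp
    show "q n \<in> borel_measurable lborel" for n
    proof -
      have "continuous_on UNIV (q n)"
        unfolding q_def by (intro continuous_intros continuous_on_compose2[OF fcont]) auto
      then show ?thesis using borel_measurable_continuous_onI by simp
    qed
    show "integrable lborel (\<lambda>z. C * indicator (cball 0 (R + norm v)) z)"
      using emeasure_lborel_cball_finite by (intro integrable_mult_right integrable_real_indicator) auto
  qed (use qbound qlim in auto)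
  then show ?thesis unfolding q0 using LIMSEQ_unique[OF _ tendsto_const] by blast
qed

text \<open>The extension of f by zero is differentiable everywhere because V and the complement of
  K are open and cover the space; the previous lemma applies to it.\<close>

lemma set_integral_dir_deriv_eq_0:
  fixes f :: "'a::euclidean_space \<Rightarrow> real"
  assumes V: "open V" and K: "compact K" "K \<subseteq> V"
    and diff: "\<And>z. z \<in> V \<Longrightarrow> f differentiable (at z)"
    and cont: "continuous_on V (\<lambda>z. dir_deriv f z v)"
    and f0: "\<And>z. z \<in> V - K \<Longrightarrow> f z = 0"
  shows "(LINT z:V|lborel. dir_deriv f z v) = 0"
proof -
  define F where "F z = (if z \<in> V then f z else 0)" for z
  have open_K: "open (- K)" using K compact_imp_closed by (auto simp: open_Compl)
  have FK: "F z = 0" if "z \<in> - K" for z using that f0 by (auto simp: F_def)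
  have diffF: "F differentiable (at z)" for z
  proof (cases "z \<in> V")
    case True
    then show ?thesis
      using differentiable_cong_open[OF V True, of F f] diff by (simp add: F_def)
  next
    case False
    then have z: "z \<in> - K" using K by auto
    show ?thesis using differentiable_cong_open[OF open_K z, of F "\<lambda>_. 0"] FK by simp
  qed
  have DV: "dir_deriv F z v = dir_deriv f z v" if "z \<in> V" for z
    by (rule dir_deriv_cong_open[OF V that]) (simp add: F_def)
  have DK: "dir_deriv F z v = 0" if "z \<in> - K" for z
  proof -
    have "dir_deriv F z v = dir_deriv (\<lambda>_. 0) z v"
      by (rule dir_deriv_cong_open[OF open_K that]) (use FK in auto)
    also have "\<dots> = 0" by (rule dir_deriv_eqI) (auto intro: derivative_eq_intros)
    finally show ?thesis .
  qed
  have "continuous_on V (\<lambda>z. dir_deriv F z v)" using cont DV by (simp cong: continuous_on_cong)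
  moreover have "continuous_on (- K) (\<lambda>z. dir_deriv F z v)"
    by (subst continuous_on_cong[OF refl DK]) auto
  ultimately have "continuous_on (V \<union> - K) (\<lambda>z. dir_deriv F z v)"
    using V open_K continuous_on_open_Un by blast
  moreover have "V \<union> - K = UNIV" using K by auto
  ultimately have "(LINT z|lborel. dir_deriv F z v) = 0"
    using integral_dir_deriv_eq_0[OF diffF _ K(1)] FK by auto
  moreover have "indicat_real V z *\<^sub>R dir_deriv f z v = dir_deriv F z v" for z
    using DV DK K by (cases "z \<in> V") auto
  ultimately show ?thesis by (simp add: set_lebesgue_integral_def)
qed

lemma set_integrable_compact_support:
  fixes h :: "'a::euclidean_space \<Rightarrow> real"
  assumes K: "compact K" "K \<subseteq> V" and cont: "continuous_on V h" and h0: "\<And>z. z \<in> V - K \<Longrightarrow> h z = 0"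
  shows "set_integrable lborel V h"
proof -
  have "(\<lambda>z. indicat_real V z *\<^sub>R h z) = (\<lambda>z. indicat_real K z *\<^sub>R h z)"
    using K h0 by (auto simp: indicator_def fun_eq_iff)
  then show ?thesis
    unfolding set_integrable_def using borel_integrable_compact[OF K(1) continuous_on_subset[OF cont K(2)]] by simp
qed

lemma set_integral_nonneg_eq_0_imp:
  fixes h :: "'a::euclidean_space \<Rightarrow> real"
  assumes V: "open V" and cont: "continuous_on V h" and int: "set_integrable lborel V h"
    and nonneg: "\<And>z. z \<in> V \<Longrightarrow> h z \<ge> 0" and zero: "(LINT z:V|lborel. h z) = 0" and z: "z \<in> V"
  shows "h z = 0"
proof (rule ccontr)
  assume "h z \<noteq> 0"
  then have "h z > 0" using nonneg[OF z] by simp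
  have "open (h -` {0<..} \<inter> V)"
    by (rule continuous_on_open_vimage[OF V, THEN iffD1, OF cont, rule_format, OF open_greaterThan])
  moreover have "z \<in> h -` {0<..} \<inter> V" using z \<open>h z > 0\<close> by simp
  ultimately obtain r where r: "r > 0" "ball z r \<subseteq> h -` {0<..} \<inter> V"
    by (rule openE)
  have "AE x in lborel. indicat_real V x *\<^sub>R h x = 0"
    using zero int nonneg
    by (subst integral_nonneg_eq_0_iff_AE[symmetric])
      (auto simp: set_integrable_def set_lebesgue_integral_def indicator_def)
  then have "AE x in lborel. x \<notin> ball z r"
    by eventually_elim (use r in \<open>auto simp: indicator_def split: if_splits\<close>)
  then have "emeasure lborel (ball z r) = 0"
    by (subst (asm) AE_iff_measurable[of "ball z r"]) auto
  moreover have "emeasure lborel (ball z r) > 0"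
    using r by (simp add: emeasure_ball)
  ultimately show False by simp
qed

section \<open>Metric traces and volume in coordinates\<close>

definition gram :: "'n::finite metric \<Rightarrow> real^('n + 'n)^('n + 'n)" where
  "gram g = (\<chi> i j. g (real_coord i) (real_coord j))"

text \<open>Entries of the inverse Gram matrix, written out by Cramer's rule. As quotients of
  polynomials in the metric coefficients they are visibly smooth in the base point.\<close>

definition inv_gram :: "'n::finite metric \<Rightarrow> 'n + 'n \<Rightarrow> 'n + 'n \<Rightarrow> real" where
  "inv_gram g c k = det (\<chi> i j. if j = k then if i = c then 1 else 0 else g (real_coord i) (real_coord j)) / det (gram g)"

definition coord :: "'n::finite + 'n \<Rightarrow> 'n tvec \<Rightarrow> real" where
  "coord c v = (case c of Inl i \<Rightarrow> Re (v $ i) | Inr i \<Rightarrow> Im (v $ i))"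

lemma real_coord_expand: "(\<Sum>c\<in>UNIV. coord c v *\<^sub>R real_coord c) = (v :: 'n::finite tvec)"
proof -
  have "(\<Sum>c\<in>UNIV. coord c v *\<^sub>R real_coord c) $ j = v $ j" for j
  proof -
    have "(\<Sum>c\<in>UNIV. coord c v *\<^sub>R real_coord c) $ j
      = (\<Sum>i\<in>UNIV. (Re (v $ i) *\<^sub>R axis i 1) $ j) + (\<Sum>i\<in>UNIV. (Im (v $ i) *\<^sub>R axis i \<i>) $ j)"
      unfolding UNIV_Plus_UNIV[symmetric]
      by (subst sum.Plus) (simp_all add: coord_def real_coord_def)
    also have "\<dots> = (\<Sum>i\<in>UNIV. if i = j then Re (v $ j) *\<^sub>R 1 else 0) + (\<Sum>i\<in>UNIV. if i = j then Im (v $ j) *\<^sub>R \<i> else 0)"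
      by (intro arg_cong2[where f = "(+)"] sum.cong refl) (auto simp: axis_def)
    also have "\<dots> = v $ j" by (simp add: complex_eq_iff)
    finally show ?thesis .
  qed
  then show ?thesis by (simp add: vec_eq_iff)
qed

context inner_form
begin

lemma gram_frame:
  assumes e: "orthonormal_frame g e"
  defines "P \<equiv> (\<chi> i b. g (real_coord i) (e b)) :: real^('n + 'n)^('n + 'n)"
  shows "det P \<noteq> 0"
    and "bilinear B \<Longrightarrow> gram B = P ** (\<chi> i j. B (e i) (e j)) ** transpose P"
proof -
  define Q where "Q = (\<chi> b i. coord i (e b)) ** P"
  have "Q $ b $ c = (if b = c then 1 else 0)" for b c
  proof -
    have "Q $ b $ c = g (\<Sum>i\<in>UNIV. coord i (e b) *\<^sub>R real_coord i) (e c)"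
      by (simp add: Q_def P_def matrix_matrix_mult_def g_sum g_simps)
    then show ?thesis using e by (simp add: real_coord_expand orthonormal_frame_def)
  qed
  then have "Q = mat 1" by (simp add: mat_def vec_eq_iff)
  then have "det Q = 1" by simp
  then show "det P \<noteq> 0" unfolding Q_def det_mul by auto
  assume B: "bilinear B"
  then have lin: "linear (\<lambda>x. B x y)" "linear (B x)" for x y unfolding bilinear_def by blast+
  have "B (real_coord i) (real_coord j)
    = (\<Sum>d\<in>UNIV. (\<Sum>c\<in>UNIV. g (real_coord i) (e c) * B (e c) (e d)) * g (real_coord j) (e d))" for i j
    using frame_real[OF e lin(1)] frame_real[OF e lin(2)[of "real_coord i"], of "real_coord j"]
    by (simp add: mult.commute)
  then show "gram B = P ** (\<chi> i j. B (e i) (e j)) ** transpose P"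
    by (simp add: gram_def P_def matrix_matrix_mult_def transpose_def vec_eq_iff)
qed

lemma det_gram_pos: "det (gram g) > 0"
proof -
  obtain e where e: "orthonormal_frame g e" using ex_orthonormal_frame by blast
  have "(\<chi> i j. g (e i) (e j)) = mat 1"
    using e by (simp add: orthonormal_frame_def mat_def vec_eq_iff)
  then have "det (gram g) = det (\<chi> i b. g (real_coord i) (e b)) * det (\<chi> i b. g (real_coord i) (e b))"
    unfolding gram_frame(2)[OF e bilinear_g] by (simp add: det_mul)
  then show ?thesis using gram_frame(1)[OF e] not_real_square_gt_zero by metis
qed

lemma metric_trace_coord:
  assumes B: "bilinear B"
  shows "metric_trace g B = (\<Sum>c\<in>UNIV. \<Sum>k\<in>UNIV. inv_gram g c k * B (real_coord c) (real_coord k))"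
proof -
  obtain e where e: "orthonormal_frame g e" using ex_orthonormal_frame by blast
  have lin: "linear (\<lambda>x. B x y)" "linear (B x)" for x y using B unfolding bilinear_def by blast+
  \<comment> \<open>\<open>W c\<close> is the vector dual to the coordinate \<open>coord c\<close>:
    pairing v with it under g returns that coordinate of v.\<close>
  define W where "W c = (\<Sum>k\<in>UNIV. inv_gram g c k *\<^sub>R real_coord k)" for c
  have gW: "g (real_coord i) (W c) = (if i = c then 1 else 0)" for i c
  proof -
    have "gram g *v (\<chi> k. inv_gram g c k) = (\<chi> i. if i = c then 1 else 0)"
      using det_gram_pos by (subst cramer) (simp_all add: inv_gram_def gram_def vec_eq_iff cong: if_cong)
    then have "(gram g *v (\<chi> k. inv_gram g c k)) $ i = (if i = c then 1 else 0)" by simp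
    then show ?thesis
      by (simp add: W_def g_sum g_simps matrix_vector_mult_def gram_def mult.commute)
  qed
  have expand_W: "(\<Sum>c\<in>UNIV. g v (W c) *\<^sub>R real_coord c) = v" for v
  proof -
    have "g v (W c) = coord c v" for c
    proof -
      have "g v (W c) = g (\<Sum>i\<in>UNIV. coord i v *\<^sub>R real_coord i) (W c)" by (simp add: real_coord_expand)
      also have "\<dots> = (\<Sum>i\<in>UNIV. coord i v * (if i = c then 1 else 0))" by (simp add: g_sum g_simps gW)
      finally show ?thesis by (simp add: if_distrib[of "(*) _"] cong: if_cong)
    qed
    then show ?thesis by (simp add: real_coord_expand)
  qed
  have "metric_trace g B = (\<Sum>a\<in>UNIV. B (\<Sum>c\<in>UNIV. g (e a) (W c) *\<^sub>R real_coord c) (e a))"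
    unfolding metric_trace_eq[OF B e] expand_W ..
  also have "\<dots> = (\<Sum>a\<in>UNIV. \<Sum>c\<in>UNIV. g (W c) (e a) * B (real_coord c) (e a))"
    by (simp add: linear_sum[OF lin(1)] linear_scale[OF lin(1)] sym[of "e _"])
  also have "\<dots> = (\<Sum>c\<in>UNIV. \<Sum>a\<in>UNIV. g (W c) (e a) * B (real_coord c) (e a))"
    by (rule sum.swap)
  also have "\<dots> = (\<Sum>c\<in>UNIV. B (real_coord c) (W c))"
    by (simp only: frame_real[OF e lin(2)])
  finally show ?thesis
    by (simp add: W_def linear_sum[OF lin(2)] linear_scale[OF lin(2)])
qed

end

section \<open>Smoothness of metric traces and the derivative of the volume density\<close>

lemma smooth_on_det:
  fixes A :: "'a::real_normed_vector \<Rightarrow> real^'k^'k"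
  assumes "open S" "\<And>i j. smooth_on S (\<lambda>z. A z $ i $ j)"
  shows "smooth_on S (\<lambda>z. det (A z))"
  unfolding det_def using assms
  by (intro smooth_on_sum smooth_on_mult smooth_on_const smooth_on_prod)

lemma det_has_derivative_at_one:
  fixes H :: "'a::real_normed_vector \<Rightarrow> real^'k^'k"
  assumes der: "\<And>i j. ((\<lambda>w. H w $ i $ j) has_derivative (\<lambda>v. H' i j v)) (at z)" and one: "H z = mat 1"
  shows "((\<lambda>w. det (H w)) has_derivative (\<lambda>v. \<Sum>i\<in>UNIV. H' i i v)) (at z)"
proof -
  have Hz: "H z $ i $ j = (if i = j then 1 else 0)" for i j by (simp add: one mat_def)
  have 1: "((\<lambda>w. det (H w)) has_derivative (\<lambda>v. \<Sum>p | p permutes UNIV. of_int (sign p) *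
      (\<Sum>i\<in>UNIV. H' i (p i) v * (\<Prod>j\<in>UNIV - {i}. H z $ j $ p j)))) (at z)"
    unfolding det_def
    by (intro has_derivative_sum has_derivative_mult_right has_derivative_prod der)
  have 2: "of_int (sign p) * (\<Sum>i\<in>UNIV. H' i (p i) v * (\<Prod>j\<in>UNIV - {i}. H z $ j $ p j))
      = (if p = id then \<Sum>i\<in>UNIV. H' i i v else 0)" if p: "p permutes UNIV" for p v
  proof (cases "p = id")
    case True
    then show ?thesis by (simp add: Hz sign_id)
  next
    case False
    then obtain a where a: "p a \<noteq> a" by (auto simp: fun_eq_iff)
    then have pa: "p (p a) \<noteq> p a" using permutes_inj[OF p] by (auto simp: inj_def)
    \<comment> \<open>A permutation other than the identity moves both a and \<open>p a\<close>.
      Omitting the factor at i therefore still leaves a zero off-diagonal entry, and only the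
      identity contributes to the derivative.\<close>
    have "(\<Prod>j\<in>UNIV - {i}. H z $ j $ p j) = 0" for i
    proof (cases "i = a")
      case True
      then show ?thesis using a pa by (intro prod_zero) (auto simp: Hz intro!: bexI[of _ "p a"])
    next
      case False
      then show ?thesis using a by (intro prod_zero) (auto simp: Hz intro!: bexI[of _ a])
    qed
    then show ?thesis using False by (simp only: mult_zero_right sum.neutral_const if_False)
  qed
  have "(\<lambda>v. \<Sum>p | p permutes UNIV. of_int (sign p) *
      (\<Sum>i\<in>UNIV. H' i (p i) v * (\<Prod>j\<in>UNIV - {i}. H z $ j $ p j)))
    = (\<lambda>v. \<Sum>p | p permutes (UNIV::'k set). (if p = id then \<Sum>i\<in>UNIV. H' i i v else 0))"
    by (intro ext sum.cong refl) (use 2 in auto)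
  also have "\<dots> = (\<lambda>v. \<Sum>i\<in>UNIV. H' i i v)"
    by (simp add: sum.delta permutes_id finite_permutations)
  finally show ?thesis using 1 by simp
qed

lemma smooth_on_inv_gram:
  assumes "open V" "\<And>x y. smooth_on V (\<lambda>z. G z x y)" "\<And>z. z \<in> V \<Longrightarrow> inner_form (G z)"
  shows "smooth_on V (\<lambda>z. inv_gram (G z) c k)"
  unfolding inv_gram_def
proof (intro smooth_on_divide assms(1) smooth_on_det)
  show "smooth_on V (\<lambda>z. (\<chi> i j. if j = k then if i = c then 1 else 0 else G z (real_coord i) (real_coord j)) $ i $ j)" for i j
    using assms(2) smooth_on_const by (cases "j = k"; cases "i = c") auto
  show "smooth_on V (\<lambda>z. gram (G z) $ i $ j)" for i j
    using assms(2) by (simp add: gram_def)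
  show "det (gram (G z)) \<noteq> 0" if "z \<in> V" for z
    using inner_form.det_gram_pos[OF assms(3)[OF that]] by simp
qed

lemma smooth_on_metric_trace:
  assumes V: "open V" and G: "\<And>x y. smooth_on V (\<lambda>z. G z x y)" "\<And>z. z \<in> V \<Longrightarrow> inner_form (G z)"
    and B: "\<And>x y. smooth_on V (\<lambda>z. B z x y)" "\<And>z. z \<in> V \<Longrightarrow> bilinear (B z)"
  shows "smooth_on V (\<lambda>z. metric_trace (G z) (B z))"
proof (subst smooth_on_cong[OF V])
  show "smooth_on V (\<lambda>z. \<Sum>c\<in>UNIV. \<Sum>k\<in>UNIV. inv_gram (G z) c k * B z (real_coord c) (real_coord k))"
    by (intro smooth_on_sum smooth_on_mult smooth_on_inv_gram V G B)
qed (use inner_form.metric_trace_coord G B in blast)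

text \<open>With the frame frozen at z, the Gram matrix near z is P H P^T with P constant and H = 1
  at z. So the derivative of the determinant is a trace, and the square root supplies the factor
  1/2.\<close>

lemma volume_density_has_derivative:
  assumes "open V" "z \<in> V" and G: "\<And>w. w \<in> V \<Longrightarrow> inner_form (G w)"
    and diff: "\<And>x y. (\<lambda>w. G w x y) differentiable (at z)" and e: "orthonormal_frame (G z) e"
  shows "((\<lambda>w. volume_density (G w)) has_derivative
      (\<lambda>v. volume_density (G z) * (\<Sum>c\<in>UNIV. dir_deriv (\<lambda>w. G w (e c) (e c)) z v) / 2)) (at z)"
proof -
  define H where "H w = (\<chi> i j. G w (e i) (e j))" for w
  define P where "P = (\<chi> i b. G z (real_coord i) (e b))"
  have Hz: "H z = mat 1"
    using e by (simp add: H_def orthonormal_frame_def mat_def vec_eq_iff)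
  have vol: "volume_density (G w) = \<bar>det P\<bar> * sqrt (det (H w))" if "w \<in> V" for w
  proof -
    have "gram (G w) = P ** H w ** transpose P"
      unfolding P_def H_def
      by (rule inner_form.gram_frame(2)[OF G[OF assms(2)] e inner_form.bilinear_g[OF G[OF that]]])
    then show ?thesis
      by (simp add: volume_density_def gram_def[symmetric] det_mul real_sqrt_mult)
  qed
  have "((\<lambda>w. H w $ i $ j) has_derivative (\<lambda>v. dir_deriv (\<lambda>w. G w (e i) (e j)) z v)) (at z)" for i j
    using dir_deriv_worksI[OF diff] by (simp add: H_def)
  from det_has_derivative_at_one[of H, OF this Hz]
  have "((\<lambda>w. det (H w)) has_derivative (\<lambda>v. \<Sum>i\<in>UNIV. dir_deriv (\<lambda>w. G w (e i) (e i)) z v)) (at z)" .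
  then have "((\<lambda>w. \<bar>det P\<bar> * sqrt (det (H w))) has_derivative
      (\<lambda>v. \<bar>det P\<bar> * (\<Sum>c\<in>UNIV. dir_deriv (\<lambda>w. G w (e c) (e c)) z v) / 2)) (at z)"
    using Hz by (auto intro!: derivative_eq_intros simp: field_simps)
  moreover have "volume_density (G z) = \<bar>det P\<bar>" using vol[OF assms(2)] by (simp add: Hz)
  ultimately show ?thesis
    using has_derivative_transform_within_open[of "\<lambda>w. \<bar>det P\<bar> * sqrt (det (H w))" _ z UNIV V]
      assms(1,2) vol by auto
qed

section \<open>Hermitian metrics on an open set\<close>

lemma lw_has_derivative:
  fixes l :: "'z::real_normed_vector \<Rightarrow> 'a \<Rightarrow> real"
  assumes "\<And>x. ((\<lambda>w. l w x) has_derivative (\<lambda>v. l' v x)) (at z)"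
    and "\<And>us. ((\<lambda>w. b w us) has_derivative (\<lambda>v. b' v us)) (at z)"
  shows "((\<lambda>w. lw (l w) (b w) vs) has_derivative (\<lambda>v. lw (l' v) (b z) vs + lw (l z) (b' v) vs)) (at z)"
  using assms(2)
proof (induction vs arbitrary: b b')
  case (Cons x us)
  have "((\<lambda>w. l w x * b w us - lw (l w) (\<lambda>ws. b w (x # ws)) us) has_derivative
     (\<lambda>v. l z x * b' v us + l' v x * b z us - (lw (l' v) (\<lambda>ws. b z (x # ws)) us + lw (l z) (\<lambda>ws. b' v (x # ws)) us))) (at z)"
    by (intro has_derivative_diff has_derivative_mult assms(1) Cons.prems Cons.IH)
  then show ?case by (simp add: algebra_simps)
qed simp

lemma (in coframe) L2_has_derivative:
  fixes A :: "'z::real_normed_vector \<Rightarrow> 'a \<Rightarrow> 'a \<Rightarrow> real"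
  assumes "\<And>x y. ((\<lambda>w. A w x y) has_derivative (\<lambda>v. A' v x y)) (at z)"
    and "\<And>us. ((\<lambda>w. b w us) has_derivative (\<lambda>v. b' v us)) (at z)"
  shows "((\<lambda>w. L2 (A w) (b w) vs) has_derivative (\<lambda>v. L2 (A' v) (b z) vs + L2 (A z) (b' v) vs)) (at z)"
proof -
  have "((\<lambda>w. lw (eps c) (lw (A w (E c)) (b w)) vs) has_derivative
      (\<lambda>v. lw (eps c) (lw (A' v (E c)) (b z)) vs + lw (eps c) (lw (A z (E c)) (b' v)) vs)) (at z)" for c
  proof -
    have "((\<lambda>w. lw (eps c) (lw (A w (E c)) (b w)) vs) has_derivative
      (\<lambda>v. lw (\<lambda>_. 0) (lw (A z (E c)) (b z)) vs
        + lw (eps c) (\<lambda>us. lw (A' v (E c)) (b z) us + lw (A z (E c)) (b' v) us) vs)) (at z)"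
      by (rule lw_has_derivative[OF _ lw_has_derivative]) (auto intro: assms)
    then show ?thesis by (simp add: lw_add)
  qed
  then have "((\<lambda>w. (\<Sum>c\<in>UNIV. lw (eps c) (lw (A w (E c)) (b w)) vs)) has_derivative
      (\<lambda>v. (\<Sum>c\<in>UNIV. lw (eps c) (lw (A' v (E c)) (b z)) vs + lw (eps c) (lw (A z (E c)) (b' v)) vs))) (at z)"
    by (rule has_derivative_sum)
  from has_derivative_mult_right[OF this, of "1 / 2"] show ?thesis
    unfolding L2_def by (simp add: sum.distrib add_divide_distrib)
qed

text \<open>By \<open>L2_commute\<close> the differentiated factor can be moved to the front, so the
  m terms of the product rule agree.\<close>

lemma (in coframe) Lpow_has_derivative:
  fixes A :: "'z::real_normed_vector \<Rightarrow> 'a \<Rightarrow> 'a \<Rightarrow> real"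
  assumes "\<And>x y. ((\<lambda>w. A w x y) has_derivative (\<lambda>v. A' v x y)) (at z)"
  shows "((\<lambda>w. Lpow (A w) m vs) has_derivative (\<lambda>v. real m * L2 (A' v) (Lpow (A z) (m - 1)) vs)) (at z)"
proof (induction m arbitrary: vs)
  case (Suc m)
  have eq: "L2 (A' v) (Lpow (A z) m) vs + L2 (A z) (\<lambda>us. real m * L2 (A' v) (Lpow (A z) (m - 1)) us) vs
     = real (Suc m) * L2 (A' v) (Lpow (A z) m) vs" for v
  proof (cases m)
    case (Suc k)
    have "L2 (A z) (L2 (A' v) (Lpow (A z) k)) = L2 (A' v) (L2 (A z) (Lpow (A z) k))"
      by (rule L2_commute)
    then show ?thesis
      by (simp only: Suc diff_Suc_1 L2_cmult Lpow_simps of_nat_Suc[of "Suc k"] distrib_right mult_1_left)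
  qed simp
  show ?case
    unfolding Lpow_simps diff_Suc_1 eq[symmetric] by (rule L2_has_derivative) (rule assms Suc.IH)+
qed simp

lemma length_1_cases:
  assumes "length vs = 1" obtains v where "vs = [v]"
  using assms by (cases vs) auto

locale hermitian_patch =
  fixes V :: "'n::finite tvec set" and \<omega> :: "'n form_field"
  assumes open_V: "open V" and form: "form_on V 2 \<omega>"
    and J_inv: "z \<in> V \<Longrightarrow> \<omega> z [J X, J Y] = \<omega> z [X, Y]"
    and positivity: "z \<in> V \<Longrightarrow> X \<noteq> 0 \<Longrightarrow> \<omega> z [X, J X] > 0"
begin

definition a :: "'n tvec \<Rightarrow> 'n tvec \<Rightarrow> 'n tvec \<Rightarrow> real" where
  "a z x y = \<omega> z [x, y]"

definition da :: "'n tvec \<Rightarrow> 'n tvec \<Rightarrow> 'n tvec \<Rightarrow> 'n tvec \<Rightarrow> real" where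
  "da z v x y = dir_deriv (\<lambda>w. \<omega> w [x, y]) z v"

abbreviation G :: "'n metric_field" where "G \<equiv> assoc_metric \<omega>"

text \<open>The very choice made inside \<open>metric_trace\<close>. Hence
  \<open>metric_trace_fr\<close> rewrites a trace as a sum over this frame by unfolding, for
  arbitrary B.\<close>

definition fr :: "'n tvec \<Rightarrow> 'n + 'n \<Rightarrow> 'n tvec" where
  "fr z = (SOME e. orthonormal_frame (G z) e)"

lemma metric_trace_fr: "metric_trace (G z) B = (\<Sum>c\<in>UNIV. B (fr z c) (fr z c))"
  by (simp add: metric_trace_def fr_def Let_def)

lemma smooth_\<omega>: "smooth_on V (\<lambda>z. \<omega> z [x, y])"
  using form by (simp add: form_on_def)

lemma diff_\<omega>: "z \<in> V \<Longrightarrow> (\<lambda>w. \<omega> w [x, y]) differentiable (at z)"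
  by (rule smooth_on_differentiable[OF smooth_\<omega>])

lemma a_alt:
  assumes "z \<in> V" shows "bilin_alt (a z)"
proof -
  have alt: "alternating_form 2 (\<omega> z)" using form assms by (simp add: form_on_def)
  have l1: "linear (\<lambda>x. a z x y)" for y
  proof -
    have "linear (\<lambda>v. \<omega> z ([0, y][0 := v]))"
      by (rule alt[unfolded alternating_form_def, THEN conjunct1, rule_format]) simp_all
    then show ?thesis by (simp add: a_def)
  qed
  have l2: "linear (a z x)" for x
  proof -
    have "linear (\<lambda>v. \<omega> z ([x, 0][1 := v]))"
      by (rule alt[unfolded alternating_form_def, THEN conjunct1, rule_format]) simp_all
    then show ?thesis by (simp add: a_def[abs_def])
  qed
  have zero: "a z x x = 0" for x
  proof -
    have "\<forall>vs i j. length vs = 2 \<longrightarrow> i < j \<longrightarrow> j < 2 \<longrightarrow> vs ! i = vs ! j \<longrightarrow> \<omega> z vs = 0"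
      using alt unfolding alternating_form_def by blast
    from this[rule_format, of "[x, x]" 0 1] show ?thesis by (simp add: a_def)
  qed
  have "a z x y = - a z y x" for x y
    using zero[of "x + y"] zero[of x] zero[of y] linear_add[OF l1, of x y "x + y"] linear_add[OF l2, of _ x y] by simp
  then show ?thesis using l1 l2 unfolding bilin_alt_def bilinear_def by blast
qed

lemma hermitian_form_a: "z \<in> V \<Longrightarrow> hermitian_form (a z)"
  using a_alt J_inv positivity by unfold_locales (auto simp: a_def)

lemma g_eq: "z \<in> V \<Longrightarrow> hermitian_form.g (a z) = G z"
  by (rule ext)+ (simp add: hermitian_form.g_def[OF hermitian_form_a] a_def assoc_metric_def)

text \<open>Linear relations between values of \<omega> that hold throughout V pass to the
  derivative. Its instances give additivity, homogeneity, skewness and J-invariance of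
  \<open>da\<close>.\<close>

lemma da_cong:
  assumes "z \<in> V" "\<And>w. w \<in> V \<Longrightarrow> a w x y = r * a w x' y' + s * a w x'' y''"
  shows "da z v x y = r * da z v x' y' + s * da z v x'' y''"
proof -
  have "da z v x y = dir_deriv (\<lambda>w. r * \<omega> w [x', y'] + s * \<omega> w [x'', y'']) z v"
    unfolding da_def by (rule dir_deriv_cong_open[OF open_V assms(1)]) (use assms(2) in \<open>simp add: a_def\<close>)
  also have "\<dots> = r * da z v x' y' + s * da z v x'' y''"
    unfolding da_def by (intro dir_deriv_eqI has_derivative_add has_derivative_mult_right dir_deriv_worksI diff_\<omega> assms)
  finally show ?thesis .
qed

lemma hermitian_jet_a:
  assumes z: "z \<in> V" shows "hermitian_jet (a z) (da z)"
proof -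
  interpret hermitian_form "a z" by (rule hermitian_form_a[OF z])
  note lin = bilin_altD(1)[OF a_alt] bilin_altD(2)[OF a_alt]
  have add: "da z v (x + x') y = da z v x y + da z v x' y" for v x x' y
    using da_cong[OF z, of "x + x'" y 1 x y 1 x' y] linear_add[OF lin(1)] by simp
  have scale: "da z v (r *\<^sub>R x) y = r * da z v x y" for v x r y
    using da_cong[OF z, of "r *\<^sub>R x" y r x y 0 x y] linear_scale[OF lin(1)] by simp
  have skew: "da z v x y = - da z v y x" for v x y
    using da_cong[OF z, of x y "-1" y x 0 x y] bilin_altD(3)[OF a_alt, of _ x y] by simp
  have lin1: "linear (\<lambda>x. da z v x y)" for v y
    by (rule linearI) (simp_all add: add scale)
  have lin2: "linear (da z v x)" for v x
  proof -
    have "da z v x = (\<lambda>y. - da z v y x)" by (rule ext) (rule skew)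
    then show ?thesis using linear_compose_neg[OF lin1] by simp
  qed
  show ?thesis
  proof (intro hermitian_jet.intro hermitian_jet_axioms.intro hermitian_form_a z)
    show "linear (\<lambda>v. da z v x y)" for x y
      unfolding da_def by (rule linear_dir_deriv[OF diff_\<omega>[OF z]])
    show "bilin_alt (da z v)" for v
      unfolding bilin_alt_def bilinear_def using lin1 lin2 skew by blast
    show "da z v (J x) (J y) = da z v x y" for v x y
      using da_cong[OF z, of "J x" "J y" 1 x y 0 x y] J_inv by (simp add: a_def)
  qed
qed

lemma inner_form_G: "z \<in> V \<Longrightarrow> inner_form (G z)"
proof -
  assume z: "z \<in> V"
  interpret hermitian_form "a z" rewrites "hermitian_form.g (a z) = G z"
    by (rule hermitian_form_a[OF z]) (rule g_eq[OF z])
  show ?thesis by (rule inner_form_axioms)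
qed

lemma fr: "z \<in> V \<Longrightarrow> orthonormal_frame (G z) (fr z)"
  unfolding fr_def using inner_form.ex_orthonormal_frame[OF inner_form_G] by (rule someI_ex)

lemma ext_d_\<omega>:
  assumes z: "z \<in> V" shows "ext_d \<omega> z [x, y, u] = hermitian_jet.tau (da z) x y u"
proof -
  interpret hermitian_jet "a z" "da z" by (rule hermitian_jet_a[OF z])
  have "ext_d \<omega> z [x, y, u] = da z x y u - da z y x u + da z u x y"
    by (simp add: ext_d_def da_def numeral_3_eq_3)
  then show ?thesis using da_skew[of y x u] by (simp add: tau_def)
qed

text \<open>The contraction \<open>\<Lambda> d\<omega>\<close>, which turns out to be the Lee form.\<close>

definition theta :: "'n tvec \<Rightarrow> 'n tvec \<Rightarrow> real" where
  "theta z v = (\<Sum>c\<in>UNIV. ext_d \<omega> z [v, fr z c, J (fr z c)]) / 2"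

lemma theta_eq: "z \<in> V \<Longrightarrow> theta z = hermitian_jet.lee (da z) (fr z)"
  by (rule ext) (simp add: theta_def hermitian_jet.lee_def[OF hermitian_jet_a] ext_d_\<omega>)

lemma linear_theta: "z \<in> V \<Longrightarrow> linear (theta z)"
  unfolding theta_eq by (rule hermitian_jet.linear_lee[OF hermitian_jet_a])

text \<open>This is d(\<omega>^m) = m d\<omega> \<and> \<omega>^(m-1). The powers of \<omega> at
  nearby points are all computed in the frame at z, so only the 2-form is differentiated; the
  alternating sum over positions in \<open>ext_d\<close> then becomes \<open>lw\<close>.\<close>

lemma ext_d_wedge_power:
  assumes z: "z \<in> V" and len: "length vs = Suc (2 * m)"
  shows "ext_d (\<lambda>w. wedge_power2 (\<omega> w) m) z vs = real m *
     hermitian_jet.wedge_tau (a z) (da z) (fr z) (coframe.Lpow (fr z) (\<lambda>c v. G z v (fr z c)) (a z) (m - 1)) vs"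
proof -
  interpret hermitian_jet "a z" "da z" rewrites "hermitian_form.g (a z) = G z"
    by (rule hermitian_jet_a[OF z]) (rule g_eq[OF z])
  interpret cf: coframe "fr z" "\<lambda>c v. G z v (fr z c)"
    by (rule coframe_frame[OF fr[OF z]])
  have der: "((\<lambda>w. a w x y) has_derivative (\<lambda>v. da z v x y)) (at z)" for x y
    unfolding a_def da_def by (rule dir_deriv_worksI[OF diff_\<omega>[OF z]])
  have der_power: "dir_deriv (\<lambda>w. wedge_power2 (\<omega> w) m us) z v = real m * cf.L2 (da z v) (cf.Lpow (a z) (m - 1)) us"
    if "length us = 2 * m" for us v
  proof -
    have "dir_deriv (\<lambda>w. wedge_power2 (\<omega> w) m us) z v = dir_deriv (\<lambda>w. cf.Lpow (a w) m us) z v"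
      by (rule dir_deriv_cong_open[OF open_V z])
        (rule wedge_power2_eq_Lpow[OF cf.coframe_axioms _ a_alt that], simp_all add: a_def)
    then show ?thesis using dir_deriv_eqI[OF cf.Lpow_has_derivative[of a "da z" z, OF der]] by simp
  qed
  have "ext_d (\<lambda>w. wedge_power2 (\<omega> w) m) z vs = (\<Sum>i<length vs. (- 1) ^ i *
      (real m * cf.L2 (da z (vs ! i)) (cf.Lpow (a z) (m - 1)) (remove_nth i vs)))"
    unfolding ext_d_def
  proof (rule sum.cong[OF refl], goal_cases)
    case (1 i)
    then have "length (remove_nth i vs) = 2 * m" using len by simp
    then show ?case by (simp only: der_power)
  qed
  also have "\<dots> = (\<Sum>i<length vs. \<Sum>c\<in>UNIV. real m * ((- 1) ^ i * G z (vs ! i) (fr z c) *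
      cf.L2 (da z (fr z c)) (cf.Lpow (a z) (m - 1)) (remove_nth i vs)))"
  proof (rule sum.cong[OF refl])
    fix i
    show "(- 1) ^ i * (real m * cf.L2 (da z (vs ! i)) (cf.Lpow (a z) (m - 1)) (remove_nth i vs))
      = (\<Sum>c\<in>UNIV. real m * ((- 1) ^ i * G z (vs ! i) (fr z c) *
      cf.L2 (da z (fr z c)) (cf.Lpow (a z) (m - 1)) (remove_nth i vs)))"
      by (subst L2_da[OF fr[OF z], symmetric]) (simp only: sum_distrib_left mult.left_commute mult.assoc)
  qed
  also have "\<dots> = real m * wedge_tau (fr z) (cf.Lpow (a z) (m - 1)) vs"
    unfolding wedge_tau_def[OF fr[OF z]] lw_eq_sum sum_distrib_left by (rule sum.swap)
  finally show ?thesis .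
qed

text \<open>Existence is \<open>lee_Lpow\<close> combined with \<open>ext_d_wedge_power\<close>;
  uniqueness is \<open>lw_Lpow_inject\<close>. Together they identify the choice in
  \<open>lee_form\<close> on V. With n = k + 2 the relevant power is k + 1 = n - 1.\<close>

lemma theta_is_lee_form:
  assumes n: "CARD('n) \<ge> 2"
  shows "is_lee_form V \<omega> (\<lambda>z vs. theta z (vs ! 0))"
    and "is_lee_form V \<omega> \<theta> \<Longrightarrow> z \<in> V \<Longrightarrow> \<theta> z [v] = theta z v"
proof -
  obtain k where k: "CARD('n) = Suc (Suc k)" using n by (metis add_2_eq_Suc le_Suc_ex)
  have lee_eq: "ext_d (\<lambda>w. wedge_power2 (\<omega> w) (Suc k)) z vs
      = lw (theta z) (coframe.Lpow (fr z) (\<lambda>c v. G z v (fr z c)) (a z) (Suc k)) vs"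
    if z: "z \<in> V" and "length vs = Suc (2 * Suc k)" for z vs
  proof -
    interpret hermitian_jet "a z" "da z" rewrites "hermitian_form.g (a z) = G z"
      by (rule hermitian_jet_a[OF z]) (rule g_eq[OF z])
    show ?thesis
      unfolding ext_d_wedge_power[OF that] theta_eq[OF z] lee_Lpow[OF fr[OF z] k] by simp
  qed
  have wedge_eq: "wedge 1 (2 * Suc k) (\<eta> z) (wedge_power2 (\<omega> z) (Suc k)) vs
      = lw (\<lambda>v. \<eta> z [v]) (coframe.Lpow (fr z) (\<lambda>c v. G z v (fr z c)) (a z) (Suc k)) vs"
    if z: "z \<in> V" and "length vs = Suc (2 * Suc k)" for z vs \<eta>
    by (rule wedge_1_power2_eq[OF inner_form.coframe_frame[OF inner_form_G[OF z] fr[OF z]] _ a_alt[OF z] that(2)])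
      (simp add: a_def)
  have smooth_theta: "smooth_on V (\<lambda>z. theta z v)" for v
  proof -
    have "smooth_on V (\<lambda>z. metric_trace (G z) (\<lambda>x y. ext_d \<omega> z [v, x, J y]) / 2)"
    proof (intro smooth_on_divide smooth_on_const open_V smooth_on_metric_trace inner_form_G)
      show "smooth_on V (\<lambda>z. G z x y)" for x y
        unfolding assoc_metric_def by (rule smooth_\<omega>)
      show "smooth_on V (\<lambda>z. ext_d \<omega> z [v, x, J y])" for x y
        by (simp add: ext_d_def numeral_3_eq_3)
          (intro smooth_on_add smooth_on_diff smooth_on_dir_deriv smooth_\<omega> open_V)
      show "bilinear (\<lambda>x y. ext_d \<omega> z [v, x, J y])" if z: "z \<in> V" for z
      proof -
        interpret hermitian_jet "a z" "da z" by (rule hermitian_jet_a[OF z])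
        show ?thesis by (auto simp: bilinear_def ext_d_\<omega>[OF z] tau_simps intro!: linearI)
      qed
    qed auto
    then show ?thesis by (simp add: theta_def metric_trace_fr)
  qed
  show "is_lee_form V \<omega> (\<lambda>z vs. theta z (vs ! 0))"
    unfolding is_lee_form_def Let_def k
  proof (intro conjI ballI allI impI)
    show "form_on V 1 (\<lambda>z vs. theta z (vs ! 0))"
      using smooth_theta linear_theta by (auto simp: form_on_def alternating_form_def)
    show "ext_d (\<lambda>w. wedge_power2 (\<omega> w) (Suc (Suc k) - 1)) z vs
       = wedge 1 (2 * (Suc (Suc k) - 1)) (\<lambda>vs. theta z (vs ! 0)) (wedge_power2 (\<omega> z) (Suc (Suc k) - 1)) vs"
      if "z \<in> V" "length vs = 2 * (Suc (Suc k) - 1) + 1" for z vs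
      using lee_eq[OF that(1), of vs] wedge_eq[OF that(1), of vs "\<lambda>z vs. theta z (vs ! 0)"] that(2)
      by (simp del: wedge_power2.simps)
  qed
  assume lee: "is_lee_form V \<omega> \<theta>" and z: "z \<in> V"
  interpret hermitian_jet "a z" "da z" rewrites "hermitian_form.g (a z) = G z"
    by (rule hermitian_jet_a[OF z]) (rule g_eq[OF z])
  interpret cf: coframe "fr z" "\<lambda>c v. G z v (fr z c)"
    by (rule coframe_frame[OF fr[OF z]])
  have lin_\<theta>: "linear (\<lambda>v. \<theta> z [v])"
  proof -
    have "alternating_form 1 (\<theta> z)" using lee z by (simp add: is_lee_form_def form_on_def)
    then have "linear (\<lambda>v. \<theta> z ([0][0 := v]))"
      by (rule alternating_form_def[THEN iffD1, THEN conjunct1, rule_format]) simp_all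
    then show ?thesis by simp
  qed
  have lin: "linear (\<lambda>v. \<theta> z [v] - theta z v)"
    by (intro linear_compose_sub lin_\<theta> linear_theta z)
  \<comment> \<open>The Lee equation speaks only about lists of length 2n - 1, whereas
    \<open>lw_Lpow_inject\<close> asks for all lists. On other lengths the product vanishes by its
    degree.\<close>
  have "lw (\<lambda>v. \<theta> z [v] - theta z v) (cf.Lpow (a z) (Suc k)) us = 0" for us
  proof (cases "length us = Suc (2 * Suc k)")
    case True
    have n1: "CARD('n) - 1 = Suc k" using k by simp
    have "length us = 2 * (CARD('n) - 1) + 1" unfolding n1 True by simp
    then have "ext_d (\<lambda>w. wedge_power2 (\<omega> w) (CARD('n) - 1)) z us
        = wedge 1 (2 * (CARD('n) - 1)) (\<theta> z) (wedge_power2 (\<omega> z) (CARD('n) - 1)) us"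
      using lee z unfolding is_lee_form_def Let_def by blast
    then have "lw (theta z) (cf.Lpow (a z) (Suc k)) us = lw (\<lambda>v. \<theta> z [v]) (cf.Lpow (a z) (Suc k)) us"
      unfolding n1 lee_eq[OF z True] wedge_eq[OF z True] .
    then show ?thesis unfolding lw_diff_left by linarith
  next
    case False
    have "cf.has_degree (Suc (2 * Suc k)) (lw (\<lambda>v. \<theta> z [v] - theta z v) (cf.Lpow (a z) (Suc k)))"
      by (rule cf.has_degree_lw[OF cf.has_degree_Lpow[OF a_alt[OF z]] lin])
    then show ?thesis using False by (rule cf.has_degree_length)
  qed
  from lw_Lpow_inject[OF fr[OF z] lin this] k
  show "\<theta> z [v] = theta z v" by simp
qed

end

section \<open>The codifferential\<close>

definition is_codiff ::
  "'n::finite tvec set \<Rightarrow> 'n metric_field \<Rightarrow> nat \<Rightarrow> 'n form_field \<Rightarrow> 'n form_field \<Rightarrow> bool" where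
  "is_codiff V g k \<beta> \<gamma> \<longleftrightarrow> form_on V k \<gamma> \<and>
     (\<forall>\<alpha>. form_on V k \<alpha> \<longrightarrow> compactly_supported_in V \<alpha> \<longrightarrow>
        L2_inner V g (Suc k) (ext_d \<alpha>) \<beta> = L2_inner V g k \<alpha> \<gamma>)"

lemma form_on_0: "form_on V 0 \<alpha> \<longleftrightarrow> smooth_on V (\<lambda>z. \<alpha> z [])"
  by (simp add: form_on_def alternating_form_def)

lemma form_on_1:
  "form_on V 1 \<alpha> \<longleftrightarrow> (\<forall>z\<in>V. linear (\<lambda>x. \<alpha> z [x])) \<and> (\<forall>x. smooth_on V (\<lambda>z. \<alpha> z [x]))"
  (is "?L \<longleftrightarrow> ?R")
proof
  assume ?L
  show ?R
  proof (intro conjI ballI allI)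
    fix z assume "z \<in> V"
    then have "alternating_form 1 (\<alpha> z)" using \<open>?L\<close> by (simp add: form_on_def)
    then have "linear (\<lambda>v. \<alpha> z ([0][0 := v]))"
      by (rule alternating_form_def[THEN iffD1, THEN conjunct1, rule_format]) simp_all
    then show "linear (\<lambda>x. \<alpha> z [x])" by simp
  next
    fix x show "smooth_on V (\<lambda>z. \<alpha> z [x])" using \<open>?L\<close> by (simp add: form_on_def)
  qed
next
  assume R: ?R
  show ?L
    unfolding form_on_def alternating_form_def
  proof (intro conjI ballI allI impI)
    fix z :: "'a tvec" and vs :: "'a tvec list" and i assume "z \<in> V" "length vs = 1" "i < (1::nat)"
    then show "linear (\<lambda>v. \<alpha> z (vs[i := v]))" using R by (auto simp: length_Suc_conv)
  next
    fix vs :: "'a tvec list" assume "length vs = 1"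
    then show "smooth_on V (\<lambda>z. \<alpha> z vs)" using R by (auto simp: length_Suc_conv)
  qed auto
qed

lemma ext_d_0: "ext_d \<alpha> z [x] = dir_deriv (\<lambda>w. \<alpha> w []) z x"
  by (simp add: ext_d_def)

lemma ext_d_1: "ext_d \<alpha> z [x, y] = dir_deriv (\<lambda>w. \<alpha> w [y]) z x - dir_deriv (\<lambda>w. \<alpha> w [x]) z y"
  by (simp add: ext_d_def numeral_2_eq_2)

context hermitian_patch
begin

abbreviation vol :: "'n tvec \<Rightarrow> real" where "vol z \<equiv> volume_density (G z)"

text \<open>This is \<open>tr\<^sub>\<omega> d\<alpha>\<close>, see \<open>trace_ext_d\<close>.\<close>

definition trace_d :: "'n tvec \<Rightarrow> 'n form_field \<Rightarrow> real" where
  "trace_d z \<alpha> = (\<Sum>c\<in>UNIV. dir_deriv (\<lambda>w. \<alpha> w [J (fr z c)]) z (fr z c))"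

lemma smooth_G: "smooth_on V (\<lambda>z. G z x y)"
  unfolding assoc_metric_def by (rule smooth_\<omega>)

lemmas smooth_trace = smooth_on_metric_trace[OF open_V smooth_G inner_form_G]

lemma frame_real_G:
  fixes l :: "'n tvec \<Rightarrow> real"
  assumes "z \<in> V" "linear l" shows "(\<Sum>c\<in>UNIV. G z v (fr z c) * l (fr z c)) = l v"
  by (rule inner_form.frame_real[OF inner_form_G[OF assms(1)] fr[OF assms(1)] assms(2)])

lemma trace_J_G:
  fixes B :: "'n tvec \<Rightarrow> 'n tvec \<Rightarrow> real"
  assumes z: "z \<in> V" and "bilinear B"
  shows "(\<Sum>c\<in>UNIV. B (J (fr z c)) (J (fr z c))) = (\<Sum>c\<in>UNIV. B (fr z c) (fr z c))"
proof -
  interpret hermitian_form "a z" rewrites "hermitian_form.g (a z) = G z"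
    by (rule hermitian_form_a[OF z]) (rule g_eq[OF z])
  show ?thesis by (rule trace_J[OF fr[OF z] assms(2)])
qed

lemma bilinear_deriv_form:
  assumes \<alpha>: "form_on V 1 \<alpha>" and z: "z \<in> V"
  shows "bilinear (\<lambda>x y. dir_deriv (\<lambda>w. \<alpha> w [y]) z x)"
proof -
  have diff: "(\<lambda>w. \<alpha> w [y]) differentiable (at z)" for y
    using \<alpha> z smooth_on_differentiable form_on_1 by blast
  have lin: "linear (\<lambda>x. \<alpha> w [x])" if "w \<in> V" for w using \<alpha> that form_on_1 by blast
  have "dir_deriv (\<lambda>w. \<alpha> w [y + y']) z x = dir_deriv (\<lambda>w. \<alpha> w [y]) z x + dir_deriv (\<lambda>w. \<alpha> w [y']) z x" for x y y'
  proof -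
    have "dir_deriv (\<lambda>w. \<alpha> w [y + y']) z x = dir_deriv (\<lambda>w. \<alpha> w [y] + \<alpha> w [y']) z x"
      by (rule dir_deriv_cong_open[OF open_V z]) (rule linear_add[OF lin])
    also have "\<dots> = dir_deriv (\<lambda>w. \<alpha> w [y]) z x + dir_deriv (\<lambda>w. \<alpha> w [y']) z x"
      by (intro dir_deriv_eqI has_derivative_add dir_deriv_worksI diff)
    finally show ?thesis .
  qed
  moreover have "dir_deriv (\<lambda>w. \<alpha> w [r *\<^sub>R y]) z x = r * dir_deriv (\<lambda>w. \<alpha> w [y]) z x" for x y r
  proof -
    have "dir_deriv (\<lambda>w. \<alpha> w [r *\<^sub>R y]) z x = dir_deriv (\<lambda>w. r * \<alpha> w [y]) z x"
      by (rule dir_deriv_cong_open[OF open_V z]) (use linear_scale[OF lin] in simp)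
    also have "\<dots> = r * dir_deriv (\<lambda>w. \<alpha> w [y]) z x"
      by (intro dir_deriv_eqI has_derivative_mult_right dir_deriv_worksI diff)
    finally show ?thesis .
  qed
  ultimately show ?thesis
    unfolding bilinear_def using linear_dir_deriv[OF diff] by (auto intro!: linearI)
qed

lemma bilinear_compose_J: "bilinear B \<Longrightarrow> bilinear (\<lambda>x y. B x (J y))" for B :: "'n tvec \<Rightarrow> 'n tvec \<Rightarrow> real"
  unfolding bilinear_def using linear_compose[OF linear_J] by (auto simp: comp_def)

lemma smooth_trace_d:
  assumes \<alpha>: "form_on V 1 \<alpha>" shows "smooth_on V (\<lambda>z. trace_d z \<alpha>)"
proof -
  have "smooth_on V (\<lambda>z. metric_trace (G z) (\<lambda>x y. dir_deriv (\<lambda>w. \<alpha> w [J y]) z x))"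
  proof (intro smooth_trace smooth_on_dir_deriv)
    show "smooth_on V (\<lambda>z. \<alpha> z [J y])" for y using \<alpha> form_on_1 by blast
  qed (assumption | rule bilinear_compose_J[OF bilinear_deriv_form[OF \<alpha>]])+
  then show ?thesis by (simp add: metric_trace_fr trace_d_def)
qed

text \<open>The two derivatives in d\<alpha>(e, J e) have the same sum over the frame, because the
  trace is invariant under J and J^2 = -1; this accounts for the 1/2.\<close>

lemma trace_ext_d:
  assumes \<alpha>: "form_on V 1 \<alpha>" and z: "z \<in> V"
  shows "(\<Sum>c\<in>UNIV. ext_d \<alpha> z [fr z c, J (fr z c)]) / 2 = trace_d z \<alpha>"
proof -
  note B = bilinear_deriv_form[OF \<alpha> z]
  have "(\<Sum>c\<in>UNIV. - dir_deriv (\<lambda>w. \<alpha> w [fr z c]) z (J (fr z c))) = trace_d z \<alpha>"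
    unfolding trace_d_def trace_J_G[OF z bilinear_compose_J[OF B], symmetric]
    using bilinear_rneg[OF B] by simp
  then show ?thesis by (simp add: ext_d_1 sum_subtractf sum_negf) (simp add: trace_d_def)
qed

lemma form_inner_1: "form_inner (G z) (Suc 0) \<alpha> \<beta> = (\<Sum>c\<in>UNIV. \<alpha> [fr z c] * \<beta> [fr z c])"
  by (simp add: metric_trace_fr)

text \<open>The coefficients \<omega>(e_c, e_d) = g(J e_c, e_d) are the components of J e_c, so the
  inner sum replaces e_d by J e_c. The 1/2! in \<open>form_inner\<close> is the 1/2 of
  \<open>trace_ext_d\<close>.\<close>

lemma form_inner_2:
  assumes \<alpha>: "form_on V 1 \<alpha>" and z: "z \<in> V"
  shows "form_inner (G z) (Suc (Suc 0)) (ext_d \<alpha> z) (\<omega> z) = trace_d z \<alpha>"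
proof -
  interpret hermitian_form "a z" rewrites "hermitian_form.g (a z) = G z"
    by (rule hermitian_form_a[OF z]) (rule g_eq[OF z])
  have lin: "linear (\<lambda>y. ext_d \<alpha> z [x, y])" for x
    using bilinear_deriv_form[OF \<alpha> z] unfolding ext_d_1 bilinear_def by (intro linear_compose_sub) auto
  have "form_inner (G z) (Suc (Suc 0)) (ext_d \<alpha> z) (\<omega> z)
     = (\<Sum>c\<in>UNIV. \<Sum>d\<in>UNIV. G z (J (fr z c)) (fr z d) * ext_d \<alpha> z [fr z c, fr z d]) / 2"
    unfolding form_inner.simps(2)[of _ "Suc 0"] metric_trace_fr form_inner_1
    using a_eq_g by (simp add: a_def mult.commute)
  also have "\<dots> = trace_d z \<alpha>"
    unfolding frame_real_G[OF z lin] by (rule trace_ext_d[OF \<alpha> z])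
  finally show ?thesis .
qed

lemma vol_has_derivative:
  assumes z: "z \<in> V"
  shows "(vol has_derivative (\<lambda>v. vol z * (\<Sum>c\<in>UNIV. da z v (fr z c) (J (fr z c))) / 2)) (at z)"
proof -
  have "da z v (fr z c) (J (fr z c)) = dir_deriv (\<lambda>w. G w (fr z c) (fr z c)) z v" for v c
    by (simp add: da_def assoc_metric_def)
  then show ?thesis
    using volume_density_has_derivative[OF open_V z inner_form_G smooth_on_differentiable[OF smooth_G z] fr[OF z]]
    by (simp only:)
qed

lemma continuous_vol: "continuous_on V vol"
  using vol_has_derivative has_derivative_continuous continuous_at_imp_continuous_on by blast

text \<open>
  The divergence theorem for the vector field \<open>\<xi>\<close> dual to \<open>\<alpha>\<close> with respect to \<open>\<omega>\<close>.
\<close>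

lemma stokes:
  assumes \<alpha>: "form_on V 1 \<alpha>" and supp: "compactly_supported_in V \<alpha>"
  shows "(LINT z:V|lborel. (trace_d z \<alpha> - (\<Sum>c\<in>UNIV. \<alpha> z [fr z c] * theta z (J (fr z c)))) * vol z) = 0"
proof -
  obtain K where K: "compact K" "K \<subseteq> V" "\<And>z vs. z \<in> V - K \<Longrightarrow> \<alpha> z vs = 0"
    using supp unfolding compactly_supported_in_def by blast
  have lin_\<alpha>: "linear (\<lambda>x. \<alpha> z [x])" if "z \<in> V" for z using \<alpha> that form_on_1 by blast
  define xi where "xi z = - (\<Sum>c\<in>UNIV. \<alpha> z [fr z c] *\<^sub>R J (fr z c))" for z
  have smooth_xi: "smooth_on V (\<lambda>z. xi z \<bullet> u)" for u
  proof -
    have "smooth_on V (\<lambda>z. metric_trace (G z) (\<lambda>x y. \<alpha> z [x] * (- (J y \<bullet> u))))"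
    proof (intro smooth_trace smooth_on_mult smooth_on_const open_V)
      show "smooth_on V (\<lambda>z. \<alpha> z [x])" for x using \<alpha> form_on_1 by blast
      show "bilinear (\<lambda>x y. \<alpha> z [x] * (- (J y \<bullet> u)))" if "z \<in> V" for z
        using lin_\<alpha>[OF that] by (auto simp: bilinear_def linear_iff inner_left_distrib algebra_simps)
    qed
    then show ?thesis by (simp add: metric_trace_fr xi_def inner_sum_left sum_negf)
  qed
  have xi_a: "a z (xi z) y = \<alpha> z [y]" if z: "z \<in> V" for z y
  proof -
    interpret hermitian_form "a z" rewrites "hermitian_form.g (a z) = G z"
      by (rule hermitian_form_a[OF z]) (rule g_eq[OF z])
    have "a z (xi z) y = (\<Sum>c\<in>UNIV. \<alpha> z [fr z c] * G z (fr z c) y)"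
      unfolding a_eq_g xi_def
      by (simp add: linear_neg[OF linear_J] linear_sum[OF linear_J] linear_scale[OF linear_J] sum_negf[symmetric] g_sum g_simps)
    also have "\<dots> = (\<Sum>c\<in>UNIV. G z y (fr z c) * \<alpha> z [fr z c])"
      by (intro sum.cong refl) (simp add: sym[of y] mult.commute)
    finally show ?thesis unfolding frame_real_G[OF z lin_\<alpha>[OF z]] .
  qed
  have diff_xi: "(\<lambda>w. xi w \<bullet> u) differentiable (at z)" if "z \<in> V" for z u
    by (rule smooth_on_differentiable[OF smooth_xi that])
  let ?Dvol = "\<lambda>z v. vol z * (\<Sum>c\<in>UNIV. da z v (fr z c) (J (fr z c))) / 2"
  \<comment> \<open>The Euclidean components of the vector density of \<xi>. Each has compact
    support in V, so each partial derivative integrates to zero, and only their sum has to be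
    recognized.\<close>
  let ?f = "\<lambda>u z. vol z * (xi z \<bullet> u)"
  have der: "(?f u has_derivative (\<lambda>v. vol z * dir_deriv (\<lambda>w. xi w \<bullet> u) z v + ?Dvol z v * (xi z \<bullet> u))) (at z)"
    if "z \<in> V" for z u
    by (intro has_derivative_mult vol_has_derivative dir_deriv_worksI diff_xi that)
  note der_eq = dir_deriv_eqI[OF der]
  have f0: "?f u z = 0" if "z \<in> V - K" for u z
    using K(3)[OF that] by (simp add: xi_def)
  have D0: "dir_deriv (?f u) z u = 0" if "z \<in> V - K" for u z
  proof -
    have "open (V - K)" using open_V compact_imp_closed[OF K(1)] by (rule open_Diff)
    then have "dir_deriv (?f u) z u = dir_deriv (\<lambda>_. 0) z u"
      using that f0 by (rule dir_deriv_cong_open)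
    also have "\<dots> = 0" by (rule dir_deriv_eqI) (auto intro: derivative_eq_intros)
    finally show ?thesis .
  qed
  have cont: "continuous_on V (\<lambda>z. dir_deriv (?f u) z u)" for u
  proof -
    have "smooth_on V (\<lambda>z. metric_trace (G z) (\<lambda>x y. da z u x (J y)))"
    proof (intro smooth_trace)
      show "smooth_on V (\<lambda>z. da z u x (J y))" for x y
        unfolding da_def by (intro smooth_on_dir_deriv smooth_\<omega>)
      show "bilinear (\<lambda>x y. da z u x (J y))" if z: "z \<in> V" for z
        by (rule bilinear_compose_J[of "da z u"]) (use hermitian_jet.da_alt[OF hermitian_jet_a[OF z]] in \<open>unfold bilin_alt_def, blast\<close>)
    qed
    then have 1: "continuous_on V (\<lambda>z. \<Sum>c\<in>UNIV. da z u (fr z c) (J (fr z c)))"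
      by (simp add: metric_trace_fr smooth_on_continuous)
    have "continuous_on V (\<lambda>z. vol z * dir_deriv (\<lambda>w. xi w \<bullet> u) z u + ?Dvol z u * (xi z \<bullet> u))"
      by (intro continuous_intros continuous_vol 1 smooth_on_continuous[OF smooth_xi]
          smooth_on_continuous[OF smooth_on_dir_deriv[OF smooth_xi]]) auto
    then show ?thesis by (subst continuous_on_cong[OF refl der_eq]) auto
  qed
  have int0: "(LINT z:V|lborel. dir_deriv (?f u) z u) = 0" for u
    by (rule set_integral_dir_deriv_eq_0[OF open_V K(1,2) _ cont f0])
      (use der in \<open>auto simp: differentiable_def\<close>)
  have integrable: "set_integrable lborel V (\<lambda>z. dir_deriv (?f u) z u)" for u
    by (rule set_integrable_compact_support[OF K(1,2) cont D0])
  \<comment> \<open>Differentiating \<alpha>(y) = a(\<xi>, y) expresses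
    \<open>trace_d z \<alpha>\<close> as the trace of the derivative of \<xi> plus the sum of
    da(e)(\<xi>, J e). The derivative of the volume adds half the sum of da(\<xi>)(e, J e). The
    derivative terms of a combine to exactly \<theta>(\<xi>), because the other two cyclic terms of
    \<open>tau\<close> have equal sums over the frame.\<close>
  have pointwise: "(\<Sum>u\<in>Basis. dir_deriv (?f u) z u)
      = (trace_d z \<alpha> - (\<Sum>c\<in>UNIV. \<alpha> z [fr z c] * theta z (J (fr z c)))) * vol z" if z: "z \<in> V" for z
  proof -
    interpret hermitian_jet "a z" "da z" rewrites "hermitian_form.g (a z) = G z"
      by (rule hermitian_jet_a[OF z]) (rule g_eq[OF z])
    define L where "L x = (\<Sum>u\<in>Basis. dir_deriv (\<lambda>w. xi w \<bullet> u) z x *\<^sub>R u)" for x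
    have linear_L: "linear L"
      unfolding L_def using linear_dir_deriv[OF diff_xi[OF z]]
      by (auto simp: linear_iff sum.distrib scaleR_left_distrib scaleR_sum_right)
    have L: "dir_deriv (\<lambda>w. \<alpha> w [y]) z x = a z (L x) y + da z x (xi z) y" for x y
    proof -
      have "dir_deriv (\<lambda>w. \<alpha> w [y]) z x = dir_deriv (\<lambda>w. \<Sum>u\<in>Basis. (xi w \<bullet> u) * \<omega> w [u, y]) z x"
      proof (rule dir_deriv_cong_open[OF open_V z])
        fix w assume w: "w \<in> V"
        have "\<alpha> w [y] = a w (\<Sum>u\<in>Basis. (xi w \<bullet> u) *\<^sub>R u) y"
          by (simp add: euclidean_representation xi_a[OF w])
        also have "\<dots> = (\<Sum>u\<in>Basis. (xi w \<bullet> u) * a w u y)"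
          using bilin_altD(1)[OF a_alt[OF w], of y] by (simp add: linear_sum[of "\<lambda>x. a w x y"] linear_scale[of "\<lambda>x. a w x y"])
        finally show "\<alpha> w [y] = (\<Sum>u\<in>Basis. (xi w \<bullet> u) * \<omega> w [u, y])" by (simp add: a_def)
      qed
      also have "\<dots> = (\<Sum>u\<in>Basis. (xi z \<bullet> u) * da z x u y + dir_deriv (\<lambda>w. xi w \<bullet> u) z x * \<omega> z [u, y])"
        unfolding da_def
        by (intro dir_deriv_eqI has_derivative_sum has_derivative_mult dir_deriv_worksI diff_xi diff_\<omega> z)
      also have "(\<Sum>u\<in>Basis. (xi z \<bullet> u) * da z x u y + dir_deriv (\<lambda>w. xi w \<bullet> u) z x * \<omega> z [u, y])
          = da z x (\<Sum>u\<in>Basis. (xi z \<bullet> u) *\<^sub>R u) y + a z (L x) y"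
      proof -
        have "a z (L x) y = (\<Sum>u\<in>Basis. dir_deriv (\<lambda>w. xi w \<bullet> u) z x * a z u y)"
          unfolding L_def by (simp add: linear_sum[OF linear_a(2)] linear_scale[OF linear_a(2)])
        moreover have "da z x (\<Sum>u\<in>Basis. (xi z \<bullet> u) *\<^sub>R u) y = (\<Sum>u\<in>Basis. (xi z \<bullet> u) * da z x u y)"
          by (simp add: linear_sum[OF bilin_altD(1)[OF da_alt]] linear_scale[OF bilin_altD(1)[OF da_alt]])
        ultimately show ?thesis by (simp add: sum.distrib a_def)
      qed
      finally show ?thesis by (simp add: euclidean_representation)
    qed
    have trace_L: "(\<Sum>u\<in>Basis. dir_deriv (\<lambda>w. xi w \<bullet> u) z u) = (\<Sum>c\<in>UNIV. a z (L (fr z c)) (J (fr z c)))"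
    proof -
      have "(\<Sum>u\<in>Basis. dir_deriv (\<lambda>w. xi w \<bullet> u) z u) = (\<Sum>u\<in>Basis. L u \<bullet> u)"
        unfolding L_def by (intro sum.cong refl) (simp add: inner_sum_left inner_Basis if_distrib cong: if_cong)
      also have "\<dots> = (\<Sum>u\<in>Basis. \<Sum>c\<in>UNIV. G z u (fr z c) * (L (fr z c) \<bullet> u))"
      proof (rule sum.cong[OF refl])
        fix u :: "'n tvec"
        have "linear (\<lambda>x. L x \<bullet> u)" using linear_L by (auto simp: linear_iff inner_left_distrib)
        then show "L u \<bullet> u = (\<Sum>c\<in>UNIV. G z u (fr z c) * (L (fr z c) \<bullet> u))"
          by (rule frame_real_G[OF z, symmetric])
      qed
      also have "\<dots> = (\<Sum>c\<in>UNIV. G z (\<Sum>u\<in>Basis. (L (fr z c) \<bullet> u) *\<^sub>R u) (fr z c))"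
        by (subst sum.swap) (simp add: g_sum g_simps mult.commute)
      finally show ?thesis by (simp add: euclidean_representation a_eq_g g_J)
    qed
    have theta_xi: "theta z (xi z) = (\<Sum>c\<in>UNIV. da z (xi z) (fr z c) (J (fr z c))) / 2 - (\<Sum>c\<in>UNIV. da z (fr z c) (xi z) (J (fr z c)))"
    proof -
      have B: "bilinear (\<lambda>x y. da z x (xi z) y)"
        unfolding bilinear_def using linear_da bilin_altD(2)[OF da_alt] by blast
      have "(\<Sum>c\<in>UNIV. da z (J (fr z c)) (xi z) (fr z c)) = - (\<Sum>c\<in>UNIV. da z (fr z c) (xi z) (J (fr z c)))"
        using trace_J_G[OF z bilinear_compose_J[OF B]] by (simp add: da_simps sum_negf)
      moreover have "(\<Sum>c\<in>UNIV. da z (fr z c) (J (fr z c)) (xi z)) = - (\<Sum>c\<in>UNIV. da z (fr z c) (xi z) (J (fr z c)))"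
        unfolding sum_negf[symmetric] by (intro sum.cong refl da_skew)
      ultimately show ?thesis
        by (simp add: theta_eq[OF z] lee_def tau_def sum.distrib)
    qed
    have theta_xi': "theta z (xi z) = - (\<Sum>c\<in>UNIV. \<alpha> z [fr z c] * theta z (J (fr z c)))"
      using linear_theta[OF z] by (simp add: xi_def linear_neg linear_sum linear_scale)
    have Dvol_xi: "(\<Sum>u\<in>Basis. ?Dvol z u * (xi z \<bullet> u)) = ?Dvol z (xi z)"
    proof -
      have lin: "linear (\<lambda>v. ?Dvol z v)"
        by (rule has_derivative_linear[OF vol_has_derivative[OF z]])
      have "?Dvol z (xi z) = ?Dvol z (\<Sum>u\<in>Basis. (xi z \<bullet> u) *\<^sub>R u)" by (simp add: euclidean_representation)
      also have "\<dots> = (\<Sum>u\<in>Basis. (xi z \<bullet> u) *\<^sub>R ?Dvol z u)"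
        unfolding linear_sum[OF lin] linear_scale[OF lin] ..
      finally show ?thesis by (simp add: mult.commute)
    qed
    have "(\<Sum>u\<in>Basis. dir_deriv (?f u) z u)
        = vol z * (\<Sum>u\<in>Basis. dir_deriv (\<lambda>w. xi w \<bullet> u) z u) + (\<Sum>u\<in>Basis. ?Dvol z u * (xi z \<bullet> u))"
      unfolding der_eq[OF z] sum.distrib sum_distrib_left ..
    also have "(\<Sum>u\<in>Basis. dir_deriv (\<lambda>w. xi w \<bullet> u) z u) = trace_d z \<alpha> - (\<Sum>c\<in>UNIV. da z (fr z c) (xi z) (J (fr z c)))"
      unfolding trace_L trace_d_def L sum.distrib by simp
    also have "(\<Sum>c\<in>UNIV. da z (fr z c) (xi z) (J (fr z c)))
        = (\<Sum>c\<in>UNIV. da z (xi z) (fr z c) (J (fr z c))) / 2 + (\<Sum>c\<in>UNIV. \<alpha> z [fr z c] * theta z (J (fr z c)))"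
      using theta_xi theta_xi' by linarith
    finally show ?thesis
      unfolding Dvol_xi by (simp add: algebra_simps)
  qed
  have "(LINT z:V|lborel. (trace_d z \<alpha> - (\<Sum>c\<in>UNIV. \<alpha> z [fr z c] * theta z (J (fr z c)))) * vol z)
      = (LINT z:V|lborel. (\<Sum>u\<in>Basis. dir_deriv (?f u) z u))"
    by (rule set_lebesgue_integral_cong) (use open_V pointwise in auto)
  also have "\<dots> = (\<Sum>u\<in>Basis. LINT z:V|lborel. dir_deriv (?f u) z u)"
    using integrable unfolding set_lebesgue_integral_def set_integrable_def scaleR_sum_right
    by (intro Bochner_Integration.integral_sum)
  finally show ?thesis by (simp add: int0)
qed

end

section \<open>Uniqueness of the codifferential and its values on \<omega> and on the Lee
  form\<close>

context hermitian_patch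
begin

lemma form_inner_smooth:
  assumes k: "k = 0 \<or> k = 1" and \<alpha>: "form_on V k \<alpha>" and \<beta>: "form_on V k \<beta>"
  shows "smooth_on V (\<lambda>z. form_inner (G z) k (\<alpha> z) (\<beta> z))"
  using k
proof
  assume "k = 0"
  then show ?thesis using \<alpha> \<beta> by (auto simp: form_on_0 intro: smooth_on_mult open_V)
next
  assume k: "k = 1"
  note \<alpha>1 = \<alpha>[unfolded k form_on_1] and \<beta>1 = \<beta>[unfolded k form_on_1]
  have "smooth_on V (\<lambda>z. metric_trace (G z) (\<lambda>x y. \<alpha> z [x] * \<beta> z [y]))"
  proof (intro smooth_trace smooth_on_mult open_V)
    show "bilinear (\<lambda>x y. \<alpha> z [x] * \<beta> z [y])" if "z \<in> V" for z
      using \<alpha>1 \<beta>1 that by (auto simp: bilinear_def linear_iff algebra_simps)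
  qed (use \<alpha>1 \<beta>1 in auto)
  then show ?thesis using k by (simp add: metric_trace_fr)
qed

lemma set_integrable_vol:
  assumes "compact K" "K \<subseteq> V" "continuous_on V h" "\<And>z. z \<in> V - K \<Longrightarrow> h z = 0"
  shows "set_integrable lborel V (\<lambda>z. h z * vol z)"
  using assms by (intro set_integrable_compact_support[of K]) (auto intro: continuous_on_mult continuous_vol)

lemma form_inner_integrable:
  assumes k: "k = 0 \<or> k = 1" and \<alpha>: "form_on V k \<alpha>" and \<beta>: "form_on V k \<beta>"
    and supp: "compactly_supported_in V \<alpha>"
  shows "set_integrable lborel V (\<lambda>z. form_inner (G z) k (\<alpha> z) (\<beta> z) * vol z)"
proof -
  obtain K where K: "compact K" "K \<subseteq> V" "\<And>z vs. z \<in> V - K \<Longrightarrow> \<alpha> z vs = 0"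
    using supp unfolding compactly_supported_in_def by blast
  have "form_inner (G z) k (\<alpha> z) (\<beta> z) = 0" if "z \<in> V - K" for z
    using k K(3)[OF that] by (auto simp: metric_trace_fr)
  then show ?thesis
    by (intro set_integrable_vol[OF K(1,2)] smooth_on_continuous[OF form_inner_smooth[OF k \<alpha> \<beta>]])
qed

lemma vol_pos: "z \<in> V \<Longrightarrow> vol z > 0"
  using inner_form.det_gram_pos[OF inner_form_G] by (simp add: volume_density_def gram_def)

text \<open>Test against the difference \<delta> of the two candidates times a bump function b: the
  integral of b |\<delta>|^2 is zero, its integrand is continuous and nonnegative, so \<delta>
  vanishes where b > 0.\<close>

lemma is_codiff_unique:
  assumes k: "k = 0 \<or> k = 1" and c1: "is_codiff V G k \<beta> \<gamma>1" and c2: "is_codiff V G k \<beta> \<gamma>2"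
    and z: "z \<in> V" and vs: "length vs = k"
  shows "\<gamma>1 z vs = \<gamma>2 z vs"
proof (rule ex_bump[OF open_V z])
  have f1: "form_on V k \<gamma>1" and f2: "form_on V k \<gamma>2" using c1 c2 by (auto simp: is_codiff_def)
  fix b :: "'n tvec \<Rightarrow> real" and K assume b: "smooth_on V b" "\<And>z. b z \<ge> 0" "b z > 0"
    "compact K" "K \<subseteq> V" "\<And>z. z \<notin> K \<Longrightarrow> b z = 0"
  define \<delta> where "\<delta> = (\<lambda>z vs. \<gamma>1 z vs - \<gamma>2 z vs)"
  define \<alpha> where "\<alpha> = (\<lambda>z vs. b z * \<delta> z vs)"
  have form_mult: "form_on V k (\<lambda>z vs. h z * \<eta> z vs)" if "smooth_on V h" "form_on V k \<eta>" for h \<eta>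
    using k that
    by (auto simp: form_on_0 form_on_1[unfolded One_nat_def] linear_iff algebra_simps intro!: smooth_on_mult open_V)
  have form_diff: "form_on V k \<delta>"
    using k f1 f2 unfolding \<delta>_def
    by (auto simp: form_on_0 form_on_1[unfolded One_nat_def] linear_iff algebra_simps intro!: smooth_on_diff open_V)
  have form_\<alpha>: "form_on V k \<alpha>" unfolding \<alpha>_def by (rule form_mult[OF b(1) form_diff])
  have supp: "compactly_supported_in V \<alpha>"
    unfolding compactly_supported_in_def \<alpha>_def using b by (intro exI[of _ K]) auto
  let ?h = "\<lambda>z. form_inner (G z) k (\<alpha> z) (\<delta> z) * vol z"
  have h_eq: "?h z = form_inner (G z) k (\<alpha> z) (\<gamma>1 z) * vol z - form_inner (G z) k (\<alpha> z) (\<gamma>2 z) * vol z" for z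
    using k by (auto simp: \<delta>_def metric_trace_fr sum_subtractf algebra_simps)
  have h_sq: "?h z = b z * form_inner (G z) k (\<delta> z) (\<delta> z) * vol z" for z
    using k by (auto simp: \<alpha>_def metric_trace_fr sum_distrib_left algebra_simps)
  have sq_nonneg: "form_inner (G z) k (\<delta> z) (\<delta> z) \<ge> 0" for z
    using k by (auto simp: metric_trace_fr intro!: sum_nonneg)
  have "(LINT z:V|lborel. ?h z) = L2_inner V G k \<alpha> \<gamma>1 - L2_inner V G k \<alpha> \<gamma>2"
    unfolding h_eq L2_inner_def
    by (intro set_integral_diff form_inner_integrable k form_\<alpha> f1 f2 supp)
  also have "\<dots> = 0"
    using c1 c2 form_\<alpha> supp by (simp add: is_codiff_def)
  finally have zero: "(LINT z:V|lborel. ?h z) = 0" .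
  have "?h z = 0"
  proof (rule set_integral_nonneg_eq_0_imp[OF open_V _ _ _ zero z])
    show "continuous_on V ?h"
      by (intro continuous_on_mult continuous_vol smooth_on_continuous form_inner_smooth k form_\<alpha> form_diff)
    show "set_integrable lborel V ?h"
      by (intro form_inner_integrable k form_\<alpha> form_diff supp)
    show "?h z \<ge> 0" if "z \<in> V" for z
      unfolding h_sq using b(2) sq_nonneg vol_pos[OF that] by simp
  qed
  then have zero: "form_inner (G z) k (\<delta> z) (\<delta> z) = 0"
    unfolding h_sq using b(3) vol_pos[OF z] by simp
  have "\<delta> z vs = 0"
    using k
  proof
    assume "k = 0"
    then show ?thesis using zero vs by simp
  next
    assume k: "k = 1"
    then obtain v where v: "vs = [v]" using vs length_1_cases by metis
    have "(\<Sum>c\<in>UNIV. \<delta> z [fr z c] * \<delta> z [fr z c]) = 0" using zero k by (simp add: metric_trace_fr)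
    then have 0: "\<delta> z [fr z c] = 0" for c
      by (subst (asm) sum_nonneg_eq_0_iff) auto
    have "linear (\<lambda>v. \<delta> z [v])" using form_diff z unfolding k form_on_1 by blast
    from frame_real_G[OF z this, of v] show ?thesis by (simp add: v 0)
  qed
  then show "\<gamma>1 z vs = \<gamma>2 z vs" by (simp add: \<delta>_def)
qed

lemma codiff_eq:
  assumes "k = 0 \<or> k = 1" "is_codiff V G k \<beta> \<gamma>" "z \<in> V" "length vs = k"
  shows "codiff V G k \<beta> z vs = \<gamma> z vs"
proof -
  have "codiff V G k \<beta> = (SOME \<gamma>. is_codiff V G k \<beta> \<gamma>)"
    by (simp add: codiff_def is_codiff_def)
  moreover have "is_codiff V G k \<beta> (SOME \<gamma>. is_codiff V G k \<beta> \<gamma>)"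
    by (rule someI[of _ \<gamma>]) (rule assms(2))
  ultimately show ?thesis using is_codiff_unique[OF assms(1) _ assms(2-4)] by simp
qed

context
  assumes smooth_theta: "\<And>v. smooth_on V (\<lambda>z. theta z v)"
begin

definition J_theta :: "'n form_field" where "J_theta z vs = theta z (J (vs ! 0))"

lemma form_J_theta: "form_on V 1 J_theta"
  unfolding form_on_1 J_theta_def using smooth_theta linear_compose[OF linear_J linear_theta] by (simp add: comp_def)

lemma stokes':
  assumes \<alpha>: "form_on V 1 \<alpha>" and supp: "compactly_supported_in V \<alpha>"
  shows "(LINT z:V|lborel. trace_d z \<alpha> * vol z) = (LINT z:V|lborel. form_inner (G z) 1 (\<alpha> z) (J_theta z) * vol z)"
proof -
  obtain K where K: "compact K" "K \<subseteq> V" "\<And>z vs. z \<in> V - K \<Longrightarrow> \<alpha> z vs = 0"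
    using supp unfolding compactly_supported_in_def by blast
  have trd0: "trace_d z \<alpha> = 0" if "z \<in> V - K" for z
  proof -
    have "open (V - K)" using open_V compact_imp_closed[OF K(1)] by (rule open_Diff)
    then have "dir_deriv (\<lambda>w. \<alpha> w vs) z u = dir_deriv (\<lambda>_. 0) z u" for u vs
      using that K(3) by (rule dir_deriv_cong_open)
    moreover have "dir_deriv (\<lambda>_. 0 :: real) z u = 0" for u :: "'n tvec"
      by (rule dir_deriv_eqI) (auto intro: derivative_eq_intros)
    ultimately show ?thesis by (simp add: trace_d_def)
  qed
  have "0 = (LINT z:V|lborel. trace_d z \<alpha> * vol z - form_inner (G z) 1 (\<alpha> z) (J_theta z) * vol z)"
    using stokes[OF assms] by (simp add: metric_trace_fr J_theta_def left_diff_distrib)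
  also have "\<dots> = (LINT z:V|lborel. trace_d z \<alpha> * vol z) - (LINT z:V|lborel. form_inner (G z) 1 (\<alpha> z) (J_theta z) * vol z)"
    by (intro set_integral_diff form_inner_integrable \<alpha> form_J_theta supp
        set_integrable_vol[OF K(1,2) smooth_on_continuous[OF smooth_trace_d[OF \<alpha>]] trd0]) auto
  finally show ?thesis by simp
qed

lemma is_codiff_\<omega>: "is_codiff V G 1 \<omega> J_theta"
  unfolding is_codiff_def
proof (intro conjI allI impI form_J_theta)
  fix \<alpha> assume \<alpha>: "form_on V 1 \<alpha>" "compactly_supported_in V \<alpha>"
  have "L2_inner V G (Suc 1) (ext_d \<alpha>) \<omega> = (LINT z:V|lborel. trace_d z \<alpha> * vol z)"
    unfolding L2_inner_def One_nat_def
    by (rule set_lebesgue_integral_cong) (use open_V form_inner_2[OF \<alpha>(1)] in \<open>auto simp del: form_inner.simps\<close>)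
  then show "L2_inner V G (Suc 1) (ext_d \<alpha>) \<omega> = L2_inner V G 1 \<alpha> J_theta"
    unfolding stokes'[OF \<alpha>] by (simp only: L2_inner_def)
qed

text \<open>Stokes' theorem is applied to \<open>f \<cdot> (\<theta> \<circ> J)\<close> for a test function \<open>f\<close>.\<close>

lemma is_codiff_lee:
  assumes \<theta>: "\<And>z v. z \<in> V \<Longrightarrow> \<theta> z [v] = theta z v"
  shows "is_codiff V G 0 \<theta> (\<lambda>z vs. trace_d z J_theta - (\<Sum>c\<in>UNIV. (theta z (fr z c))\<^sup>2))"
  unfolding is_codiff_def
proof (intro conjI allI impI)
  have "smooth_on V (\<lambda>z. metric_trace (G z) (\<lambda>x y. theta z x * theta z y))"
  proof (intro smooth_trace smooth_on_mult open_V smooth_theta)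
    show "bilinear (\<lambda>x y. theta z x * theta z y)" if "z \<in> V" for z
      using linear_theta[OF that] by (auto simp: bilinear_def linear_iff algebra_simps)
  qed
  then have smooth_sq: "smooth_on V (\<lambda>z. \<Sum>c\<in>UNIV. (theta z (fr z c))\<^sup>2)"
    by (simp add: metric_trace_fr power2_eq_square)
  then show "form_on V 0 (\<lambda>z vs. trace_d z J_theta - (\<Sum>c\<in>UNIV. (theta z (fr z c))\<^sup>2))"
    unfolding form_on_0 by (intro smooth_on_diff open_V smooth_trace_d form_J_theta)
  then have form_\<gamma>: "form_on V 0 (\<lambda>z vs. trace_d z J_theta - (\<Sum>c\<in>UNIV. (theta z (fr z c))\<^sup>2))" .
  fix f assume f: "form_on V 0 f" and supp: "compactly_supported_in V f"
  have smooth_f: "smooth_on V (\<lambda>z. f z [])" using f by (simp add: form_on_0)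
  define \<alpha> where "\<alpha> = (\<lambda>z vs. f z [] * J_theta z vs)"
  have form_\<alpha>: "form_on V 1 \<alpha>"
    using form_J_theta smooth_f unfolding form_on_1 \<alpha>_def
    by (auto simp: linear_iff algebra_simps intro!: smooth_on_mult open_V)
  obtain K where K: "compact K" "K \<subseteq> V" "\<And>z vs. z \<in> V - K \<Longrightarrow> f z vs = 0"
    using supp unfolding compactly_supported_in_def by blast
  have supp_\<alpha>: "compactly_supported_in V \<alpha>"
    unfolding compactly_supported_in_def \<alpha>_def using K by (intro exI[of _ K]) auto
  \<comment> \<open>In the product rule J occurs twice, once in \<open>J_theta\<close> and once in
    \<open>trace_d\<close>. Since J^2 = -1, the gradient term is minus the inner product of df and
    \<theta>.\<close>
  have trace_d_\<alpha>: "trace_d z \<alpha> = - (\<Sum>c\<in>UNIV. ext_d f z [fr z c] * theta z (fr z c)) + f z [] * trace_d z J_theta" if z: "z \<in> V" for z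
  proof -
    have "dir_deriv (\<lambda>w. f w [] * J_theta w [x]) z v = f z [] * dir_deriv (\<lambda>w. J_theta w [x]) z v + dir_deriv (\<lambda>w. f w []) z v * J_theta z [x]" for x v
      using form_J_theta z unfolding form_on_1
      by (intro dir_deriv_eqI has_derivative_mult dir_deriv_worksI smooth_on_differentiable[OF _ z] smooth_f) auto
    moreover have "J_theta z [J x] = - theta z x" for x
      using linear_neg[OF linear_theta[OF z]] by (simp add: J_theta_def)
    ultimately show ?thesis
      unfolding trace_d_def \<alpha>_def
      by (simp add: sum.distrib sum_negf sum_subtractf sum_distrib_left ext_d_0)
  qed
  have inner_\<alpha>: "form_inner (G z) 1 (\<alpha> z) (J_theta z) = f z [] * (\<Sum>c\<in>UNIV. (theta z (fr z c))\<^sup>2)" if z: "z \<in> V" for z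
  proof -
    have B: "bilinear (\<lambda>x y. theta z x * theta z y)"
      using linear_theta[OF z] by (auto simp: bilinear_def linear_iff algebra_simps)
    have "form_inner (G z) 1 (\<alpha> z) (J_theta z) = f z [] * (\<Sum>c\<in>UNIV. theta z (J (fr z c)) * theta z (J (fr z c)))"
      by (simp add: metric_trace_fr \<alpha>_def J_theta_def sum_distrib_left mult.assoc)
    then show ?thesis unfolding trace_J_G[OF z B] by (simp add: power2_eq_square)
  qed
  have grad0: "ext_d f z [x] = 0" if "z \<in> V - K" for x z
  proof -
    have "open (V - K)" using open_V compact_imp_closed[OF K(1)] by (rule open_Diff)
    then have "dir_deriv (\<lambda>w. f w []) z x = dir_deriv (\<lambda>_. 0) z x"
      using that K(3) by (rule dir_deriv_cong_open)
    also have "\<dots> = 0" by (rule dir_deriv_eqI) (auto intro: derivative_eq_intros)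
    finally show ?thesis by (simp add: ext_d_0)
  qed
  let ?D = "\<lambda>z. form_inner (G z) 1 (ext_d f z) (\<theta> z)"
  have D: "?D z = (\<Sum>c\<in>UNIV. ext_d f z [fr z c] * theta z (fr z c))" if "z \<in> V" for z
    using \<theta>[OF that] by (simp add: metric_trace_fr)
  let ?F = "\<lambda>z. f z [] * (trace_d z J_theta - (\<Sum>c\<in>UNIV. (theta z (fr z c))\<^sup>2))"
  have "(LINT z:V|lborel. ?F z * vol z - ?D z * vol z)
      = (LINT z:V|lborel. trace_d z \<alpha> * vol z - form_inner (G z) 1 (\<alpha> z) (J_theta z) * vol z)"
  proof (rule set_lebesgue_integral_cong, goal_cases)
    case 2
    show ?case
    proof (intro allI impI)
      fix z assume z: "z \<in> V"
      show "?F z * vol z - ?D z * vol z = trace_d z \<alpha> * vol z - form_inner (G z) 1 (\<alpha> z) (J_theta z) * vol z"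
        unfolding D[OF z] trace_d_\<alpha>[OF z] inner_\<alpha>[OF z] by (simp add: algebra_simps)
    qed
  qed (use open_V in simp)
  also have "\<dots> = 0"
    using stokes[OF form_\<alpha> supp_\<alpha>] by (simp add: metric_trace_fr J_theta_def left_diff_distrib)
  finally have zero: "(LINT z:V|lborel. ?F z * vol z - ?D z * vol z) = 0" .
  have smooth_df: "smooth_on V (\<lambda>z. ext_d f z [x])" for x
    unfolding ext_d_0 by (rule smooth_on_dir_deriv[OF smooth_f])
  have cont_D: "continuous_on V ?D"
  proof -
    have "smooth_on V (\<lambda>z. metric_trace (G z) (\<lambda>x y. ext_d f z [x] * theta z y))"
    proof (intro smooth_trace smooth_on_mult open_V smooth_theta smooth_df)
      show "bilinear (\<lambda>x y. ext_d f z [x] * theta z y)" if z: "z \<in> V" for z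
        using linear_theta[OF z] linear_dir_deriv[OF smooth_on_differentiable[OF smooth_f z]]
        by (auto simp: bilinear_def linear_iff algebra_simps ext_d_0)
    qed
    then have "continuous_on V (\<lambda>z. \<Sum>c\<in>UNIV. ext_d f z [fr z c] * theta z (fr z c))"
      by (simp add: metric_trace_fr smooth_on_continuous)
    then show ?thesis by (subst continuous_on_cong[OF refl D]) auto
  qed
  have "(LINT z:V|lborel. ?F z * vol z - ?D z * vol z)
      = (LINT z:V|lborel. ?F z * vol z) - (LINT z:V|lborel. ?D z * vol z)"
  proof (rule set_integral_diff)
    show "set_integrable lborel V (\<lambda>z. ?F z * vol z)"
    proof (rule set_integrable_vol[OF K(1,2)])
      show "continuous_on V ?F"
        by (rule smooth_on_continuous)
          (intro smooth_on_mult smooth_on_diff smooth_f smooth_sq open_V smooth_trace_d form_J_theta)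
      show "?F z = 0" if "z \<in> V - K" for z using K(3)[OF that] by simp
    qed
    show "set_integrable lborel V (\<lambda>z. ?D z * vol z)"
      by (rule set_integrable_vol[OF K(1,2) cont_D]) (simp add: metric_trace_fr grad0)
  qed
  then show "L2_inner V G (Suc 0) (ext_d f) \<theta> = L2_inner V G 0 f (\<lambda>z vs. trace_d z J_theta - (\<Sum>c\<in>UNIV. (theta z (fr z c))\<^sup>2))"
    using zero by (simp add: L2_inner_def del: form_inner.simps(2))
qed

end

end

section \<open>Torsion\<close>

lemma vec_scale_J: "c *s x = Re c *\<^sub>R x + Im c *\<^sub>R J (x :: 'n::finite tvec)"
  by (simp add: vec_eq_iff J_def complex_eq_iff)

context hermitian_jet
begin

lemma linear_tau: "linear (\<lambda>x. tau x y u)" "linear (\<lambda>y. tau x y u)" "linear (\<lambda>u. tau x y u)"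
  by (auto intro!: linearI simp: tau_simps)

context
  fixes e :: "'n + 'n \<Rightarrow> 'n tvec"
  assumes e: "orthonormal_frame g e"
begin

lemma parseval: "(\<Sum>c\<in>UNIV. (g x (e c))\<^sup>2) = g x x"
  using frame_real[OF e linear_g(1), of x x] by (simp add: power2_eq_square)

lemma g_frame_J: "g (e c) (J (e c)) = 0"
  using g_J_swap[of "e c" "e c"] sym[of "J (e c)" "e c"] by simp

lemma trace_J_mult:
  fixes A B :: "'n tvec \<Rightarrow> real"
  assumes "linear A" "linear B"
  shows "(\<Sum>c\<in>UNIV. A (J (e c)) * B (J (e c))) = (\<Sum>c\<in>UNIV. A (e c) * B (e c))"
  by (rule trace_J[OF e]) (use assms in \<open>auto simp: bilinear_def linear_iff algebra_simps\<close>)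

definition trace3 :: "('n tvec \<Rightarrow> 'n tvec \<Rightarrow> 'n tvec \<Rightarrow> real) \<Rightarrow> real" where
  "trace3 F = (\<Sum>c\<in>UNIV. \<Sum>d\<in>UNIV. \<Sum>f\<in>UNIV. F (e c) (e d) (e f))"

lemma trace3_J1:
  assumes "\<And>y u. linear (\<lambda>x. A x y u)" "\<And>y u. linear (\<lambda>x. B x y u)"
  shows "trace3 (\<lambda>x y u. A (J x) y u * B (J x) y u) = trace3 (\<lambda>x y u. A x y u * B x y u)"
proof -
  have "bilinear (\<lambda>x x'. \<Sum>d\<in>UNIV. \<Sum>f\<in>UNIV. A x (e d) (e f) * B x' (e d) (e f))"
    using assms by (auto simp: bilinear_def linear_iff algebra_simps sum.distrib sum_distrib_left)
  from trace_J[OF e this] show ?thesis by (simp add: trace3_def)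
qed

lemma trace3_J2:
  assumes "\<And>x u. linear (\<lambda>y. A x y u)" "\<And>x u. linear (\<lambda>y. B x y u)"
  shows "trace3 (\<lambda>x y u. A x (J y) u * B x (J y) u) = trace3 (\<lambda>x y u. A x y u * B x y u)"
proof -
  have "bilinear (\<lambda>y y'. \<Sum>f\<in>UNIV. A x y (e f) * B x y' (e f))" for x
    using assms by (auto simp: bilinear_def linear_iff algebra_simps sum.distrib sum_distrib_left)
  from trace_J[OF e this] show ?thesis by (simp add: trace3_def)
qed

lemma trace3_J3:
  assumes "\<And>x y. linear (A x y)" "\<And>x y. linear (B x y)"
  shows "trace3 (\<lambda>x y u. A x y (J u) * B x y (J u)) = trace3 (\<lambda>x y u. A x y u * B x y u)"
  unfolding trace3_def trace_J_mult[OF assms] ..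

lemma trace3_swap12: "trace3 (\<lambda>x y u. F y x u) = trace3 F"
  unfolding trace3_def by (rule sum.swap)

lemma trace3_swap23: "trace3 (\<lambda>x y u. F x u y) = trace3 F"
  unfolding trace3_def by (intro sum.cong refl sum.swap)

lemma trace3_add: "trace3 (\<lambda>x y u. F x y u + H x y u) = trace3 F + trace3 H"
  by (simp add: trace3_def sum.distrib)

lemma trace3_cmult: "trace3 (\<lambda>x y u. k * F x y u) = k * trace3 F"
  by (simp add: trace3_def sum_distrib_left)

text \<open>The function \<open>g(T\<^sup>r(x,y),u)\<close> of the torsion \<open>T\<^sup>r\<close>.\<close>

definition torsion_form :: "real \<Rightarrow> 'n tvec \<Rightarrow> 'n tvec \<Rightarrow> 'n tvec \<Rightarrow> real" where
  "torsion_form r x y u = - ((r - 1) / 2 * tau (J x) (J y) (J u)) - (1 + r) / 4 * (tau (J x) y u + tau x (J y) u)"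

lemma linear_tau_J: "linear (\<lambda>x. tau (J x) y u)" "linear (\<lambda>y. tau x (J y) u)" "linear (\<lambda>u. tau x y (J u))"
  by (auto intro!: linearI simp: tau_simps)

text \<open>The origin of K_r. Moving J between factors under the trace reduces all products to two
  numbers: D, the square sum of \<open>tau\<close>, and E, the sum of tau(x,y,u) tau(J x,J y,u).
  Multiplying \<open>tau_type\<close> by \<open>tau\<close> and using skewness gives D = 3 E. With p
  = (r-1)/2 and q = (1+r)/4 the total is (p^2 + 4pq/3 + 4q^2/3) D = K_r D / 6.\<close>

lemma trace3_torsion_form: "trace3 (\<lambda>x y u. (torsion_form r x y u)\<^sup>2) = (3 * r\<^sup>2 - 2 * r + 1) / 6 * trace3 (\<lambda>x y u. (tau x y u)\<^sup>2)"
proof -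
  let ?D = "trace3 (\<lambda>x y u. tau x y u * tau x y u)"
  let ?E = "trace3 (\<lambda>x y u. tau x y u * tau (J x) (J y) u)"
  have E1: "trace3 (\<lambda>x y u. tau x y u * tau (J x) y (J u)) = ?E"
  proof -
    have "trace3 (\<lambda>x y u. tau x y u * tau (J x) y (J u)) = trace3 (\<lambda>x y u. tau x u y * tau (J x) u (J y))"
      by (rule trace3_swap23[symmetric])
    also have "trace3 (\<lambda>x y u. tau x u y * tau (J x) u (J y)) = trace3 (\<lambda>x y u. tau x y u * tau (J x) (J y) u)"
    proof (intro arg_cong[of _ _ trace3] ext)
      fix x y u show "tau x u y * tau (J x) u (J y) = tau x y u * tau (J x) (J y) u"
        using tau_skew(2)[of x u y] tau_skew(2)[of "J x" u "J y"] by simp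
    qed
    finally show ?thesis .
  qed
  have E2: "trace3 (\<lambda>x y u. tau x y u * tau x (J y) (J u)) = ?E"
  proof -
    have "trace3 (\<lambda>x y u. tau x y u * tau x (J y) (J u)) = trace3 (\<lambda>x y u. tau y x u * tau y (J x) (J u))"
      by (rule trace3_swap12[symmetric])
    also have "trace3 (\<lambda>x y u. tau y x u * tau y (J x) (J u)) = trace3 (\<lambda>x y u. tau x y u * tau (J x) y (J u))"
    proof (intro arg_cong[of _ _ trace3] ext)
      fix x y u show "tau y x u * tau y (J x) (J u) = tau x y u * tau (J x) y (J u)"
        using tau_skew(1)[of y x u] tau_skew(1)[of y "J x" "J u"] by simp
    qed
    finally show ?thesis unfolding E1 .
  qed
  have E: "?E = ?D / 3"
  proof -
    have "tau x y u * tau x y u = tau x y u * tau (J x) (J y) u + (tau x y u * tau (J x) y (J u) + tau x y u * tau x (J y) (J u))" for x y u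
      unfolding distrib_left[symmetric] using tau_type[of x y u] by (simp add: add.assoc)
    then have "?D = trace3 (\<lambda>x y u. tau x y u * tau (J x) (J y) u + (tau x y u * tau (J x) y (J u) + tau x y u * tau x (J y) (J u)))"
      by (simp only:)
    also have "\<dots> = 3 * ?E" unfolding trace3_add E1 E2 by simp
    finally show ?thesis by simp
  qed
  have S1: "trace3 (\<lambda>x y u. tau (J x) y u * tau (J x) y u) = ?D"
    by (rule trace3_J1) (rule linear_tau)+
  have S2: "trace3 (\<lambda>x y u. tau x (J y) u * tau x (J y) u) = ?D"
    by (rule trace3_J2) (rule linear_tau)+
  have S3: "trace3 (\<lambda>x y u. tau (J x) (J y) (J u) * tau (J x) (J y) (J u)) = ?D"
  proof -
    have "trace3 (\<lambda>x y u. tau (J x) (J y) (J u) * tau (J x) (J y) (J u)) = trace3 (\<lambda>x y u. tau x (J y) (J u) * tau x (J y) (J u))"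
      by (rule trace3_J1) (rule linear_tau)+
    also have "\<dots> = trace3 (\<lambda>x y u. tau x y (J u) * tau x y (J u))"
      by (rule trace3_J2) (rule linear_tau)+
    also have "\<dots> = ?D"
      by (rule trace3_J3) (rule linear_tau)+
    finally show ?thesis .
  qed
  have S12: "trace3 (\<lambda>x y u. tau (J x) y u * tau x (J y) u) = - ?E"
  proof -
    have "trace3 (\<lambda>x y u. tau (J x) y u * tau x (J y) u) = trace3 (\<lambda>x y u. tau (J (J x)) y u * tau (J x) (J y) u)"
      by (rule trace3_J1[symmetric]) (rule linear_tau linear_tau_J)+
    also have "\<dots> = - ?E" using trace3_cmult[of "-1"] by (simp add: tau_simps)
    finally show ?thesis .
  qed
  have S31: "trace3 (\<lambda>x y u. tau (J x) (J y) (J u) * tau (J x) y u) = ?E"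
  proof -
    have "trace3 (\<lambda>x y u. tau (J x) (J y) (J u) * tau (J x) y u) = trace3 (\<lambda>x y u. tau x (J y) (J u) * tau x y u)"
      by (rule trace3_J1) (rule linear_tau)+
    then show ?thesis using E2 by (simp add: mult.commute)
  qed
  have S32: "trace3 (\<lambda>x y u. tau (J x) (J y) (J u) * tau x (J y) u) = ?E"
  proof -
    have "trace3 (\<lambda>x y u. tau (J x) (J y) (J u) * tau x (J y) u) = trace3 (\<lambda>x y u. tau (J x) y (J u) * tau x y u)"
      by (rule trace3_J2) (rule linear_tau)+
    then show ?thesis using E1 by (simp add: mult.commute)
  qed
  define p where "p = (r - 1) / 2"
  define q where "q = (1 + r) / 4"
  have "(torsion_form r x y u)\<^sup>2 = p\<^sup>2 * (tau (J x) (J y) (J u) * tau (J x) (J y) (J u))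
     + (2 * p * q * (tau (J x) (J y) (J u) * tau (J x) y u) + (2 * p * q * (tau (J x) (J y) (J u) * tau x (J y) u)
     + (q\<^sup>2 * (tau (J x) y u * tau (J x) y u) + (q\<^sup>2 * (tau x (J y) u * tau x (J y) u)
     + 2 * q\<^sup>2 * (tau (J x) y u * tau x (J y) u)))))" for x y u
    unfolding torsion_form_def p_def[symmetric] q_def[symmetric] by (simp add: power2_eq_square algebra_simps)
  then have "trace3 (\<lambda>x y u. (torsion_form r x y u)\<^sup>2) = p\<^sup>2 * ?D + (2 * p * q * ?E + (2 * p * q * ?E + (q\<^sup>2 * ?D + (q\<^sup>2 * ?D + 2 * q\<^sup>2 * - ?E))))"
    by (simp only: trace3_add trace3_cmult S1 S2 S3 S12 S31 S32)
  then show ?thesis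
    unfolding E by (simp add: p_def q_def power2_eq_square field_simps)
qed

definition lee_sq :: real where "lee_sq = (\<Sum>c\<in>UNIV. (lee e (e c))\<^sup>2)"

text \<open>The trace part of the torsion is a multiple of \<open>lee_part x y - lee_part y x\<close>.\<close>

definition lee_part :: "'n tensor21" where
  "lee_part x y = lee e x *\<^sub>R y - lee e (J x) *\<^sub>R J y"

lemma lee_J: "linear (\<lambda>x. lee e (J x))"
  using linear_compose[OF linear_J linear_lee] by (simp add: comp_def)

lemma lee_sq_J: "(\<Sum>c\<in>UNIV. lee e (J (e c)) * lee e (J (e c))) = lee_sq"
  unfolding trace_J_mult[OF linear_lee linear_lee] lee_sq_def by (simp add: power2_eq_square)

lemma lee_sq: "(\<Sum>c\<in>UNIV. lee e (e c) * lee e (e c)) = lee_sq"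
  by (simp add: lee_sq_def power2_eq_square)

lemma tau_self: "tau x y y = 0"
  using tau_skew(2)[of x y y] by simp

text \<open>The vectors e_d and J e_d are orthonormal, so each of the 2n indices d contributes
  \<theta>(x)^2 + \<theta>(J x)^2, and the sum of this over the frame is 2
  \<open>lee_sq\<close>.\<close>

lemma sum_lee_part_lee_part: "(\<Sum>c\<in>UNIV. \<Sum>d\<in>UNIV. g (lee_part (e c) (e d)) (lee_part (e c) (e d))) = 4 * real CARD('n) * lee_sq"
proof -
  have ee: "g (e d) (e d) = 1" for d using e by (simp add: orthonormal_frame_def)
  have "g (lee_part x (e d)) (lee_part x (e d)) = lee e x * lee e x + lee e (J x) * lee e (J x)" for x d
    unfolding lee_part_def by (simp add: g_simps g_frame_J g_J_swap[of "e d" "e d"] g_J ee)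
  then show ?thesis by (simp add: sum.distrib lee_sq lee_sq_J sum_distrib_left[symmetric])
qed

lemma sum_lee_part_lee_part': "(\<Sum>c\<in>UNIV. \<Sum>d\<in>UNIV. g (lee_part (e c) (e d)) (lee_part (e d) (e c))) = 4 * lee_sq"
proof -
  have "(\<Sum>d\<in>UNIV. g (lee_part x (e d)) (lee_part (e d) x)) = 2 * (lee e x * lee e x) + 2 * (lee e (J x) * lee e (J x))" for x
  proof -
    have "g (lee_part x y) (lee_part y x) = lee e x * (g x y * lee e y) - lee e x * (g (J x) y * lee e (J y))
        + lee e (J x) * (g (J x) y * lee e y) + lee e (J x) * (g x y * lee e (J y))" for y
      unfolding lee_part_def using g_J_swap[of y x] by (simp add: g_simps g_J sym[of y] algebra_simps)
    then show ?thesis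
      by (simp add: sum.distrib sum_subtractf sum_distrib_left[symmetric] frame_real[OF e linear_lee] frame_real[OF e lee_J] linear_neg[OF linear_lee])
  qed
  then show ?thesis by (simp add: sum.distrib lee_sq lee_sq_J sum_distrib_left[symmetric])
qed

context
  fixes T :: "'n tensor21"
  assumes T: "g (T x y) u = torsion_form 1 x y u"
begin

text \<open>The Chern torsion is complex bilinear. In terms of g this is precisely the absence of a
  (3,0) part, \<open>tau_type\<close>.\<close>

lemma T_J: "T (J x) y = J (T x y)" "T x (J y) = J (T x y)"
proof -
  have 1: "g (T (J x) y) u = g (J (T x y)) u" for u
    using tau_type[of x y u] by (simp add: T torsion_form_def g_J_swap tau_simps field_simps)
  have 2: "g (T x (J y)) u = g (J (T x y)) u" for u
    using tau_type[of x y u] by (simp add: T torsion_form_def g_J_swap tau_simps field_simps)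
  show "T (J x) y = J (T x y)" "T x (J y) = J (T x y)"
    by (rule nondegenerate, rule 1) (rule nondegenerate, rule 2)
qed

lemma T_linear: "linear (\<lambda>x. T x y)" "linear (T x)"
  by (auto intro!: linearI nondegenerate simp: g_simps T torsion_form_def tau_simps algebra_simps)

lemma T_skew: "T x y = - T y x"
proof (rule nondegenerate)
  fix u show "g (T x y) u = g (- T y x) u"
    using tau_skew(1)[of "J x" y u] tau_skew(1)[of x "J y" u] by (simp add: g_simps T torsion_form_def field_simps)
qed

text \<open>At r = 1 only the second term of \<open>torsion_form\<close> is left. With u = y one of
  its summands is zero and the other is half the integrand of \<open>lee\<close>; with u = J y the
  roles are exchanged.\<close>

lemma trace_T: "(\<Sum>d\<in>UNIV. g (T x (e d)) (e d)) = lee e x" "(\<Sum>d\<in>UNIV. g (T x (e d)) (J (e d))) = - lee e (J x)"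
proof -
  have "g (T x y) y = tau x y (J y) / 2" for y
    using tau_skew(2)[of x "J y" y] by (simp add: T torsion_form_def tau_self)
  then show "(\<Sum>d\<in>UNIV. g (T x (e d)) (e d)) = lee e x"
    by (simp only: lee_def sum_divide_distrib)
  have "g (T x y) (J y) = - (tau (J x) y (J y) / 2)" for y
    by (simp add: T torsion_form_def tau_self)
  then show "(\<Sum>d\<in>UNIV. g (T x (e d)) (J (e d))) = - lee e (J x)"
    by (simp add: lee_def sum_divide_distrib sum_negf)
qed

lemma sum_T_lee_part: "(\<Sum>c\<in>UNIV. \<Sum>d\<in>UNIV. g (T (e c) (e d)) (lee_part (e c) (e d))) = 2 * lee_sq"
proof -
  have "(\<Sum>d\<in>UNIV. g (T x (e d)) (lee_part x (e d))) = lee e x * lee e x + lee e (J x) * lee e (J x)" for x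
    unfolding lee_part_def by (simp add: g_simps sum_subtractf sum_distrib_left[symmetric] trace_T)
  then show ?thesis by (simp add: sum.distrib lee_sq lee_sq_J)
qed

lemma sum_T_lee_part': "(\<Sum>c\<in>UNIV. \<Sum>d\<in>UNIV. g (T (e c) (e d)) (lee_part (e d) (e c))) = - (2 * lee_sq)"
proof -
  have "g (T x y) v = - g (T y x) v" for x y v
    by (subst T_skew) (simp add: g_simps)
  then have "(\<Sum>c\<in>UNIV. \<Sum>d\<in>UNIV. g (T (e c) (e d)) (lee_part (e d) (e c)))
      = - (\<Sum>c\<in>UNIV. \<Sum>d\<in>UNIV. g (T (e d) (e c)) (lee_part (e d) (e c)))"
    unfolding sum_negf[symmetric] by (intro sum.cong refl)
  also have "(\<Sum>c\<in>UNIV. \<Sum>d\<in>UNIV. g (T (e d) (e c)) (lee_part (e d) (e c))) = 2 * lee_sq"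
    using sum_T_lee_part by (subst sum.swap)
  finally show ?thesis .
qed

text \<open>Expanding the square gives -8 \<kappa> from the products with T and 8 \<kappa>^2 (n-1)
  from the trace part. As 2 \<kappa> (n-1) = 1, the latter is 4 \<kappa>, and the sum -4 \<kappa> is
  -2/(n-1).\<close>

lemma norm_tracefree:
  assumes n: "CARD('n) \<ge> 2"
  defines "\<kappa> \<equiv> 1 / (2 * (real CARD('n) - 1))"
  defines "W \<equiv> \<lambda>x y. T x y - \<kappa> *\<^sub>R (lee_part x y - lee_part y x)"
  shows "(\<Sum>c\<in>UNIV. \<Sum>d\<in>UNIV. g (W (e c) (e d)) (W (e c) (e d)))
     = (\<Sum>c\<in>UNIV. \<Sum>d\<in>UNIV. g (T (e c) (e d)) (T (e c) (e d))) - 2 / (real CARD('n) - 1) * lee_sq"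
proof -
  have W: "g (W x y) (W x y) = g (T x y) (T x y) - 2 * \<kappa> * g (T x y) (lee_part x y) + 2 * \<kappa> * g (T x y) (lee_part y x)
     + \<kappa>\<^sup>2 * g (lee_part x y) (lee_part x y) + \<kappa>\<^sup>2 * g (lee_part y x) (lee_part y x) - 2 * \<kappa>\<^sup>2 * g (lee_part x y) (lee_part y x)" for x y
    unfolding W_def using sym[of "lee_part x y" "T x y"] sym[of "lee_part y x" "T x y"] sym[of "lee_part y x" "lee_part x y"]
    by (simp add: g_simps power2_eq_square algebra_simps)
  have sw: "(\<Sum>c\<in>UNIV. \<Sum>d\<in>UNIV. g (lee_part (e d) (e c)) (lee_part (e d) (e c))) = 4 * real CARD('n) * lee_sq"
    using sum_lee_part_lee_part by (subst sum.swap)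
  have "(\<Sum>c\<in>UNIV. \<Sum>d\<in>UNIV. g (W (e c) (e d)) (W (e c) (e d)))
     = (\<Sum>c\<in>UNIV. \<Sum>d\<in>UNIV. g (T (e c) (e d)) (T (e c) (e d))) - 2 * \<kappa> * (2 * lee_sq) + 2 * \<kappa> * (- (2 * lee_sq))
     + \<kappa>\<^sup>2 * (4 * real CARD('n) * lee_sq) + \<kappa>\<^sup>2 * (4 * real CARD('n) * lee_sq) - 2 * \<kappa>\<^sup>2 * (4 * lee_sq)"
    unfolding W sum.distrib sum_subtractf sum_distrib_left[symmetric] sum_T_lee_part sum_T_lee_part' sum_lee_part_lee_part sum_lee_part_lee_part' sw ..
  also have "\<dots> = (\<Sum>c\<in>UNIV. \<Sum>d\<in>UNIV. g (T (e c) (e d)) (T (e c) (e d))) - 2 / (real CARD('n) - 1) * lee_sq"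
  proof -
    have "real CARD('n) - 1 \<noteq> 0" using n by simp
    then have "\<kappa> * (real CARD('n) - 1) = 1 / 2" by (simp add: \<kappa>_def)
    then have "\<kappa>\<^sup>2 * (real CARD('n) - 1) = \<kappa> / 2" by (simp add: power2_eq_square mult.assoc)
    then have "8 * (\<kappa>\<^sup>2 * (real CARD('n) - 1)) * lee_sq = 8 * (\<kappa> / 2) * lee_sq"
      by (rule arg_cong)
    moreover have "2 / (real CARD('n) - 1) = 4 * \<kappa>"
      using \<open>real CARD('n) - 1 \<noteq> 0\<close> unfolding \<kappa>_def times_divide_eq_right by (subst frac_eq_eq) auto
    ultimately show ?thesis by (simp add: algebra_simps)
  qed
  finally show ?thesis .
qed

end

end

end

section \<open>Torsion and scalar curvature on a coordinate patch\<close>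

context hermitian_patch
begin

text \<open>Symmetry is what makes the Levi-Civita term drop out of the torsion. As
  \<open>levi_civita\<close> is a definite description, it takes existence and uniqueness to extract
  it.\<close>

lemma levi_civita_sym:
  assumes z: "z \<in> V" shows "levi_civita G z X Y = levi_civita G z Y X"
proof -
  interpret hermitian_jet "a z" "da z" rewrites "hermitian_form.g (a z) = G z"
    by (rule hermitian_jet_a[OF z]) (rule g_eq[OF z])
  define dG where "dG x y u = dir_deriv (\<lambda>w. G w y u) z x" for x y u
  have dG: "dG x y u = da z x y (J u)" for x y u
    by (simp add: dG_def da_def assoc_metric_def)
  have dG_sym: "dG x y u = dG x u y" for x y u
  proof -
    have "dG x y u = dir_deriv (\<lambda>w. G w u y) z x"
      unfolding dG_def
      by (rule dir_deriv_cong_open[OF open_V z]) (rule inner_form.sym[OF inner_form_G])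
    then show ?thesis by (simp add: dG_def)
  qed
  \<comment> \<open>The Koszul formula for constant vector fields, whose brackets vanish.\<close>
  define K where "K x y u = (dG x y u + dG y x u - dG u x y) / 2" for x y u
  have K_lin: "K (x + x') y u = K x y u + K x' y u" "K (r *\<^sub>R x) y u = r * K x y u"
    "K y (x + x') u = K y x u + K y x' u" "K y (r *\<^sub>R x) u = r * K y x u"
    "K y u (x + x') = K y u x + K y u x'" "K y u (r *\<^sub>R x) = r * K y u x" for x x' y u r
    by (simp_all add: K_def dG da_simps field_simps)
  have K_sym: "K x y u = K y x u" for x y u using dG_sym[of u x y] by (simp add: K_def)
  define \<Gamma> where "\<Gamma> x y = (\<Sum>c\<in>UNIV. K x y (fr z c) *\<^sub>R fr z c)" for x y
  have \<Gamma>: "G z (\<Gamma> x y) u = K x y u" for x y u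
  proof -
    have "linear (K x y)" using K_lin by (intro linearI) auto
    moreover have "G z (\<Gamma> x y) u = (\<Sum>c\<in>UNIV. G z u (fr z c) * K x y (fr z c))"
      by (simp add: \<Gamma>_def g_sum g_simps sym[of "fr z _"] mult.commute)
    ultimately show ?thesis using frame_real_G[OF z] by simp
  qed
  let ?P = "\<lambda>\<Gamma>. bilinear \<Gamma> \<and> (\<forall>X Y. \<Gamma> X Y = \<Gamma> Y X) \<and>
     (\<forall>X Y Z. dir_deriv (\<lambda>w. G w Y Z) z X = G z (\<Gamma> X Y) Z + G z Y (\<Gamma> X Z))"
  have "?P \<Gamma>"
  proof (intro conjI allI)
    show "bilinear \<Gamma>"
      unfolding bilinear_def by (auto intro!: linearI nondegenerate simp: g_simps \<Gamma> K_lin)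
    show "\<Gamma> x y = \<Gamma> y x" for x y by (simp add: \<Gamma>_def K_sym[of x y])
    show "dir_deriv (\<lambda>w. G w y u) z x = G z (\<Gamma> x y) u + G z y (\<Gamma> x u)" for x y u
      using dG_sym[of x y u] dG_sym[of y x u] dG_sym[of u x y]
      unfolding sym[of y "\<Gamma> x u"] \<Gamma> dG_def[symmetric] by (simp add: K_def field_simps)
  qed
  moreover have "\<Delta> = \<Gamma>" if \<Delta>: "?P \<Delta>" for \<Delta>
  proof (intro ext)
    fix x y
    have "G z (\<Delta> x y) u = K x y u" for u
    proof -
      have c: "dG x y u = G z (\<Delta> x y) u + G z y (\<Delta> x u)" for x y u
        using \<Delta> unfolding dG_def by blast
      have s: "\<Delta> x y = \<Delta> y x" for x y using \<Delta> by blast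
      show ?thesis
        using c[of x y u] c[of y x u] c[of u x y] s[of y x] s[of u x] s[of u y] sym[of y "\<Delta> x u"]
        by (simp add: K_def)
    qed
    then show "\<Delta> x y = \<Gamma> x y" by (intro nondegenerate) (simp add: \<Gamma>)
  qed
  ultimately have "?P (THE \<Gamma>. ?P \<Gamma>)" by (rule theI)
  then show ?thesis unfolding levi_civita_def by blast
qed

lemma G_gauduchon:
  assumes z: "z \<in> V"
  shows "G z (gauduchon r \<omega> z X Y) Z = G z (levi_civita G z X Y) Z
        + (r - 1) / 4 * J_form (ext_d \<omega> z) [X, Y, Z] - (1 + r) / 4 * ext_d \<omega> z [J X, Y, Z]"
proof -
  interpret hermitian_jet "a z" "da z" rewrites "hermitian_form.g (a z) = G z"
    by (rule hermitian_jet_a[OF z]) (rule g_eq[OF z])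
  define F where "F Z = G z (levi_civita G z X Y) Z
        + (r - 1) / 4 * J_form (ext_d \<omega> z) [X, Y, Z] - (1 + r) / 4 * ext_d \<omega> z [J X, Y, Z]" for Z
  have lin: "linear F"
    by (rule linearI) (simp_all add: F_def J_form_def ext_d_\<omega>[OF z] g_simps tau_simps algebra_simps)
  define W where "W = (\<Sum>c\<in>UNIV. F (fr z c) *\<^sub>R fr z c)"
  have W: "G z W Z = F Z" for Z
  proof -
    have "G z W Z = (\<Sum>c\<in>UNIV. G z Z (fr z c) * F (fr z c))"
      by (simp add: W_def g_sum g_simps sym[of "fr z _"] mult.commute)
    then show ?thesis by (simp add: frame_real_G[OF z lin])
  qed
  have "gauduchon r \<omega> z X Y = (THE W. \<forall>Z. G z W Z = F Z)"
    by (simp add: gauduchon_def F_def Let_def)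
  also have "\<dots> = W"
  proof (rule the_equality)
    show "W' = W" if "\<forall>Z. G z W' Z = F Z" for W'
      by (rule nondegenerate) (simp add: that W)
  qed (simp add: W)
  finally show ?thesis by (simp add: W F_def)
qed

text \<open>The Levi-Civita terms cancel. The \<open>J_form\<close> term is skew in X and Y and
  doubles, with sign (-1)^3 from the convention for 3-forms; skewness of \<open>tau\<close> turns
  the remaining difference into the sum in \<open>torsion_form\<close>.\<close>

lemma G_torsion:
  assumes z: "z \<in> V"
  shows "G z (torsion r \<omega> z X Y) Z = hermitian_jet.torsion_form (da z) r X Y Z"
proof -
  interpret hermitian_jet "a z" "da z" rewrites "hermitian_form.g (a z) = G z"
    by (rule hermitian_jet_a[OF z]) (rule g_eq[OF z])
  show ?thesis
    using levi_civita_sym[OF z, of X Y] tau_skew(1)[of "J Y" "J X" "J Z"] tau_skew(1)[of "J Y" X Z]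
    unfolding torsion_def
    by (simp add: g_simps G_gauduchon[OF z] J_form_def ext_d_\<omega>[OF z] torsion_form_def[OF fr[OF z]] field_simps)
qed

lemma norm_torsion:
  assumes z: "z \<in> V"
  shows "tensor_norm_sq (G z) (torsion r \<omega> z) = (3 * r\<^sup>2 - 2 * r + 1) / 2 * tensor_norm_sq (G z) (torsion 1 \<omega> z)"
proof -
  interpret hermitian_jet "a z" "da z" rewrites "hermitian_form.g (a z) = G z"
    by (rule hermitian_jet_a[OF z]) (rule g_eq[OF z])
  have eq: "tensor_norm_sq (G z) (torsion r \<omega> z) = (3 * r\<^sup>2 - 2 * r + 1) / 6 * trace3 (fr z) (\<lambda>x y u. (tau x y u)\<^sup>2)" for r
  proof -
    have "tensor_norm_sq (G z) (torsion r \<omega> z)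
      = (\<Sum>c\<in>UNIV. \<Sum>d\<in>UNIV. \<Sum>f\<in>UNIV. (G z (torsion r \<omega> z (fr z c) (fr z d)) (fr z f))\<^sup>2)"
      unfolding tensor_norm_sq_def metric_trace_fr parseval[OF fr[OF z]] ..
    also have "\<dots> = trace3 (fr z) (\<lambda>x y u. (torsion_form r x y u)\<^sup>2)"
      unfolding trace3_def[OF fr[OF z]] G_torsion[OF z] ..
    finally show ?thesis unfolding trace3_torsion_form[OF fr[OF z]] .
  qed
  have "trace3 (fr z) (\<lambda>x y u. (tau x y u)\<^sup>2) = 3 * tensor_norm_sq (G z) (torsion 1 \<omega> z)"
    using eq[of 1] by simp
  then show ?thesis using eq[of r] by simp
qed

text \<open>Real form of the tensor given by complex components. Complex linearity recovers T from
  its values on the vectors \<open>axis i 1\<close>. The trace part is complex linear in X with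
  coefficients \<theta>_i, and the 1/2 in \<theta>_i is the 2 in 2(n-1).\<close>

lemma tracefree_torsion_eq:
  assumes z: "z \<in> V" and lee: "\<And>v. lee_form V \<omega> z [v] = theta z v"
  shows "tracefree_torsion V \<omega> z X Y = torsion 1 \<omega> z X Y
     - (1 / (2 * (real CARD('n) - 1))) *\<^sub>R ((theta z X *\<^sub>R Y - theta z (J X) *\<^sub>R J Y) - (theta z Y *\<^sub>R X - theta z (J Y) *\<^sub>R J X))"
proof -
  interpret hermitian_jet "a z" "da z" rewrites "hermitian_form.g (a z) = G z"
    by (rule hermitian_jet_a[OF z]) (rule g_eq[OF z])
  let ?T = "torsion 1 \<omega> z"
  note TJ = T_J[OF fr[OF z], of ?T, OF G_torsion[OF z]]
  note Tlin = T_linear[OF fr[OF z], of ?T, OF G_torsion[OF z]]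
  have J_nth: "J x $ k = \<i> * x $ k" for x :: "'n tvec" and k by (simp add: J_def)
  have axis_J: "axis i \<i> = J (axis i 1 :: 'n tvec)" for i
    by (simp add: J_def vec_eq_iff axis_def)
  \<comment> \<open>Complex bilinearity makes all four terms of the component formula equal, which
    cancels the division by 4.\<close>
  have comp: "chern_torsion_comp \<omega> z k i j = ?T (axis i 1) (axis j 1) $ k" for k i j
    by (simp add: chern_torsion_comp_def Let_def axis_J TJ J_nth algebra_simps)
  \<comment> \<open>The (1,0) part of \<theta>: complex linear, with \<theta>_i as its value on the
    i-th coordinate vector.\<close>
  define \<Theta> where "\<Theta> x = (of_real (theta z x) - \<i> * of_real (theta z (J x))) / 2" for x
  have lee_comp: "lee_comp V \<omega> z i = \<Theta> (axis i 1)" for i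
    by (simp add: lee_comp_def lee \<Theta>_def axis_J)
  have \<Theta>_scale: "\<Theta> (c *s x) = c * \<Theta> x" for c x
    using linear_theta[OF z]
    by (simp add: \<Theta>_def vec_scale_J linear_add linear_diff linear_scale linear_neg complex_eq_iff algebra_simps)
  have \<Theta>_add: "\<Theta> (x + y) = \<Theta> x + \<Theta> y" for x y
    using linear_theta[OF z] by (simp add: \<Theta>_def linear_add field_simps)
  have \<Theta>_0: "\<Theta> 0 = 0" using linear_0[OF linear_theta[OF z]] by (simp add: \<Theta>_def)
  have \<Theta>: "(\<Sum>i\<in>UNIV. \<Theta> (axis i 1) * x $ i) = \<Theta> x" for x
  proof -
    have "\<Theta> (\<Sum>i\<in>I. x $ i *s axis i 1) = (\<Sum>i\<in>I. x $ i * \<Theta> (axis i 1))" for I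
      by (induction I rule: infinite_finite_induct) (simp_all add: \<Theta>_0 \<Theta>_add \<Theta>_scale)
    from this[of UNIV] show ?thesis by (simp add: basis_expansion mult.commute)
  qed
  have T_scale: "?T (c *s x) y = c *s ?T x y" "?T x (c *s y) = c *s ?T x y" for c x y
    by (simp_all add: vec_scale_J linear_add[OF Tlin(1)] linear_scale[OF Tlin(1)]
        linear_add[OF Tlin(2)] linear_scale[OF Tlin(2)] TJ)
  have T_expand: "?T X Y $ k = (\<Sum>i\<in>UNIV. \<Sum>j\<in>UNIV. ?T (axis i 1) (axis j 1) $ k * X $ i * Y $ j)" for k
  proof -
    have "?T X Y = ?T (\<Sum>i\<in>UNIV. X $ i *s axis i 1) (\<Sum>j\<in>UNIV. Y $ j *s axis j 1)"
      by (simp only: basis_expansion)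
    also have "\<dots> = (\<Sum>i\<in>UNIV. \<Sum>j\<in>UNIV. X $ i *s (Y $ j *s ?T (axis i 1) (axis j 1)))"
      by (simp only: linear_sum[OF Tlin(1)] linear_sum[OF Tlin(2)] T_scale vec.scale_sum_right)
        (subst sum.swap, simp only: vec.scale_left_commute)
    finally show ?thesis by (simp add: mult.assoc mult.left_commute mult.commute)
  qed
  have n0: "of_nat CARD('n) - 1 = complex_of_real (real CARD('n) - 1)" by simp
  have delta: "(\<Sum>i\<in>UNIV. \<Sum>j\<in>UNIV. ((if k = j then \<Theta> (axis i 1) else 0) - (if k = i then \<Theta> (axis j 1) else 0)) / N * X $ i * Y $ j)
     = (\<Theta> X * Y $ k - \<Theta> Y * X $ k) / N" for k N
  proof -
    have "(\<Sum>j\<in>UNIV. ((if k = j then \<Theta> (axis i 1) else 0) - (if k = i then \<Theta> (axis j 1) else 0)) / N * X $ i * Y $ j)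
      = (\<Sum>j\<in>UNIV. if k = j then \<Theta> (axis i 1) * X $ i * Y $ j / N else 0) - (if k = i then X $ i / N else 0) * (\<Sum>j\<in>UNIV. \<Theta> (axis j 1) * Y $ j)" for i
      unfolding sum_distrib_left sum_subtractf[symmetric] by (intro sum.cong refl) (simp add: field_simps diff_divide_distrib)
    then have "(\<Sum>i\<in>UNIV. \<Sum>j\<in>UNIV. ((if k = j then \<Theta> (axis i 1) else 0) - (if k = i then \<Theta> (axis j 1) else 0)) / N * X $ i * Y $ j)
      = (\<Sum>i\<in>UNIV. \<Theta> (axis i 1) * X $ i * (Y $ k / N)) - (\<Sum>i\<in>UNIV. if k = i then X $ i / N * \<Theta> Y else 0)"
      unfolding \<Theta> by (simp add: sum_subtractf if_distrib[of "\<lambda>x. x * _"] cong: if_cong)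
    moreover have "(\<Sum>i\<in>UNIV. \<Theta> (axis i 1) * X $ i * (Y $ k / N)) = \<Theta> X * (Y $ k / N)"
      by (simp only: sum_distrib_right[symmetric] \<Theta>)
    ultimately show ?thesis by (simp only:) (simp add: diff_divide_distrib)
  qed
  have "tracefree_torsion V \<omega> z X Y $ k = ?T X Y $ k - (\<Theta> X * Y $ k - \<Theta> Y * X $ k) / (of_nat CARD('n) - 1)" for k
    unfolding delta[symmetric] T_expand
    by (simp add: tracefree_torsion_def tracefree_torsion_comp_def comp lee_comp sum_subtractf[symmetric] left_diff_distrib cong: if_cong)
  moreover have "(\<Theta> X * Y $ k - \<Theta> Y * X $ k) / (of_nat CARD('n) - 1)
     = ((1 / (2 * (real CARD('n) - 1))) *\<^sub>R ((theta z X *\<^sub>R Y - theta z (J X) *\<^sub>R J Y) - (theta z Y *\<^sub>R X - theta z (J Y) *\<^sub>R J X))) $ k" for k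
  proof -
    have "((of_real p - \<i> * of_real q) / 2 * y - (of_real s - \<i> * of_real q') / 2 * x) / of_real N
      = (1 / (2 * N)) *\<^sub>R ((p *\<^sub>R y - q *\<^sub>R (\<i> * y)) - (s *\<^sub>R x - q' *\<^sub>R (\<i> * x)))"
      for p q s q' N :: real and x y :: complex
      by (cases "N = 0") (simp_all add: scaleR_conv_of_real field_simps)
    then show ?thesis unfolding n0 \<Theta>_def by (simp only: vector_minus_component vector_scaleR_component J_nth)
  qed
  ultimately show ?thesis by (simp add: vec_eq_iff)
qed

text \<open>Only the \<open>codiff\<close> term of \<open>ricci_form\<close> depends on r. It agrees
  with \<open>J_theta\<close> throughout the open set V, so the exterior derivatives agree as well.
  Both halves of \<open>part11\<close> have the same trace by J-invariance.\<close>

lemma scal_eq: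
  assumes z: "z \<in> V" and theta: "\<And>v. smooth_on V (\<lambda>z. theta z v)"
  shows "scal r V \<omega> z = scal 1 V \<omega> z + (r - 1) * trace_d z J_theta"
proof -
  let ?C = "codiff V G 1 \<omega>"
  have C: "?C w [x] = J_theta w [x]" if "w \<in> V" for w x
    by (rule codiff_eq[OF _ is_codiff_\<omega>[OF theta] that]) auto
  have dC: "ext_d ?C z [x, y] = ext_d J_theta z [x, y]" for x y
    unfolding ext_d_1 using dir_deriv_cong_open[OF open_V z C] by simp
  have B: "bilinear (\<lambda>x y. ext_d J_theta z [x, J y])"
  proof (rule bilinear_compose_J)
    show "bilinear (\<lambda>x y. ext_d J_theta z [x, y])"
      using bilinear_deriv_form[OF form_J_theta[OF theta] z] unfolding ext_d_1 bilinear_def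
      by (auto intro!: linear_compose_sub)
  qed
  have tr: "(\<Sum>c\<in>UNIV. ext_d J_theta z [fr z c, J (fr z c)]) = 2 * trace_d z J_theta"
    using trace_ext_d[OF form_J_theta[OF theta] z] by simp
  have tr': "(\<Sum>c\<in>UNIV. ext_d J_theta z [J (fr z c), J (J (fr z c))]) = 2 * trace_d z J_theta"
    unfolding trace_J_G[OF z B] by (rule tr)
  have "part11 (ricci_form r V \<omega> z) [x, J x] = part11 (ricci_form 1 V \<omega> z) [x, J x]
     + (r - 1) / 4 * (ext_d J_theta z [x, J x] + ext_d J_theta z [J x, J (J x)])" for x
    by (simp add: part11_def ricci_form_def dC[unfolded One_nat_def] field_simps del: J_simps)
  then have S: "(\<Sum>c\<in>UNIV. part11 (ricci_form r V \<omega> z) [fr z c, J (fr z c)])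
     = (\<Sum>c\<in>UNIV. part11 (ricci_form 1 V \<omega> z) [fr z c, J (fr z c)]) + (r - 1) / 4 * (2 * trace_d z J_theta + 2 * trace_d z J_theta)"
    by (simp only: sum.distrib sum_distrib_left[symmetric] tr tr')
  show ?thesis
    unfolding scal_def trace_omega_def metric_trace_fr S by simp
qed

lemma mu_eq:
  assumes n: "CARD('n) \<ge> 2" and z: "z \<in> V"
  shows "mu r t V \<omega> z = mu 1 t V \<omega> z - (real CARD('n) - 1) / 2 * (r - 1) *
     tensor_norm_sq (G z) (tracefree_torsion V \<omega> z)"
proof -
  interpret hermitian_jet "a z" "da z" rewrites "hermitian_form.g (a z) = G z"
    by (rule hermitian_jet_a[OF z]) (rule g_eq[OF z])
  have "is_lee_form V \<omega> (lee_form V \<omega>)"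
    unfolding lee_form_def using theta_is_lee_form(1)[OF n] by (rule someI[of "is_lee_form V \<omega>"])
  then have lee: "lee_form V \<omega> w [v] = theta w v" if "w \<in> V" for w v
    using theta_is_lee_form(2)[OF n _ that] by blast
  have "form_on V 1 (\<lambda>z vs. theta z (vs ! 0))"
    using theta_is_lee_form(1)[OF n] unfolding is_lee_form_def by blast
  then have theta: "smooth_on V (\<lambda>z. theta z v)" for v
    unfolding form_on_1 by simp
  define N where "N = tensor_norm_sq (G z) (torsion 1 \<omega> z)"
  define L where "L = (\<Sum>c\<in>UNIV. (theta z (fr z c))\<^sup>2)"
  define m where "m = real CARD('n) - 1"
  have m: "m > 0" using n by (simp add: m_def)
  have cod: "codiff V G 0 (lee_form V \<omega>) z [] = trace_d z J_theta - L"
    unfolding L_def by (rule codiff_eq[OF _ is_codiff_lee[OF theta lee] z]) auto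
  have tf: "tensor_norm_sq (G z) (tracefree_torsion V \<omega> z) = N - 2 / m * L"
    using norm_tracefree[OF fr[OF z], of "torsion 1 \<omega> z", OF G_torsion[OF z] n]
    unfolding tensor_norm_sq_def metric_trace_fr N_def L_def m_def
      tracefree_torsion_eq[OF z lee[OF z]] lee_part_def[OF fr[OF z]] theta_eq[OF z, symmetric]
      lee_sq_def[OF fr[OF z]] .
  have K: "3 * r\<^sup>2 - 2 * r + 1 > 0"
  proof -
    have "(r - 1)\<^sup>2 + r\<^sup>2 > 0" unfolding sum_power2_gt_zero_iff by auto
    moreover have "3 * r\<^sup>2 - 2 * r + 1 = (r - 1)\<^sup>2 + r\<^sup>2 + r\<^sup>2"
      by (simp add: power2_eq_square algebra_simps)
    ultimately show ?thesis using zero_le_power2[of r] by linarith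
  qed
  \<comment> \<open>Applied with k = K_r, whose positivity was just shown: the K_r in the
    denominator of \<mu> meets the one from \<open>norm_torsion\<close>.\<close>
  have cancel: "x / (2 * k) * (k / 2 * N) = x / 4 * N" if "k > 0" for x k :: real
    using that by (simp add: field_simps)
  have "mu r t V \<omega> z = scal 1 V \<omega> z + (r - 1) * trace_d z J_theta + (t - (1 + m * r)) / m * (trace_d z J_theta - L)
      + (t - 2 * (1 + m * r)) / 4 * N"
    unfolding mu_def Let_def scal_eq[OF z theta, of r] norm_torsion[OF z, of r] N_def[symmetric] cod m_def[symmetric]
    by (simp only: cancel[OF K])
  moreover have "mu 1 t V \<omega> z = scal 1 V \<omega> z + (t - (1 + m)) / m * (trace_d z J_theta - L)
      + (t - 2 * (1 + m)) / 4 * N"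
    unfolding mu_def Let_def N_def[symmetric] cod m_def[symmetric] by simp
  ultimately show ?thesis
    unfolding tf m_def[symmetric] using m by (simp add: field_simps)
qed

end

theorem proposition2p5:
  fixes M :: "'m topology"
    and A :: "('m, 'n::finite) hol_chart set"
    and \<omega> :: "('m, 'n) hol_chart \<Rightarrow> 'n form_field"
    and r t :: real
  assumes "CARD('n) \<ge> 2"
    and "complex_manifold M A"
    and "compact_space M"
    and "connected_space M"
    and "hermitian_metric A \<omega>"
  shows "\<forall>(U, \<phi>)\<in>A. \<forall>x\<in>U.
     mu r t (\<phi> ` U) (\<omega> (U, \<phi>)) (\<phi> x) =
     mu 1 t (\<phi> ` U) (\<omega> (U, \<phi>)) (\<phi> x)
       - (real CARD('n) - 1) / 2 * (r - 1) *
         tensor_norm_sq (assoc_metric (\<omega> (U, \<phi>)) (\<phi> x))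
           (tracefree_torsion (\<phi> ` U) (\<omega> (U, \<phi>)) (\<phi> x))"
proof (intro ballI, clarify)
  fix U \<phi> x assume c: "(U, \<phi>) \<in> A" and x: "x \<in> U"
  have "open (\<phi> ` U)" using assms(2) c unfolding complex_manifold_def by blast
  then have "hermitian_patch (\<phi> ` U) (\<omega> (U, \<phi>))"
    using assms(5) c unfolding hermitian_metric_def by unfold_locales force+
  then show "mu r t (\<phi> ` U) (\<omega> (U, \<phi>)) (\<phi> x) = mu 1 t (\<phi> ` U) (\<omega> (U, \<phi>)) (\<phi> x)
       - (real CARD('n) - 1) / 2 * (r - 1) *
         tensor_norm_sq (assoc_metric (\<omega> (U, \<phi>)) (\<phi> x))
           (tracefree_torsion (\<phi> ` U) (\<omega> (U, \<phi>)) (\<phi> x))"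
    using x by (intro hermitian_patch.mu_eq assms(1)) auto
qed

end
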